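(* Let $L$ be a nonlattice lifetime distribution with mean $\mu$, variance $\sigma_L^2$, and rational probability generating function $F(z)=P(z)/Q(z)$ written in lowest terms, where $P,Q$ are real polynomials. Let $M\ge 1$ be an integer and let $Y_t$ be the superposition of $M$ independent stationary renewal count sequences with lifetime $L$. Then $Y_t$ is a causal and invertible ARMA process. Moreover, its autocovariance generating function $G(z)$ can be factorized as $$G(z)=\frac{kM}{\mu}\,\frac{\theta(z)\,\theta\!\left(\frac1z\right)}{\phi(z)\,\phi\!\left(\frac1z\right)},\qquad k=\frac{\sigma_L^2\,Q^2(1)}{\theta^2(1)\,Q^2(0)},$$ where $\phi(z)$ and $\theta(z)$ are real polynomials with constant term $1$ that have all their zeros outside the unit circle and have no common zeros.
   Context: Lifetime distribution: a random variable $L$ with values in $\{1,2,\dots\}$, $P(L=n)=f_n$, and $0<f_1<1$. It is called lattice if there is an integer $d>1$ such that $\sum_{k=0}^\infty P(L=kd)=1$, and nonlattice otherwise. Its probability generating function is $F(z)=\sum_{n\ge1}f_nz^n$. Here $F$ is rational, and $F(z)=P(z)/Q(z)$ in lowest terms means that $P,Q$ are polynomials with no common factors. Stationary renewal count sequence: let $L_0,L_1,L_2,\dots$ be independent, with $L_1,L_2,\dots$ distributed as $L$ and $P(L_0=n)=\mu^{-1}P(L>n)$ for $n\ge0$, where $\mu=E[L]$. Set $X_t=1$ if $L_0+L_1+\cdots+L_k=t$ for some $k\ge0$, and $X_t=0$ otherwise ($t\ge 0$). The sequence $X_t$ is strictly stationary. Taking $M$ independent copies $X_{1,t},\dots,X_{M,t}$,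 put $Y_t=\sum_{i=1}^M X_{i,t}$. This is a strictly stationary process with binomial marginals. The autocovariance generating function is $G(z)=\sum_{h=-\infty}^\infty\gamma(h)z^h$, where $\gamma(h)=\gamma(-h)=\mathrm{cov}(Y_t,Y_{t+h})$. It is viewed as a Laurent series near $|z|=1$ and the rational function it represents. ARMA: a stationary process $X_t$ is ARMA$(p,q)$ if for every $t$ one has $X_t-\phi_1X_{t-1}-\cdots-\phi_pX_{t-p}=Z_t+\theta_1Z_{t-1}+\cdots+\theta_qZ_{t-q}$, where $Z_t$ is white noise with variance $\sigma^2$. For a process with nonzero mean such as $Y_t$ the equation is understood for the mean-centered process, extended by stationarity to all integer times. The characteristic polynomials are $\phi(z)=1-\phi_1z-\cdots-\phi_pz^p$ and $\theta(z)=1+\theta_1z+\cdots+\theta_qz^q$. The ARMA process is causal and invertible if $\phi$ and $\theta$, respectively, have no zeros in $|z|\le1$. "Outside the unit circle" means $|z|>1$.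
   Formalization: It is additionally assumed that L is not concentrated on a shifted lattice a+dZ with d>1; without this the claim fails, e.g. for P(L=1)=P(L=3)=1/2, where G(-1)=0, and it fails for every lifetime so excluded. *)

theory Defs
  imports "HOL-Probability.Probability" "HOL-Computational_Algebra.Polynomial"
begin

definition cpoly :: "real poly \<Rightarrow> complex \<Rightarrow> complex" where
  "cpoly p z = poly (map_poly complex_of_real p) z"

definition cov :: "'a measure \<Rightarrow> ('a \<Rightarrow> real) \<Rightarrow> ('a \<Rightarrow> real) \<Rightarrow> real" where
  "cov N U V = (\<integral>\<omega>. (U \<omega> - (\<integral>x. U x \<partial>N)) * (V \<omega> - (\<integral>x. V x \<partial>N)) \<partial>N)"

definition lifetime :: "nat pmf \<Rightarrow> bool" where
  "lifetime p \<longleftrightarrow> pmf p 0 = 0 \<and> 0 < pmf p 1 \<and> pmf p 1 < 1"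

definition lattice_lifetime :: "nat pmf \<Rightarrow> bool" where
  "lattice_lifetime p \<longleftrightarrow> (\<exists>d::nat. d > 1 \<and> (\<Sum>k. pmf p (k * d)) = 1)"

(* Lattice up to a shift: concentrated on some a + d * Z with d > 1.  Excluding only
   lattice_lifetime (a = 0) does not keep the moving-average polynomial free of zeros on the
   unit circle: for P(L=1) = P(L=3) = 1/2 and M = 1 the autocovariance generating function is
   (1 + z) (1 + 1/z) / (2 (2 + z + z^2) (2 + 1/z + 1/z^2)), which vanishes at z = -1. *)
definition shifted_lattice_lifetime :: "nat pmf \<Rightarrow> bool" where
  "shifted_lattice_lifetime p \<longleftrightarrow>
     (\<exists>a d::nat. d > 1 \<and> (\<Sum>k. pmf p (a + k * d)) = 1)"

definition pgf :: "nat pmf \<Rightarrow> complex \<Rightarrow> complex" where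
  "pgf p z = (\<Sum>n. of_real (pmf p n) * z ^ n)"

(* Q is not assumed to be zero-free in the disc; this follows from coprimality. *)
definition pgf_lowest_terms :: "nat pmf \<Rightarrow> real poly \<Rightarrow> real poly \<Rightarrow> bool" where
  "pgf_lowest_terms p P Q \<longleftrightarrow> Q \<noteq> 0 \<and> coprime P Q \<and>
     (\<forall>z. norm z < 1 \<and> cpoly Q z \<noteq> 0 \<longrightarrow> pgf p z = cpoly P z / cpoly Q z)"

definition lifetime_mean :: "nat pmf \<Rightarrow> real" where
  "lifetime_mean p = measure_pmf.expectation p real"

definition lifetime_variance :: "nat pmf \<Rightarrow> real" where
  "lifetime_variance p = measure_pmf.variance p real"

definition stationary_renewal_count ::
    "'a measure \<Rightarrow> nat pmf \<Rightarrow> (nat \<Rightarrow> 'a \<Rightarrow> real) \<Rightarrow> bool" where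
  "stationary_renewal_count N p X \<longleftrightarrow>
     (\<exists>L :: nat \<Rightarrow> 'a \<Rightarrow> nat.
        prob_space.indep_vars N (\<lambda>_. count_space UNIV) L UNIV \<and>
        (\<forall>k\<ge>1. distr N (count_space UNIV) (L k) = measure_pmf p) \<and>
        (\<forall>n. measure N {\<omega> \<in> space N. L 0 \<omega> = n}
             = measure_pmf.prob p {n<..} / lifetime_mean p) \<and>
        (\<forall>t. \<forall>\<omega>\<in>space N.
           X t \<omega> = (if \<exists>k. (\<Sum>j\<le>k. L j \<omega>) = t then 1 else 0)))"

definition renewal_superposition ::
    "'a measure \<Rightarrow> nat pmf \<Rightarrow> nat \<Rightarrow> (nat \<Rightarrow> 'a \<Rightarrow> real) \<Rightarrow> bool" where
  "renewal_superposition N p m Y \<longleftrightarrow>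
     (\<exists>X :: nat \<Rightarrow> nat \<Rightarrow> 'a \<Rightarrow> real.
        (\<forall>i\<in>{1..m}. stationary_renewal_count N p (X i)) \<and>
        prob_space.indep_vars N (\<lambda>_. PiM UNIV (\<lambda>_::nat. borel)) (\<lambda>i \<omega> t. X i t \<omega>) {1..m} \<and>
        (\<forall>t. \<forall>\<omega>\<in>space N. Y t \<omega> = (\<Sum>i=1..m. X i t \<omega>)))"

(* For a process on t >= 0; by stationarity the base time 0 is immaterial. *)
definition autocov :: "'a measure \<Rightarrow> (nat \<Rightarrow> 'a \<Rightarrow> real) \<Rightarrow> int \<Rightarrow> real" where
  "autocov N Y h = cov N (Y 0) (Y (nat \<bar>h\<bar>))"

definition strictly_stationary :: "'a measure \<Rightarrow> (int \<Rightarrow> 'a \<Rightarrow> real) \<Rightarrow> bool" where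
  "strictly_stationary N W \<longleftrightarrow> (\<forall>t. W t \<in> borel_measurable N) \<and>
     (\<forall>s. distr N (PiM UNIV (\<lambda>_::int. borel)) (\<lambda>\<omega> t. W (t + s) \<omega>)
        = distr N (PiM UNIV (\<lambda>_::int. borel)) (\<lambda>\<omega> t. W t \<omega>))"

definition two_sided_extension ::
    "'a measure \<Rightarrow> (nat \<Rightarrow> 'a \<Rightarrow> real) \<Rightarrow> 'b measure \<Rightarrow> (int \<Rightarrow> 'b \<Rightarrow> real) \<Rightarrow> bool" where
  "two_sided_extension \<Omega> Y N W \<longleftrightarrow> prob_space N \<and> strictly_stationary N W \<and>
     distr N (PiM UNIV (\<lambda>_::nat. borel)) (\<lambda>\<omega> t. W (int t) \<omega>)
       = distr \<Omega> (PiM UNIV (\<lambda>_::nat. borel)) (\<lambda>\<omega> t. Y t \<omega>)"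

definition weakly_stationary :: "'a measure \<Rightarrow> (int \<Rightarrow> 'a \<Rightarrow> real) \<Rightarrow> bool" where
  "weakly_stationary N W \<longleftrightarrow>
     (\<forall>t. W t \<in> borel_measurable N \<and> integrable N (\<lambda>\<omega>. (W t \<omega>)\<^sup>2)) \<and>
     (\<forall>s t. (\<integral>\<omega>. W s \<omega> \<partial>N) = (\<integral>\<omega>. W t \<omega> \<partial>N)) \<and>
     (\<forall>s t h. cov N (W s) (W (s + h)) = cov N (W t) (W (t + h)))"

definition white_noise :: "'a measure \<Rightarrow> real \<Rightarrow> (int \<Rightarrow> 'a \<Rightarrow> real) \<Rightarrow> bool" where
  "white_noise N v Z \<longleftrightarrow> v > 0 \<and>
     (\<forall>t. Z t \<in> borel_measurable N \<and> integrable N (\<lambda>\<omega>. (Z t \<omega>)\<^sup>2) \<and>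
          (\<integral>\<omega>. Z t \<omega> \<partial>N) = 0) \<and>
     (\<forall>s t. cov N (Z s) (Z t) = (if s = t then v else 0))"

definition ar_charpoly :: "nat \<Rightarrow> (nat \<Rightarrow> real) \<Rightarrow> real poly" where
  "ar_charpoly p a = 1 - (\<Sum>i=1..p. monom (a i) i)"

definition ma_charpoly :: "nat \<Rightarrow> (nat \<Rightarrow> real) \<Rightarrow> real poly" where
  "ma_charpoly q b = 1 + (\<Sum>j=1..q. monom (b j) j)"

(* The ARMA(p,q) equation for the mean-centered process, with AR coefficients a 1, ..., a p
   and MA coefficients b 1, ..., b q. *)
definition ARMA ::
    "'a measure \<Rightarrow> (int \<Rightarrow> 'a \<Rightarrow> real) \<Rightarrow> nat \<Rightarrow> nat \<Rightarrow> (nat \<Rightarrow> real) \<Rightarrow> (nat \<Rightarrow> real) \<Rightarrow> bool" where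
  "ARMA N W p q a b \<longleftrightarrow> weakly_stationary N W \<and>
     (\<exists>v Z. white_noise N v Z \<and>
        (let V = (\<lambda>t \<omega>. W t \<omega> - (\<integral>x. W t x \<partial>N)) in
         \<forall>t. AE \<omega> in N.
           V t \<omega> - (\<Sum>i=1..p. a i * V (t - int i) \<omega>)
             = Z t \<omega> + (\<Sum>j=1..q. b j * Z (t - int j) \<omega>)))"

definition causal_invertible_ARMA ::
    "'a measure \<Rightarrow> (int \<Rightarrow> 'a \<Rightarrow> real) \<Rightarrow> nat \<Rightarrow> nat \<Rightarrow> (nat \<Rightarrow> real) \<Rightarrow> (nat \<Rightarrow> real) \<Rightarrow> bool" where
  "causal_invertible_ARMA N W p q a b \<longleftrightarrow> ARMA N W p q a b \<and>
     (\<forall>z. norm z \<le> 1 \<longrightarrow> cpoly (ar_charpoly p a) z \<noteq> 0) \<and>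
     (\<forall>z. norm z \<le> 1 \<longrightarrow> cpoly (ma_charpoly q b) z \<noteq> 0)"

end

theory Submission
  imports Defs "HOL-Complex_Analysis.Complex_Analysis"
    "HOL-Computational_Algebra.Computational_Algebra"
    "HOL-Computational_Algebra.Field_as_Ring" "HOL-Library.Real_Mod"
begin

text \<open>
Write $u_h$ for the probability that a renewal occurs $h$ time units after a renewal, and
$U(z) = \sum_h u_h z^h$.  A stationary renewal process has $P(X_h = 1) = 1/\mu$ for every $h$;
conditioning on the delay $L_0$ turns this into the renewal equation, that is $U = 1/(1-F)$, and
independence of $L_0$ from the later lifetimes gives $P(X_0 = X_h = 1) = u_h/\mu$.  Hence one copy
has autocovariance $(u_{|h|} - 1/\mu)/\mu$, and $M$ uncorrelated copies give
$G(z) = (M/\mu)\,(A(z) + A(1/z) - a_0)$ with $A(z) = \sum_h a_h z^h$, $a_h = u_h - 1/\mu$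
(\<open>renewal_superposition_properties\<close>).

Next, $A$ is made explicit (\<open>renewal_covariance_factorization\<close>).  Since $QF = P$ on the closed
disc and $P,Q$ have no common zero, $Q$ has no zero there; so $F$ converges beyond the
unit circle and all moments of $L$ are finite.  On the closed disc $|F| < 1$ except at $z = 1$,
where $Q - P$ has a simple zero.  Therefore $Q - P = (1-z)\,Q(0)\,\phi$ with the zeros of $\phi$
outside the unit circle, the pole of $U$ at $1$ is cancelled in $A$, and $A = R/\phi$ with a polynomial
$R$.  Putting $G$ over the denominator $\phi(z)\phi(1/z)$ leaves the symmetric numerator
$B(z) = R(z)\phi(1/z) + R(1/z)\phi(z) - a_0\,\phi(z)\phi(1/z)$, and
\[ Q(0)^2 (1-z)(1-1/z)\,B(z) = Q(z)Q(1/z) - P(z)P(1/z). \]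
On the unit circle the right-hand side is $|Q|^2(1-|F|^2)$, which is positive for $z \ne 1$ because
$L$ is not concentrated on a shifted lattice; at $z = 1$ a second-order expansion gives
$B(1) = \sigma_L^2 Q(1)^2/Q(0)^2 > 0$.  So $B$ has no zero on the circle and the Fejer-Riesz
factorization (\<open>fejer_riesz\<close>) yields $B(z) = c\,\theta(z)\theta(1/z)$; the value at $1$ determines $c$.
A common zero of $\phi$ and $\theta$ would be a common zero of $P$ and $Q$.

For the ARMA equation let $V$ be the centred process and $\psi = \phi/\theta$, a power series converging
beyond the unit circle.  The process is bounded, so $Z_t = \sum_j \psi_j V_{t-j}$ converges absolutely
at almost every point of whatever probability space carries the two-sided process, and, with $S$ the
backshift, $\phi(S)V = \theta(S)Z$ is a comparison of coefficients.  The autocovariances of $Z$ have generating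
function $\psi(z)\psi(1/z)G(z)$, which is constant on the unit circle; a Laurent series that is constant
there has only its constant coefficient, so $Z$ is white noise (\<open>ARMA_of_rational_spectrum\<close>).

A two-sided extension exists by Kolmogorov's theorem once the one-sided process is known to be strictly
stationary.  That follows from an explicit map on lifetime sequences (\<open>advance\<close>) which moves
the observation time by one unit and preserves the law of the sequence of lifetimes.
\<close>

section \<open>Evaluating real polynomials at complex points\<close>

lemma cpoly_altdef: "cpoly p z = (\<Sum>i\<le>degree p. of_real (coeff p i) * z ^ i)"
  by (simp add: cpoly_def poly_altdef degree_map_poly coeff_map_poly)

lemma map_poly_of_real_mult:
  "map_poly complex_of_real (p * q) = map_poly complex_of_real p * map_poly complex_of_real q"
  by (rule poly_eqI) (simp add: coeff_map_poly coeff_mult)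

lemma map_poly_of_real_add:
  "map_poly complex_of_real (p + q) = map_poly complex_of_real p + map_poly complex_of_real q"
  by (rule poly_eqI) (simp add: coeff_map_poly)

lemma map_poly_of_real_diff:
  "map_poly complex_of_real (p - q) = map_poly complex_of_real p - map_poly complex_of_real q"
  by (rule poly_eqI) (simp add: coeff_map_poly)

lemma cpoly_mult [simp]: "cpoly (p * q) z = cpoly p z * cpoly q z"
  by (simp add: cpoly_def map_poly_of_real_mult)

lemma cpoly_add [simp]: "cpoly (p + q) z = cpoly p z + cpoly q z"
  by (simp add: cpoly_def map_poly_of_real_add)

lemma cpoly_diff [simp]: "cpoly (p - q) z = cpoly p z - cpoly q z"
  by (simp add: cpoly_def map_poly_of_real_diff)

lemma cpoly_smult [simp]: "cpoly (smult c p) z = of_real c * cpoly p z"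
  by (simp add: cpoly_def map_poly_smult)

lemma cpoly_minus [simp]: "cpoly (- p) z = - cpoly p z"
  using cpoly_smult[of "-1" p z] by simp

lemma cpoly_pCons [simp]: "cpoly (pCons c p) z = of_real c + z * cpoly p z"
  by (simp add: cpoly_def map_poly_pCons)

lemma cpoly_0 [simp]: "cpoly 0 z = 0"
  by (simp add: cpoly_def)

lemma cpoly_1 [simp]: "cpoly 1 z = 1"
  by (simp add: cpoly_def)

lemma cpoly_monom [simp]: "cpoly (monom c n) z = of_real c * z ^ n"
  by (simp add: cpoly_def map_poly_monom poly_monom)

lemma cpoly_of_real [simp]: "cpoly p (of_real x) = of_real (poly p x)"
  by (simp add: cpoly_altdef poly_altdef)

lemma cpoly_at_0 [simp]: "cpoly p 0 = of_real (poly p 0)"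
  using cpoly_of_real[of p 0] by simp

lemma cpoly_at_1 [simp]: "cpoly p 1 = of_real (poly p 1)"
  using cpoly_of_real[of p 1] by simp

lemma cnj_cpoly: "cnj (cpoly p z) = cpoly p (cnj z)"
  by (simp add: cpoly_altdef)

lemma continuous_on_cpoly: "continuous_on A (cpoly p)"
  unfolding cpoly_def by (intro continuous_intros)

lemma finite_cpoly_roots: "p \<noteq> 0 \<Longrightarrow> finite {z. cpoly p z = 0}"
  unfolding cpoly_def by (rule poly_roots_finite) (simp add: map_poly_eq_0_iff)

lemma cpoly_reflect_poly:
  "z \<noteq> 0 \<Longrightarrow> cpoly (reflect_poly p) z = z ^ degree p * cpoly p (1 / z)"
proof -
  assume z: "z \<noteq> 0"
  have "map_poly complex_of_real (reflect_poly p) = reflect_poly (map_poly complex_of_real p)"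
    by (rule poly_eqI) (simp add: coeff_map_poly coeff_reflect_poly degree_map_poly)
  then show ?thesis using z
    by (simp add: cpoly_def poly_reflect_poly_nz degree_map_poly inverse_eq_divide)
qed

section \<open>Fejer-Riesz factorization\<close>

text \<open>
Conjugating a factorization $p = (z-w)^m s$ coefficientwise moves the zero to the conjugate of $w$ and
leaves a real $p$ unchanged.
\<close>

lemma order_cnj_le:
  fixes p :: "complex poly"
  assumes p: "p \<noteq> 0" and real: "map_poly cnj p = p"
  shows "order w p \<le> order (cnj w) p"
proof -
  obtain s where s: "p = [:-w, 1:] ^ order w p * s"
    using order_1[of w p] by (elim dvdE)
  have "poly p z = poly ([:- cnj w, 1:] ^ order w p * map_poly cnj s) z" for z
  proof -
    have "poly p z = cnj (poly p (cnj z))"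
      using poly_map_poly_cnj[of p z] real by simp
    also have "\<dots> = cnj (poly ([:-w, 1:] ^ order w p * s) (cnj z))"
      using s by simp
    finally show ?thesis by simp
  qed
  then have "p = [:- cnj w, 1:] ^ order w p * map_poly cnj s"
    by (simp add: poly_eq_poly_eq_iff[symmetric] fun_eq_iff)
  then have "[:- cnj w, 1:] ^ order w p dvd p" by (metis dvdI)
  then show ?thesis using p by (simp add: order_divides)
qed

lemma order_cnj:
  fixes p :: "complex poly"
  assumes "p \<noteq> 0" "map_poly cnj p = p"
  shows "order (cnj w) p = order w p"
  using order_cnj_le[OF assms, of w] order_cnj_le[OF assms, of "cnj w"] by simp

text \<open>
Reversing the coefficients is multiplicative and turns $z - 1/w$ into a multiple of $z - w$.
\<close>

lemma order_inverse_le_order_reflect: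
  fixes p :: "complex poly"
  assumes p: "p \<noteq> 0" and w: "w \<noteq> 0"
  shows "order (1 / w) p \<le> order w (reflect_poly p)"
proof -
  let ?m = "order (1 / w) p"
  have "reflect_poly [:-(1/w), 1:] = smult (-(1/w)) [:-w, 1:]"
    using w by (simp add: reflect_poly_pCons)
  moreover obtain s where "p = [:-(1/w), 1:] ^ ?m * s"
    using order_1[of "1 / w" p] by (elim dvdE)
  ultimately have "reflect_poly p = (smult (-(1/w)) [:-w, 1:]) ^ ?m * reflect_poly s"
    by (metis reflect_poly_mult reflect_poly_power)
  also have "\<dots> = [:-w, 1:] ^ ?m * smult ((-(1/w)) ^ ?m) (reflect_poly s)"
    by (simp only: smult_power mult_smult_left mult_smult_right)
  finally have "[:-w, 1:] ^ ?m dvd reflect_poly p" by (intro dvdI)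
  then show ?thesis using p by (simp add: order_divides)
qed

text \<open>
The symmetry says that $p$ and its reversal agree up to powers of $z$, and powers of $z$ do not affect
the order at $w \ne 0$.
\<close>

lemma order_inverse_le:
  fixes p :: "complex poly"
  assumes p: "p \<noteq> 0" and w: "w \<noteq> 0"
    and sym: "\<And>z. z \<noteq> 0 \<Longrightarrow> poly p z = z ^ k * poly p (1 / z)"
  shows "order (1 / w) p \<le> order w p"
proof -
  \<comment> \<open>The symmetry is silent about $z = 0$; an extra factor $z$ makes both sides vanish there.\<close>
  have "poly (monom 1 (Suc (degree p)) * p) z = poly (monom 1 (Suc k) * reflect_poly p) z" for z
  proof (cases "z = 0")
    case False
    then show ?thesis using sym[OF False]
      by (simp add: poly_monom poly_reflect_poly_nz inverse_eq_divide)
  qed (simp add: poly_monom)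
  then have eq: "monom 1 (Suc (degree p)) * p = monom 1 (Suc k) * reflect_poly p"
    by (simp add: poly_eq_poly_eq_iff[symmetric] fun_eq_iff)
  have o: "order w (monom 1 j) = 0" for j
    using w by (intro order_0I) (simp add: poly_monom)
  have "order w (monom 1 (Suc (degree p)) * p) = order w p"
    using p by (subst order_mult) (simp_all add: o monom_eq_0_iff)
  moreover have "order w (monom 1 (Suc k) * reflect_poly p) = order w (reflect_poly p)"
    using p by (subst order_mult) (simp_all add: o monom_eq_0_iff)
  ultimately show ?thesis
    using order_inverse_le_order_reflect[OF p w] eq by simp
qed

lemma order_inverse:
  fixes p :: "complex poly"
  assumes "p \<noteq> 0" "w \<noteq> 0" "\<And>z. z \<noteq> 0 \<Longrightarrow> poly p z = z ^ k * poly p (1 / z)"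
  shows "order (1 / w) p = order w p"
  using order_inverse_le[OF assms(1,2), of k] order_inverse_le[OF assms(1), of "1 / w" k] assms
  by fastforce

text \<open>
The symmetry $q(z) = z^{2n} q(1/z)$ makes the multiplicities of the zeros $w$ and $1/w$ equal.  With no
zeros on the circle, the nonzero zeros therefore split into those outside and their reciprocals, and
$\theta$ collects the factors $1 - z/w$ of the former; the latter are collected by $\theta(1/z)$ up to a
constant and a power of $z$.  Because $q$ is real, zeros come in conjugate pairs of equal multiplicity, so $\theta$ is
real.
\<close>

theorem fejer_riesz:
  fixes q :: "real poly"
  assumes sym: "\<And>z. z \<noteq> 0 \<Longrightarrow> cpoly q z = z ^ (2 * n) * cpoly q (1 / z)"
    and nz: "\<And>z. norm z = 1 \<Longrightarrow> cpoly q z \<noteq> 0"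
  obtains \<theta> c where "poly \<theta> 0 = 1" "\<And>z. cpoly \<theta> z = 0 \<Longrightarrow> norm z > 1"
    "\<And>z. z \<noteq> 0 \<Longrightarrow> cpoly q z = of_real c * z ^ n * cpoly \<theta> z * cpoly \<theta> (1 / z)"
proof -
  define p where "p = map_poly complex_of_real q"
  have cq: "cpoly q z = poly p z" for z by (simp add: cpoly_def p_def)
  have p0: "p \<noteq> 0" using nz[of 1] unfolding cq by auto
  have p_real: "map_poly cnj p = p" by (simp add: p_def map_poly_map_poly o_def)
  have psym: "poly p z = z ^ (2 * n) * poly p (1 / z)" if "z \<noteq> 0" for z
    using sym[OF that] by (simp add: cq)
  define m where "m w = order w p" for w
  have m_inv: "m (1 / w) = m w" if "w \<noteq> 0" for w
    unfolding m_def using order_inverse[OF p0 that psym] .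
  have m_cnj: "m (cnj w) = m w" for w
    unfolding m_def by (rule order_cnj[OF p0 p_real])
  define S where "S = {w. poly p w = 0}"
  define So where "So = {w \<in> S. norm w > 1}"
  define Si where "Si = {w \<in> S. w \<noteq> 0 \<and> norm w < 1}"
  define S0 where "S0 = S \<inter> {0}"
  have fin: "finite S" unfolding S_def using p0 by (rule poly_roots_finite)
  have fins [simp]: "finite So" "finite Si" "finite S0"
    using fin by (auto simp: So_def Si_def S0_def)
  have S_iff: "w \<in> S \<longleftrightarrow> m w \<noteq> 0" for w
    using p0 by (simp add: S_def m_def order_root)
  have Sn: "norm w \<noteq> 1" if "w \<in> S" for w using that nz[of w] by (auto simp: S_def cq)
  have SU: "S = S0 \<union> Si \<union> So" using Sn by (force simp: So_def Si_def S0_def)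
  have So0: "w \<noteq> 0" if "w \<in> So" for w using that by (auto simp: So_def)
  have decomp: "poly p z = lead_coeff p * (\<Prod>w\<in>S. (z - w) ^ m w)" for z
  proof -
    have "poly p z = poly (smult (lead_coeff p) (\<Prod>w\<in>S. [:-w, 1:] ^ m w)) z"
      unfolding S_def m_def by (simp only: complex_poly_decompose)
    also have "\<dots> = lead_coeff p * (\<Prod>w\<in>S. (z - w) ^ m w)"
      by (simp add: poly_prod)
    finally show ?thesis .
  qed
  define D where "D = (\<Prod>w\<in>So. [:1, -(1/w):] ^ m w)"
  have D: "poly D z = (\<Prod>w\<in>So. (1 - z / w) ^ m w)" for z
    by (simp add: D_def poly_prod)
  have D_real: "map_poly cnj D = D"
  proof -
    have "poly (map_poly cnj D) z = poly D z" for z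
    proof -
      have "poly (map_poly cnj D) z = (\<Prod>w\<in>So. (1 - z / cnj w) ^ m w)"
        by (simp add: D)
      also have "\<dots> = (\<Prod>w\<in>So. (1 - z / w) ^ m w)"
        by (rule prod.reindex_bij_witness[of _ cnj cnj]) (auto simp: So_def S_iff m_cnj)
      finally show ?thesis by (simp add: D)
    qed
    then show ?thesis by (simp add: poly_eq_poly_eq_iff[symmetric] fun_eq_iff)
  qed
  define \<theta> where "\<theta> = map_poly Re D"
  have theta_D: "map_poly complex_of_real \<theta> = D"
  proof (rule poly_eqI)
    fix i
    have "cnj (coeff D i) = coeff D i"
      using arg_cong[OF D_real, of "\<lambda>p. coeff p i"] by (simp add: coeff_map_poly)
    then show "coeff (map_poly complex_of_real \<theta>) i = coeff D i"
      by (simp add: \<theta>_def coeff_map_poly complex_eq_iff)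
  qed
  have th: "cpoly \<theta> z = poly D z" for z by (simp add: cpoly_def theta_D)
  have th0: "poly \<theta> 0 = 1"
    using cpoly_at_0[of \<theta>] by (simp add: th D of_real_eq_1_iff[symmetric, where ?'a = complex] del: of_real_eq_1_iff cpoly_at_0)
  have thz: "norm z > 1" if "cpoly \<theta> z = 0" for z
  proof -
    from that obtain w where "w \<in> So" "1 - z / w = 0" by (auto simp: th D)
    then have "z = w" using So0 by (auto simp: field_simps)
    then show ?thesis using \<open>w \<in> So\<close> by (simp add: So_def)
  qed
  define e where "e = m 0"
  define K where "K = (\<Sum>w\<in>So. m w)"
  define C where "C = lead_coeff p * (\<Prod>w\<in>So. (-w) ^ m w)"
  have fact: "poly p z = C * z ^ (e + K) * poly D z * poly D (1 / z)" if z: "z \<noteq> 0" for z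
  proof -
    have 0: "(\<Prod>w\<in>S0. (z - w) ^ m w) = z ^ e"
      by (cases "0 \<in> S") (auto simp: S0_def e_def S_iff)
    have o: "(\<Prod>w\<in>So. (z - w) ^ m w) = (\<Prod>w\<in>So. (-w) ^ m w) * poly D z"
      unfolding D prod.distrib[symmetric] power_mult_distrib[symmetric]
    proof (intro prod.cong refl)
      fix w assume "w \<in> So"
      then have "z - w = - w * (1 - z / w)" using So0 by (simp add: field_simps)
      then show "(z - w) ^ m w = (- w * (1 - z / w)) ^ m w" by (simp only:)
    qed
    have "(\<Prod>w\<in>Si. (z - w) ^ m w) = (\<Prod>w\<in>So. (z - 1 / w) ^ m w)"
    proof (rule prod.reindex_bij_witness[of _ "\<lambda>w. 1 / w" "\<lambda>w. 1 / w"])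
      fix a assume a: "a \<in> Si"
      then have a0: "a \<noteq> 0" by (auto simp: Si_def)
      show "1 / (1 / a) = a" by simp
      show "1 / a \<in> So" using a m_inv[OF a0] a0
        by (auto simp: Si_def So_def S_iff norm_divide)
      show "(z - 1 / (1 / a)) ^ m (1 / a) = (z - a) ^ m a" using m_inv[OF a0] by simp
    next
      fix b assume b: "b \<in> So"
      then have b0: "b \<noteq> 0" by (rule So0)
      show "1 / (1 / b) = b" by simp
      show "1 / b \<in> Si" using b m_inv[OF b0] b0
        by (auto simp: Si_def So_def S_iff norm_divide)
    qed
    also have "\<dots> = (\<Prod>w\<in>So. z ^ m w * (1 - (1 / z) / w) ^ m w)"
      unfolding power_mult_distrib[symmetric]
    proof (intro prod.cong refl)
      fix w assume "w \<in> So"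
      then have "z - 1 / w = z * (1 - (1 / z) / w)" using So0 z by (simp add: right_diff_distrib)
      then show "(z - 1 / w) ^ m w = (z * (1 - (1 / z) / w)) ^ m w" by (simp only:)
    qed
    also have "\<dots> = z ^ K * poly D (1 / z)"
      unfolding D K_def by (simp add: prod.distrib power_sum)
    finally have i: "(\<Prod>w\<in>Si. (z - w) ^ m w) = z ^ K * poly D (1 / z)" .
    have "(\<Prod>w\<in>S. (z - w) ^ m w) = (\<Prod>w\<in>S0. (z - w) ^ m w) * (\<Prod>w\<in>Si. (z - w) ^ m w) * (\<Prod>w\<in>So. (z - w) ^ m w)"
    proof -
      have "S0 \<inter> Si = {}" "(S0 \<union> Si) \<inter> So = {}" by (auto simp: S0_def Si_def So_def)
      then show ?thesis unfolding SU by (simp add: prod.union_disjoint)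
    qed
    then show ?thesis unfolding decomp 0 i o C_def by (simp add: power_add algebra_simps)
  qed
  \<comment> \<open>The exponent is found by comparing both sides of the symmetry at a real point $t > 1$ that is not
    a zero.\<close>
  have eK: "e + K = n"
  proof -
    have "infinite ((complex_of_real ` {1<..<2}) - S)"
      using fin by (intro Diff_infinite_finite) (auto simp: finite_image_iff inj_on_def)
    then have "complex_of_real ` {1<..<2} - S \<noteq> {}" by (rule infinite_imp_nonempty)
    then obtain y where y: "y \<in> complex_of_real ` {1<..<2} - S" by blast
    then obtain t where "y = complex_of_real t" "1 < t" by auto
    with y have t: "1 < t" "poly p (complex_of_real t) \<noteq> 0" by (simp_all add: S_def)
    let ?z = "complex_of_real t"
    have z0: "?z \<noteq> 0" using t by auto
    have a: "poly p ?z = C * ?z ^ (e + K) * poly D ?z * poly D (1 / ?z)"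
      by (rule fact[OF z0])
    have b: "poly p (1 / ?z) = C * (1 / ?z) ^ (e + K) * poly D (1 / ?z) * poly D (1 / (1 / ?z))"
      by (rule fact) (use z0 in simp)
    have "poly p ?z * ?z ^ (2 * (e + K)) = ?z ^ (2 * n) * (poly p (1 / ?z) * ?z ^ (2 * (e + K)))"
      using psym[OF z0] by simp
    also have "poly p (1 / ?z) * ?z ^ (2 * (e + K)) = poly p ?z"
          proof -
      have pw: "(1 / ?z) ^ k * ?z ^ (2 * k) = ?z ^ k" for k
        using z0 by (simp add: power_one_over mult_2 power_add)
      have "poly p (1 / ?z) * ?z ^ (2 * (e + K)) = C * ((1 / ?z) ^ (e + K) * ?z ^ (2 * (e + K))) * poly D ?z * poly D (1 / ?z)"
        unfolding b by simp
      then show ?thesis unfolding pw a .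
    qed
    finally have "?z ^ (2 * (e + K)) = ?z ^ (2 * n)" using t by simp
    then have "t ^ (2 * (e + K)) = t ^ (2 * n)" by (simp flip: of_real_power)
    then have "2 * (e + K) = 2 * n" using t by (intro power_inject_exp[THEN iffD1]) auto
    then show ?thesis by simp
  qed
  have C_real: "C = of_real (Re C)"
  proof -
    have "of_real (poly q 1) = C * of_real ((poly \<theta> 1)\<^sup>2)"
    proof -
      have "poly p 1 = of_real (poly q 1)" using cpoly_at_1[of q] unfolding cq .
      moreover have "poly D 1 = of_real (poly \<theta> 1)" using cpoly_at_1[of \<theta>] unfolding th .
      ultimately show ?thesis using fact[of 1] by (simp add: power2_eq_square mult.assoc)
    qed
    moreover have "poly \<theta> 1 \<noteq> 0" using thz[of 1] by auto
    ultimately have "C = of_real (poly q 1 / (poly \<theta> 1)\<^sup>2)"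
      by (simp add: field_simps)
    then show ?thesis by simp
  qed
  show ?thesis
  proof (rule that[of \<theta> "Re C"])
    show "cpoly q z = complex_of_real (Re C) * z ^ n * cpoly \<theta> z * cpoly \<theta> (1 / z)" if "z \<noteq> 0" for z
      using fact[OF that] C_real by (simp add: cq th eK)
  qed (use th0 thz in auto)
qed

section \<open>Power series of rational functions\<close>

lemma zero_free_disc_enlarge:
  assumes "p \<noteq> 0" and nz: "\<And>z. norm z \<le> 1 \<Longrightarrow> cpoly p z \<noteq> 0"
  obtains r where "r > 1" "\<And>z. norm z < r \<Longrightarrow> cpoly p z \<noteq> 0"
proof -
  \<comment> \<open>The number $2$ stands in for the radius of a zero if there is none.\<close>
  let ?A = "insert 2 (norm ` {z. cpoly p z = 0})"
  have fin: "finite ?A" using finite_cpoly_roots[OF assms(1)] by simp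
  have "Min ?A \<in> ?A" by (rule Min_in[OF fin]) simp
  moreover have "x > 1" if "x \<in> ?A" for x using that nz by force
  ultimately have "Min ?A > 1" by blast
  moreover have "cpoly p z \<noteq> 0" if "norm z < Min ?A" for z
    using that Min_le[OF fin, of "norm z"] by auto
  ultimately show ?thesis using that by blast
qed

text \<open>
A quotient of polynomials is holomorphic on each disc in which the denominator does not vanish, so its
Taylor series at $0$ converges on that whole disc.  The coefficients enter only through the formal identity
$D \cdot \sum_n c_n z^n = N$; this is the form in which they are available for generating functions.
\<close>

lemma rational_power_series:
  fixes c :: "nat \<Rightarrow> real"
  assumes c: "fps_of_poly D * Abs_fps c = fps_of_poly N"
    and nz: "\<And>z. norm z < r \<Longrightarrow> cpoly D z \<noteq> 0" and z: "norm z < r"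
  shows "summable (\<lambda>n. norm (of_real (c n) * z ^ n))"
    and "(\<lambda>n. of_real (c n) * z ^ n) sums (cpoly N z / cpoly D z)"
proof -
  define f where "f = fps_of_poly (map_poly complex_of_real N)"
  define g where "g = fps_of_poly (map_poly complex_of_real D)"
  define C where "C = Abs_fps (\<lambda>n. complex_of_real (c n))"
  have r0: "r > 0" using z norm_ge_zero[of z] by linarith
  have g0: "fps_nth g 0 \<noteq> 0"
    using nz[of 0] r0 by (simp add: g_def coeff_map_poly poly_0_coeff_0)
  have "g * C = f"
  proof (rule fps_ext)
    fix n
    have "complex_of_real (fps_nth (fps_of_poly D * Abs_fps c) n) = of_real (fps_nth (fps_of_poly N) n)"
      using c by simp
    then show "fps_nth (g * C) n = fps_nth f n"
      by (simp add: fps_mult_nth g_def f_def C_def coeff_map_poly)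
  qed
  moreover have "g \<noteq> 0" using g0 by auto
  ultimately have Cfg: "C = f / g" by (auto simp: nonzero_mult_div_cancel_left)
  have R: "Min {ereal r, fps_conv_radius f, fps_conv_radius g} = ereal r"
    by (simp add: f_def g_def)
  have nz': "eval_fps g x \<noteq> 0" if "x \<in> eball 0 (ereal r)" for x
    using that nz[of x] by (simp add: g_def cpoly_def in_eball_iff dist_norm)
  note div = fps_conv_radius_divide'[of f g "ereal r"] eval_fps_divide'[of f g "ereal r" z]
  have rad: "ereal r \<le> fps_conv_radius C"
    unfolding Cfg using div(1) nz' r0 R by (simp add: f_def g_def)
  then have rad': "ereal (norm z) < fps_conv_radius C" using z
    by (meson ereal_less_eq(3) less_ereal.simps(1) less_le_trans)
  show "summable (\<lambda>n. norm (of_real (c n) * z ^ n))"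
    using norm_summable_fps[OF rad'] by (simp add: C_def)
  have "eval_fps C z = cpoly N z / cpoly D z"
    unfolding Cfg using div(2) nz' r0 R z by (simp add: f_def g_def cpoly_def)
  then show "(\<lambda>n. of_real (c n) * z ^ n) sums (cpoly N z / cpoly D z)"
    using sums_eval_fps[OF rad'] by (simp add: C_def)
qed

lemma rational_power_series_exists:
  assumes "poly D 0 \<noteq> 0"
  obtains c where "fps_of_poly D * Abs_fps c = fps_of_poly (N :: real poly)"
proof (rule that[of "fps_nth (fps_of_poly N / fps_of_poly D)"])
  have D0: "fps_nth (fps_of_poly D) 0 \<noteq> 0" using assms by (simp add: poly_0_coeff_0)
  have "fps_of_poly D * (fps_of_poly N / fps_of_poly D) = fps_of_poly N * (inverse (fps_of_poly D) * fps_of_poly D)"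
    unfolding fps_divide_unit[OF D0] by (simp only: mult_ac)
  also have "\<dots> = fps_of_poly N" unfolding inverse_mult_eq_1[OF D0] by simp
  finally show "fps_of_poly D * Abs_fps (fps_nth (fps_of_poly N / fps_of_poly D)) = fps_of_poly N"
    by (simp only: fps_nth_inverse)
qed

section \<open>Rational probability generating functions\<close>

lemma pmf_nat_sums_1: "pmf (p :: nat pmf) sums 1"
proof -
  have "(\<lambda>n. measure p {n}) sums measure p (\<Union>n. {n})"
    by (rule measure_pmf.finite_measure_UNION) (auto simp: disjoint_family_on_def)
  moreover have "measure p (\<Union>n. {n}) = 1" by (simp add: measure_pmf.prob_space[simplified])
  ultimately show ?thesis by (simp add: measure_pmf_single)
qed

lemma pgf_summable:
  assumes "norm z \<le> 1"
  shows "summable (\<lambda>n. norm (complex_of_real (pmf p n) * z ^ n))"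
proof (rule summable_comparison_test[OF _ sums_summable[OF pmf_nat_sums_1[of p]]])
  show "\<exists>N. \<forall>n\<ge>N. norm (norm (complex_of_real (pmf p n) * z ^ n)) \<le> pmf p n"
    using assms by (auto simp: norm_mult norm_power intro!: mult_right_le_one_le power_le_one)
qed

lemma pgf_continuous: "continuous_on (cball 0 1) (pgf p)"
proof -
  have "uniform_limit (cball 0 1) (\<lambda>N z. \<Sum>n<N. complex_of_real (pmf p n) * z ^ n)
      (\<lambda>z. \<Sum>n. complex_of_real (pmf p n) * z ^ n) sequentially"
    by (rule Weierstrass_m_test[where M = "pmf p"])
       (use sums_summable[OF pmf_nat_sums_1[of p]] in
        \<open>auto simp: norm_mult norm_power intro!: mult_right_le_one_le power_le_one\<close>)
  then show ?thesis unfolding pgf_def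
    by (rule uniform_limit_theorem[rotated]) (auto intro!: always_eventually continuous_intros)
qed

lemma pgf_at_0: "pgf p 0 = of_real (pmf p 0)"
  using powser_zero[of "\<lambda>n. complex_of_real (pmf p n)"] by (simp add: pgf_def)

lemma pgf_at_1: "pgf p 1 = 1"
proof -
  have "(\<lambda>n. complex_of_real (pmf p n)) sums of_real 1"
    by (intro sums_of_real pmf_nat_sums_1)
  then show ?thesis by (simp add: pgf_def sums_iff)
qed

text \<open>
The defining quotient is known only inside the disc and away from the zeros of $Q$.  These points are dense
in the closed disc, and both sides are continuous there.
\<close>

lemma pgf_mult_denominator:
  assumes pq: "pgf_lowest_terms p P Q" and z: "norm z \<le> 1"
  shows "pgf p z * cpoly Q z = cpoly P z"
proof -
  define Z where "Z = {z. cpoly Q z = 0}"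
  define S where "S = ball 0 1 - Z"
  have fin: "finite Z" unfolding Z_def
    using pq by (intro finite_cpoly_roots) (simp add: pgf_lowest_terms_def)
  have "z islimpt ball 0 1" using z by (simp add: islimpt_ball)
  then have "z islimpt Z \<union> S" by (rule islimpt_subset) (auto simp: S_def)
  then have "z islimpt S" using fin by (simp add: islimpt_Un_finite)
  then have zc: "z \<in> closure S" by (simp add: closure_def)
  have cl: "closure S \<subseteq> cball 0 1"
    by (rule closure_minimal) (auto simp: S_def)
  have "continuous_on (closure S) (\<lambda>z. pgf p z * cpoly Q z - cpoly P z)"
    by (intro continuous_intros continuous_on_cpoly continuous_on_subset[OF pgf_continuous cl])
  moreover have "pgf p x * cpoly Q x - cpoly P x = 0" if "x \<in> S" for x
    using that pq by (auto simp: S_def Z_def pgf_lowest_terms_def)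
  ultimately have "pgf p z * cpoly Q z - cpoly P z = 0"
    using zc by (rule continuous_constant_on_closure)
  then show ?thesis by simp
qed

text \<open>
A Bezout identity $aP + bQ = 1$ over the reals stays valid at every complex point.
\<close>

lemma coprime_no_common_root:
  fixes P Q :: "real poly"
  assumes "coprime P Q" "cpoly P z = 0" "cpoly Q z = 0"
  shows False
proof -
  obtain a b where "a * P + b * Q = gcd P Q"
    using bezout_coefficients_fst_snd by blast
  then have "a * P + b * Q = 1" using assms(1) by (simp add: coprime_iff_gcd_eq_1)
  then have "cpoly (a * P + b * Q) z = 1" by simp
  then show False using assms(2,3) by simp
qed

text \<open>
At a zero of $Q$ in the closed disc $P = QF$ would vanish too.
\<close>

lemma pgf_denominator_nonzero:
  assumes "pgf_lowest_terms p P Q" "norm z \<le> 1"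
  shows "cpoly Q z \<noteq> 0"
proof
  assume "cpoly Q z = 0"
  moreover from this have "cpoly P z = 0" using pgf_mult_denominator[OF assms] by simp
  ultimately show False using assms(1) coprime_no_common_root
    by (auto simp: pgf_lowest_terms_def)
qed

text \<open>
The identity $QF = P$ of functions near $0$ is an identity of coefficients.
\<close>

lemma pgf_fps:
  assumes pq: "pgf_lowest_terms p P Q"
  shows "fps_of_poly Q * Abs_fps (pmf p) = fps_of_poly P"
proof -
  have rad: "fps_conv_radius (Abs_fps (\<lambda>n. complex_of_real (pmf p n))) \<ge> 1"
    unfolding fps_conv_radius_def
    using conv_radius_geI[of "\<lambda>n. complex_of_real (pmf p n)" 1] summable_norm_cancel[OF pgf_summable[of 1 p]]
    by (simp add: one_ereal_def)
  let ?F = "Abs_fps (\<lambda>n. complex_of_real (pmf p n))"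
  let ?Q = "fps_of_poly (map_poly complex_of_real Q)" and ?P = "fps_of_poly (map_poly complex_of_real P)"
  have "?Q * ?F = ?P"
  proof (rule eval_fps_eqD)
    have "1 \<le> fps_conv_radius (?Q * ?F)"
      using fps_conv_radius_mult[of ?Q ?F] rad by (simp add: order.trans)
    then show "fps_conv_radius (?Q * ?F) > 0" by (rule less_le_trans[rotated]) simp
    have "eval_fps (?Q * ?F) z = eval_fps ?P z" if "z \<in> ball 0 1" for z
    proof -
      have z: "ereal (norm z) < fps_conv_radius ?F"
        using that rad by (intro less_le_trans[OF _ rad]) (simp add: one_ereal_def)
      have "eval_fps (?Q * ?F) z = eval_fps ?Q z * eval_fps ?F z"
        by (rule eval_fps_mult) (use z in simp_all)
      also have "eval_fps ?F z = pgf p z" by (simp add: eval_fps_def pgf_def)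
      finally show ?thesis
        using pgf_mult_denominator[OF pq, of z] that by (simp add: cpoly_def mult.commute)
    qed
    then show "\<forall>\<^sub>F z in nhds 0. eval_fps (?Q * ?F) z = eval_fps ?P z"
      using eventually_nhds_in_open[of "ball 0 1" "0::complex"] by (auto elim!: eventually_mono)
  qed simp
  show ?thesis
  proof (rule fps_ext)
    fix n
    have "fps_nth (?Q * ?F) n = fps_nth ?P n" using \<open>?Q * ?F = ?P\<close> by simp
    then have "complex_of_real (fps_nth (fps_of_poly Q * Abs_fps (pmf p)) n) = of_real (fps_nth (fps_of_poly P) n)"
      by (simp add: fps_mult_nth coeff_map_poly)
    then show "fps_nth (fps_of_poly Q * Abs_fps (pmf p)) n = fps_nth (fps_of_poly P) n"
      by (simp only: of_real_eq_iff)
  qed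
qed

lemma pgf_norm_le: "norm z \<le> 1 \<Longrightarrow> pmf p 0 = 0 \<Longrightarrow> norm (pgf p z) \<le> norm z"
proof -
  assume z: "norm z \<le> 1" and p0: "pmf p 0 = 0"
  have le: "norm (complex_of_real (pmf p n) * z ^ n) \<le> pmf p n * norm z" for n
  proof (cases n)
    case (Suc k)
    have "norm z * norm z ^ k \<le> norm z * 1"
      using z by (intro mult_left_mono power_le_one) auto
    then show ?thesis by (simp add: norm_mult norm_power Suc mult_left_mono)
  qed (simp add: p0)
  have "norm (pgf p z) \<le> (\<Sum>n. norm (complex_of_real (pmf p n) * z ^ n))"
    unfolding pgf_def by (rule summable_norm[OF pgf_summable[OF z]])
  also have "\<dots> \<le> (\<Sum>n. pmf p n * norm z)"
    using le pgf_summable[OF z] sums_summable[OF sums_mult2[OF pmf_nat_sums_1]]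
    by (intro suminf_le) auto
  also have "\<dots> = norm z" using sums_mult2[OF pmf_nat_sums_1[of p], of "norm z"] by (simp add: sums_iff)
  finally show ?thesis .
qed

lemma lifetime_support:
  assumes "lifetime p"
  obtains k where "k \<ge> 2" "pmf p k > 0"
proof -
  have "\<exists>k\<ge>2. pmf p k > 0"
  proof (rule ccontr)
    assume "\<not> ?thesis"
    then have "pmf p n = 0" if "n \<noteq> 1" for n
      using that assms pmf_nonneg[of p n]
      by (cases "n = 0") (auto simp: lifetime_def not_less intro!: antisym)
    then have "pmf p sums pmf p 1" using sums_finite[of "{1}" "pmf p"] by simp
    then have "pmf p 1 = 1" using pmf_nat_sums_1 sums_unique2 by blast
    then show False using assms by (simp add: lifetime_def)
  qed
  then show ?thesis using that by blast
qed

lemma shifted_lattice_lifetimeI: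
  assumes d: "d > 1" and supp: "\<And>n. pmf p n > 0 \<Longrightarrow> \<exists>k. n = a + k * d"
  shows "shifted_lattice_lifetime p"
proof -
  have inj: "inj (\<lambda>k. a + k * d)" using d by (auto simp: inj_on_def)
  have "(\<lambda>k. pmf p (a + k * d)) sums 1 \<longleftrightarrow> pmf p sums 1"
  proof (rule sums_mono_reindex)
    show "strict_mono (\<lambda>k. a + k * d)" using d by (auto simp: strict_mono_def)
    show "pmf p n = 0" if "n \<notin> range (\<lambda>k. a + k * d)" for n
      using that supp[of n] pmf_nonneg[of p n] by (force simp: less_le)
  qed
  then have "(\<Sum>k. pmf p (a + k * d)) = 1" using pmf_nat_sums_1 by (simp add: sums_iff)
  then show ?thesis using d unfolding shifted_lattice_lifetime_def by blast
qed

text \<open>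
$z^n = z$ means $z^{n-1} = 1$, so $d$ is the multiplicative order of $z$.
\<close>

lemma unit_power_eq_lattice:
  fixes z :: complex
  assumes "z \<noteq> 1" "norm z = 1" "k \<ge> 2" "z ^ k = z"
  obtains d where "d > 1" "\<And>n. n \<ge> 1 \<Longrightarrow> z ^ n = z \<Longrightarrow> \<exists>j. n = 1 + j * d"
proof -
  have z0: "z \<noteq> 0" using assms(2) by auto
  define d where "d = (LEAST d. d > 0 \<and> z ^ d = 1)"
  have "z ^ (k - 1) * z = 1 * z" using assms by (simp only: power_minus_mult[of k z] mult_1)
  then have "z ^ (k - 1) = 1" using z0 by simp
  then have ex: "k - 1 > 0 \<and> z ^ (k - 1) = 1" using assms by simp
  have d: "d > 0" "z ^ d = 1" unfolding d_def using LeastI[of "\<lambda>d. d > 0 \<and> z ^ d = 1", OF ex] by auto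
  have least: "d \<le> e" if "e > 0" "z ^ e = 1" for e unfolding d_def using that by (intro Least_le) auto
  have "d \<noteq> 1" using d assms(1) by auto
  with d have "d > 1" by simp
  moreover have "\<exists>j. n = 1 + j * d" if n: "n \<ge> 1" "z ^ n = z" for n
  proof -
    have "z ^ (n - 1) * z = 1 * z" using n by (simp only: power_minus_mult[of n z] mult_1)
    then have "z ^ (n - 1) = 1" using z0 by simp
    then have "z ^ (d * ((n - 1) div d) + (n - 1) mod d) = 1" by simp
    then have "z ^ ((n - 1) mod d) = 1" unfolding power_add power_mult d(2) by simp
    then have "(n - 1) mod d = 0" using least[of "(n - 1) mod d"] d(1) mod_less_divisor[of d "n - 1"]
      by (metis gr_zeroI not_le)
    then have "n - 1 = ((n - 1) div d) * d" by (simp add: mod_0_imp_dvd)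
    then show ?thesis using n by (intro exI[of _ "(n - 1) div d"]) simp
  qed
  ultimately show ?thesis using that by blast
qed

text \<open>
On the circle, $|F(z)| = 1$ would force all $z^n$ with $P(L = n) > 0$ to have the same argument as $z$, the
term of $n = 1$; then $z^n = z$ for all these $n$, and $L$ would live on $1 + d\,\mathbb{Z}$.  Otherwise two
terms already satisfy a strict triangle inequality.
\<close>

lemma pgf_norm_less_1:
  assumes L: "lifetime p" and ns: "\<not> shifted_lattice_lifetime p"
    and z: "norm z \<le> 1" "z \<noteq> 1"
  shows "norm (pgf p z) < 1"
proof (cases "norm z < 1")
  case True
  then show ?thesis using pgf_norm_le[of z p] L by (simp add: lifetime_def)
next
  case False
  with z have nz: "norm z = 1" by simp
  have "\<exists>k\<ge>2. pmf p k > 0 \<and> z ^ k \<noteq> z"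
  proof (rule ccontr)
    assume neg: "\<not> ?thesis"
    obtain k where k: "k \<ge> 2" "pmf p k > 0" using lifetime_support[OF L] .
    with neg have "z ^ k = z" by blast
    then obtain d where d: "d > 1" "\<And>n. n \<ge> 1 \<Longrightarrow> z ^ n = z \<Longrightarrow> \<exists>j. n = 1 + j * d"
      using unit_power_eq_lattice[OF z(2) nz k(1)] by blast
    have "\<exists>j. n = 1 + j * d" if "pmf p n > 0" for n
    proof (rule d(2))
      show "n \<ge> 1" using that L by (cases n) (auto simp: lifetime_def)
      then show "z ^ n = z" using neg that by (cases "n = 1") auto
    qed
    then show False using shifted_lattice_lifetimeI[OF d(1)] ns by blast
  qed
  then obtain k where k: "k \<ge> 2" "pmf p k > 0" "z ^ k \<noteq> z" by blast
  define f where "f n = complex_of_real (pmf p n) * z ^ n" for n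
  define w where "w n = (if n = 1 then f 1 + f k else if n = k then 0 else f n)" for n
  have nf: "norm (f n) = pmf p n" for n by (simp add: f_def norm_mult norm_power nz)
  have f: "f sums pgf p z" unfolding f_def pgf_def
    using summable_norm_cancel[OF pgf_summable[OF z(1)]] by (rule summable_sums)
  have "norm (f 1 + f k) \<noteq> norm (f 1) + norm (f k)"
  proof
    assume "norm (f 1 + f k) = norm (f 1) + norm (f k)"
    then have "norm (f 1) *\<^sub>R f k = norm (f k) *\<^sub>R f 1"
      by (simp add: norm_triangle_eq)
    then have "complex_of_real (pmf p 1 * pmf p k) * z ^ k = of_real (pmf p 1 * pmf p k) * z"
      unfolding nf by (simp add: f_def scaleR_conv_of_real mult_ac)
    then show False using k L by (simp add: lifetime_def)
  qed
  then have lt: "norm (f 1 + f k) < pmf p 1 + pmf p k"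
    using norm_triangle_ineq[of "f 1" "f k"] by (simp add: nf)
  have k1: "k \<noteq> 1" using k by simp
  have tail: "(\<lambda>n. f n - (if n \<in> {1, k} then f n else 0)) sums (pgf p z - (\<Sum>n\<in>{1,k}. f n))"
    by (intro sums_diff f sums_If_finite_set) simp
  have tail': "(\<lambda>n. pmf p n - (if n \<in> {1, k} then pmf p n else 0)) sums (1 - (\<Sum>n\<in>{1,k}. pmf p n))"
    by (intro sums_diff pmf_nat_sums_1 sums_If_finite_set) simp
  have "norm (pgf p z - (\<Sum>n\<in>{1,k}. f n)) \<le> 1 - (\<Sum>n\<in>{1,k}. pmf p n)"
  proof -
    have *: "norm (f n - (if n \<in> {1, k} then f n else 0)) \<le> pmf p n - (if n \<in> {1, k} then pmf p n else 0)" for n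
      by (simp add: nf)
    show ?thesis
      using norm_suminf_le[OF * sums_summable[OF tail']] tail tail' by (simp add: sums_iff)
  qed
  then have "norm (pgf p z - (f 1 + f k)) \<le> 1 - (pmf p 1 + pmf p k)" using k1 by auto
  then show ?thesis using lt norm_triangle_ineq[of "pgf p z - (f 1 + f k)" "f 1 + f k"] by simp
qed

section \<open>Moments of the lifetime\<close>

lemma expectation_pmf_nat:
  fixes g :: "nat \<Rightarrow> real"
  assumes "summable (\<lambda>n. pmf p n * \<bar>g n\<bar>)"
  shows "integrable (measure_pmf p) g"
    and "(\<lambda>n. pmf p n * g n) sums measure_pmf.expectation p g"
proof -
  have i: "integrable (count_space UNIV) (\<lambda>n. pmf p n * g n)"
    using assms by (simp add: integrable_count_space_nat_iff abs_mult)
  then show "integrable (measure_pmf p) g"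
    unfolding measure_pmf_eq_density by (subst integrable_density) simp_all
  have "measure_pmf.expectation p g = integral\<^sup>L (count_space UNIV) (\<lambda>n. pmf p n * g n)"
    unfolding measure_pmf_eq_density by (subst integral_density) simp_all
  then show "(\<lambda>n. pmf p n * g n) sums measure_pmf.expectation p g"
    using sums_integral_count_space_nat[OF i] by simp
qed

text \<open>
Differentiate $QF = P$ once and twice at $1$.  This is legitimate because $F$ converges beyond the unit
circle, which also makes the first two moments finite: $F'(1) = E L$ and $F''(1) = E\,L(L-1)$.
\<close>

lemma pgf_moments:
  assumes pq: "pgf_lowest_terms p P Q"
  defines "\<mu> \<equiv> lifetime_mean p"
  shows "poly (pderiv P) 1 = poly (pderiv Q) 1 + \<mu> * poly Q 1"
    and "poly (pderiv (pderiv P)) 1 = poly (pderiv (pderiv Q)) 1 + 2 * \<mu> * poly (pderiv Q) 1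
           + (lifetime_variance p + \<mu>\<^sup>2 - \<mu>) * poly Q 1"
    and "integrable (measure_pmf p) real"
    and "integrable (measure_pmf p) (\<lambda>n. (real n)\<^sup>2)"
proof -
  define F where "F = Abs_fps (pmf p)"
  have Q0: "Q \<noteq> 0" using pq by (simp add: pgf_lowest_terms_def)
  obtain r where r: "r > 1" "\<And>z. norm z < r \<Longrightarrow> cpoly Q z \<noteq> 0"
    using zero_free_disc_enlarge[OF Q0 pgf_denominator_nonzero[OF pq]] by metis
  define s where "s = (1 + r) / 2"
  have s: "1 < s" "s < r" using r by (auto simp: s_def)
  have QF: "fps_of_poly Q * F = fps_of_poly P" unfolding F_def by (rule pgf_fps[OF pq])
  have "summable (\<lambda>n. norm (complex_of_real (pmf p n) * of_real s ^ n))"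
    by (rule rational_power_series(1)[OF QF[unfolded F_def] r(2)]) (use s in auto)
  then have "summable (\<lambda>n. pmf p n * s ^ n)"
    using s by (simp add: norm_mult norm_power)
  then have "norm s \<le> conv_radius (pmf p)" by (intro conv_radius_geI) simp
  then have "ereal 1 < fps_conv_radius F"
    using s unfolding fps_conv_radius_def F_def
    by (simp add: fps_nth_Abs_fps) (meson ereal_less(4) less_ereal.simps(1) less_le_trans)
  moreover have "fps_conv_radius F \<le> fps_conv_radius (fps_deriv F)"
    by (rule fps_conv_radius_deriv)
  moreover have "fps_conv_radius (fps_deriv F) \<le> fps_conv_radius (fps_deriv (fps_deriv F))"
    by (rule fps_conv_radius_deriv)
  ultimately have rad: "ereal 1 < fps_conv_radius F"
    "ereal 1 < fps_conv_radius (fps_deriv F)"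
    "ereal 1 < fps_conv_radius (fps_deriv (fps_deriv F))" by simp_all
  have F1: "eval_fps F 1 = 1"
    using sums_unique2[OF sums_eval_fps[of 1 F], of 1] pmf_nat_sums_1[of p] rad(1) by (simp add: F_def)
  have m1: "(\<lambda>n. real n * pmf p n) sums eval_fps (fps_deriv F) 1"
    using sums_eval_fps[of 1 "fps_deriv F"] rad(2) sums_Suc[of "\<lambda>n. real n * pmf p n" "eval_fps (fps_deriv F) 1"]
    by (simp add: F_def)
  have m2: "(\<lambda>n. real n * (real n - 1) * pmf p n) sums eval_fps (fps_deriv (fps_deriv F)) 1"
  proof -
    have "(\<lambda>n. real (Suc (Suc n)) * (real (Suc (Suc n)) - 1) * pmf p (Suc (Suc n))) sums eval_fps (fps_deriv (fps_deriv F)) 1"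
      using sums_eval_fps[of 1 "fps_deriv (fps_deriv F)"] rad(3) by (simp add: F_def algebra_simps)
    from sums_Suc[OF this] have "(\<lambda>n. real (Suc n) * (real (Suc n) - 1) * pmf p (Suc n)) sums eval_fps (fps_deriv (fps_deriv F)) 1"
      by simp
    from sums_Suc[OF this] show ?thesis by simp
  qed
  have sq: "(\<lambda>n. pmf p n * (real n)\<^sup>2) sums (eval_fps (fps_deriv (fps_deriv F)) 1 + eval_fps (fps_deriv F) 1)"
    using sums_add[OF m2 m1] by (simp add: algebra_simps power2_eq_square)
  show i1: "integrable (measure_pmf p) real"
    by (rule expectation_pmf_nat(1)) (use sums_summable[OF m1] in \<open>simp add: mult.commute\<close>)
  show i2: "integrable (measure_pmf p) (\<lambda>n. (real n)\<^sup>2)"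
    by (rule expectation_pmf_nat(1)) (use sums_summable[OF sq] in simp)
  have mu: "\<mu> = eval_fps (fps_deriv F) 1"
    using sums_unique2[OF expectation_pmf_nat(2)[of p real], of "eval_fps (fps_deriv F) 1"] m1 sums_summable[OF m1]
    by (simp add: \<mu>_def lifetime_mean_def mult.commute)
  have e2: "measure_pmf.expectation p (\<lambda>n. (real n)\<^sup>2) = eval_fps (fps_deriv (fps_deriv F)) 1 + \<mu>"
    using sums_unique2[OF expectation_pmf_nat(2)[of p "\<lambda>n. (real n)\<^sup>2"] sq] sums_summable[OF sq] by (simp add: mu)
  have var: "lifetime_variance p = eval_fps (fps_deriv (fps_deriv F)) 1 + \<mu> - \<mu>\<^sup>2"
    unfolding lifetime_variance_def using measure_pmf.variance_eq[OF i1 i2] e2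
    by (simp add: \<mu>_def lifetime_mean_def)
  have ev_mult: "eval_fps (fps_of_poly q * G) 1 = poly q 1 * eval_fps G 1"
    if "ereal 1 < fps_conv_radius G" for q :: "real poly" and G
    using that by (subst eval_fps_mult) simp_all
  have ev_add: "eval_fps (G + H) 1 = eval_fps G 1 + eval_fps H 1"
    if "ereal 1 < fps_conv_radius G" "ereal 1 < fps_conv_radius H" for G H :: "real fps"
    using that by (intro eval_fps_add) simp_all
  have rm: "ereal 1 < fps_conv_radius (fps_of_poly q * G)"
    if "ereal 1 < fps_conv_radius G" for q :: "real poly" and G
    using fps_conv_radius_mult[of "fps_of_poly q" G] that by simp
  have d1: "fps_of_poly (pderiv P) = fps_of_poly Q * fps_deriv F + fps_of_poly (pderiv Q) * F"
    unfolding fps_of_poly_pderiv QF[symmetric] by simp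
  have "eval_fps (fps_of_poly (pderiv P)) 1 = poly Q 1 * eval_fps (fps_deriv F) 1 + poly (pderiv Q) 1 * eval_fps F 1"
    unfolding d1 by (subst ev_add) (auto intro: rm rad simp: ev_mult rad)
  then show "poly (pderiv P) 1 = poly (pderiv Q) 1 + \<mu> * poly Q 1"
    by (simp add: F1 mu)
  have d2: "fps_of_poly (pderiv (pderiv P)) = fps_of_poly Q * fps_deriv (fps_deriv F) +
     (fps_of_poly (smult 2 (pderiv Q)) * fps_deriv F + fps_of_poly (pderiv (pderiv Q)) * F)"
    unfolding fps_of_poly_pderiv[of "pderiv P"] d1 by (simp add: fps_of_poly_pderiv fps_of_poly_smult algebra_simps)
  have "eval_fps (fps_of_poly (pderiv (pderiv P))) 1 = poly Q 1 * eval_fps (fps_deriv (fps_deriv F)) 1 +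
     (poly (smult 2 (pderiv Q)) 1 * eval_fps (fps_deriv F) 1 + poly (pderiv (pderiv Q)) 1 * eval_fps F 1)"
    unfolding d2
    by (subst ev_add, (auto intro: rm rad)[1],
        (rule less_le_trans[OF _ fps_conv_radius_add], auto intro: rm rad)[1],
        subst ev_add, auto intro: rm rad simp: ev_mult rad)
  then show "poly (pderiv (pderiv P)) 1 = poly (pderiv (pderiv Q)) 1 + 2 * \<mu> * poly (pderiv Q) 1
           + (lifetime_variance p + \<mu>\<^sup>2 - \<mu>) * poly Q 1"
    by (simp add: F1 mu[symmetric] var algebra_simps)
qed

lemma lifetime_mean_pos:
  assumes L: "lifetime p" and pq: "pgf_lowest_terms p P Q"
  shows "lifetime_mean p > 0"
proof -
  obtain k where k: "k \<ge> 2" "pmf p k > 0" using lifetime_support[OF L] .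
  have "lifetime_mean p \<ge> 0" unfolding lifetime_mean_def by (rule Bochner_Integration.integral_nonneg) auto
  moreover have "lifetime_mean p \<noteq> 0"
  proof
    assume "lifetime_mean p = 0"
    then have "AE n in measure_pmf p. real n = 0"
      using integral_nonneg_eq_0_iff_AE[OF pgf_moments(3)[OF pq]] by (simp add: lifetime_mean_def)
    then have "k = 0" using k by (auto simp: AE_measure_pmf_iff set_pmf_iff)
    then show False using k by simp
  qed
  ultimately show ?thesis by simp
qed

text \<open>
A lifetime takes the value $1$ and some value at least $2$ with positive probability, so it is not almost
surely constant.
\<close>

lemma lifetime_variance_pos:
  assumes L: "lifetime p" and pq: "pgf_lowest_terms p P Q"
  shows "lifetime_variance p > 0"
proof -
  obtain k where k: "k \<ge> 2" "pmf p k > 0" using lifetime_support[OF L] .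
  let ?f = "\<lambda>n. (real n - lifetime_mean p)\<^sup>2"
  have i: "integrable (measure_pmf p) ?f"
    unfolding power2_diff using pgf_moments(3,4)[OF pq] by simp
  have "lifetime_variance p \<ge> 0"
    unfolding lifetime_variance_def by (rule Bochner_Integration.integral_nonneg) auto
  moreover have "lifetime_variance p \<noteq> 0"
  proof
    assume "lifetime_variance p = 0"
    then have "AE n in measure_pmf p. ?f n = 0"
      using integral_nonneg_eq_0_iff_AE[OF i] by (simp add: lifetime_variance_def lifetime_mean_def)
    then have *: "real n = lifetime_mean p" if "pmf p n \<noteq> 0" for n
      using that by (auto simp: AE_measure_pmf_iff set_pmf_iff)
    have "real k = real 1" using *[of k] *[of 1] k L by (simp add: lifetime_def)
    then show False using k by simp
  qed
  ultimately show ?thesis by simp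
qed

section \<open>Factorization of the renewal covariance series\<close>

lemma has_sum_symmetric_Laurent:
  fixes a :: "nat \<Rightarrow> complex"
  assumes p: "summable (\<lambda>n. norm (a n * z ^ n))" "(\<lambda>n. a n * z ^ n) sums A"
    and n: "summable (\<lambda>n. norm (a n * (1 / z) ^ n))" "(\<lambda>n. a n * (1 / z) ^ n) sums B"
    and z: "z \<noteq> 0"
  shows "((\<lambda>h::int. a (nat \<bar>h\<bar>) * z powi h) has_sum (A + B - a 0)) UNIV"
proof -
  let ?f = "\<lambda>h::int. a (nat \<bar>h\<bar>) * z powi h"
  have "((\<lambda>n. a n * z ^ n) has_sum A) UNIV"
    using p(1) p(2) by (rule norm_summable_imp_has_sum)
  then have "((?f \<circ> int) has_sum A) UNIV"
    by (simp add: o_def)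
  then have P: "(?f has_sum A) (range int)"
    by (subst has_sum_reindex) (auto simp: inj_on_def)
  have "(\<lambda>n. a (Suc n) * (1 / z) ^ Suc n) sums (B - a 0)"
    using n(2) sums_Suc_iff[of "\<lambda>n. a n * (1 / z) ^ n" "B - a 0"] by simp
  moreover have "summable (\<lambda>n. norm (a (Suc n) * (1 / z) ^ Suc n))"
    using n(1) summable_Suc_iff[of "\<lambda>n. norm (a n * (1 / z) ^ n)"] by simp
  ultimately have "((\<lambda>n. a (Suc n) * (1 / z) ^ Suc n) has_sum (B - a 0)) UNIV"
    by (intro norm_summable_imp_has_sum)
  moreover have "(?f \<circ> (\<lambda>n. - int (Suc n))) = (\<lambda>n. a (Suc n) * (1 / z) ^ Suc n)"
  proof
    fix n
    have "z powi (- int (Suc n)) = (1 / z) ^ Suc n"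
      unfolding power_int_minus power_int_of_nat by (simp add: power_one_over inverse_eq_divide)
    moreover have "nat \<bar>- int (Suc n)\<bar> = Suc n" by simp
    ultimately show "(?f \<circ> (\<lambda>n. - int (Suc n))) n = a (Suc n) * (1 / z) ^ Suc n"
      unfolding o_def by (simp only:)
  qed
  ultimately have "((?f \<circ> (\<lambda>n. - int (Suc n))) has_sum (B - a 0)) UNIV" by simp
  then have N: "(?f has_sum (B - a 0)) (range (\<lambda>n. - int (Suc n)))"
    by (subst has_sum_reindex) (auto simp: inj_on_def)
  have "range int \<inter> range (\<lambda>n. - int (Suc n)) = {}" by auto
  moreover have "range int \<union> range (\<lambda>n. - int (Suc n)) = UNIV"
  proof -
    have "h \<in> range int \<union> range (\<lambda>n. - int (Suc n))" for h
      by (cases h rule: int_cases) auto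
    then show ?thesis by blast
  qed
  ultimately show ?thesis using has_sum_Un_disjoint[OF P N] by (simp add: algebra_simps)
qed

text \<open>
The polynomial $z^n p(1/z)$ for $n$ at least the degree of $p$; here polynomials of different
degrees have to be reversed with the same $n$.
\<close>

definition rev_poly :: "nat \<Rightarrow> real poly \<Rightarrow> real poly" where
  "rev_poly n p = monom 1 (n - degree p) * reflect_poly p"

lemma cpoly_rev_poly:
  assumes "degree p \<le> n" "z \<noteq> 0"
  shows "cpoly (rev_poly n p) z = z ^ n * cpoly p (1 / z)"
proof -
  have "z ^ (n - degree p) * z ^ degree p = z ^ n"
    using assms by (simp flip: power_add)
  then show ?thesis using assms by (simp add: rev_poly_def cpoly_reflect_poly mult.assoc[symmetric])
qed

text \<open>
The tail probabilities have generating function $(1-F)/(1-z)$, so the convolution equation reads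
$(1-F)/(1-z) \cdot U = 1/(1-z)$.
\<close>

lemma renewal_fps:
  fixes u :: "nat \<Rightarrow> real"
  assumes u: "\<And>h. (\<Sum>j\<le>h. measure_pmf.prob p {j<..} * u (h - j)) = 1"
  shows "(1 - Abs_fps (pmf p)) * Abs_fps u = 1"
proof -
  define T where "T = Abs_fps (\<lambda>j. measure_pmf.prob p {j<..})"
  have tail: "measure_pmf.prob p {j<..} = 1 - (\<Sum>k\<le>j. pmf p k)" for j
  proof -
    have "measure_pmf.prob p {j<..} = 1 - measure_pmf.prob p {..j}"
      using measure_pmf.prob_compl[of "{..j}" p] by (simp add: Compl_eq_Diff_UNIV[symmetric] Compl_atMost)
    then show ?thesis by (simp add: measure_measure_pmf_finite)
  qed
  have "T * Abs_fps u = Abs_fps (\<lambda>_. 1)"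
    by (rule fps_ext) (use u in \<open>simp add: T_def fps_mult_nth atLeast0AtMost\<close>)
  moreover have "(1 - fps_X) * Abs_fps (\<lambda>_. 1::real) = 1"
    by (rule fps_ext) (simp add: left_diff_distrib fps_X_mult_nth)
  ultimately have "(1 - fps_X) * T * Abs_fps u = 1" by (simp add: mult.assoc)
  moreover have "(1 - fps_X) * T = 1 - Abs_fps (pmf p)"
  proof (rule fps_ext)
    fix n show "fps_nth ((1 - fps_X) * T) n = fps_nth (1 - Abs_fps (pmf p)) n"
      by (cases n) (auto simp: left_diff_distrib T_def tail)
  qed
  ultimately show ?thesis by simp
qed

text \<open>
Both $Q - P$ and $Q/Q(0) - \phi/\mu$ will play the role of $(1-z)\,g$: the values of $\phi$, $\phi'$ and
$R$ at $1$ then come from derivatives of $P$ and $Q$.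
\<close>

lemma pderiv_linear_factor_at_1:
  fixes g :: "real poly"
  shows "poly (pderiv ([:1, -1:] * g)) 1 = - poly g 1"
    and "poly (pderiv (pderiv ([:1, -1:] * g))) 1 = - 2 * poly (pderiv g) 1"
proof -
  have d: "pderiv ([:1, -1:] * g) = [:1, -1:] * pderiv g - g"
    unfolding pderiv_mult by (simp add: pderiv_pCons)
  then show 1: "poly (pderiv ([:1, -1:] * g)) 1 = - poly g 1" for g :: "real poly"
    unfolding pderiv_mult by (simp add: pderiv_pCons)
  show "poly (pderiv (pderiv ([:1, -1:] * g))) 1 = - 2 * poly (pderiv g) 1"
    unfolding d pderiv_diff poly_diff 1 by simp
qed

text \<open>
Here $\phi$ is $(Q-P)/((1-z)\,Q(0))$, $\theta$ is the Fejer-Riesz factor of the numerator left over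
when the covariance series is put over $\phi(z)\phi(1/z)$, and the constant comes from evaluating at $1$.
\<close>

lemma renewal_covariance_factorization:
  fixes u :: "nat \<Rightarrow> real"
  assumes L: "lifetime p" and ns: "\<not> shifted_lattice_lifetime p" and pq: "pgf_lowest_terms p P Q"
    and u: "\<And>h. (\<Sum>j\<le>h. measure_pmf.prob p {j<..} * u (h - j)) = 1"
  defines "\<mu> \<equiv> lifetime_mean p"
  obtains \<phi> \<theta> r where
    "poly \<phi> 0 = 1" "poly \<theta> 0 = 1"
    "\<And>z. cpoly \<phi> z = 0 \<Longrightarrow> norm z > 1"
    "\<And>z. cpoly \<theta> z = 0 \<Longrightarrow> norm z > 1"
    "\<And>z. cpoly \<phi> z = 0 \<Longrightarrow> cpoly \<theta> z \<noteq> 0"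
    "poly Q 0 \<noteq> 0" "poly Q 1 \<noteq> 0" "poly \<theta> 1 \<noteq> 0" "r > 1"
    "\<And>z. 1 / r < norm z \<Longrightarrow> norm z < r \<Longrightarrow>
       ((\<lambda>h::int. of_real (u (nat \<bar>h\<bar>) - 1 / \<mu>) * z powi h) has_sum
         of_real (lifetime_variance p * (poly Q 1)\<^sup>2 / ((poly \<theta> 1)\<^sup>2 * (poly Q 0)\<^sup>2)) *
         (cpoly \<theta> z * cpoly \<theta> (1 / z)) / (cpoly \<phi> z * cpoly \<phi> (1 / z))) UNIV"
proof -
  define q0 where "q0 = poly Q 0"
  define F where "F = pgf p"
  have Qnz: "cpoly Q z \<noteq> 0" if "norm z \<le> 1" for z using pgf_denominator_nonzero[OF pq that] .
  have FQ: "F z * cpoly Q z = cpoly P z" if "norm z \<le> 1" for z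
    unfolding F_def using pgf_mult_denominator[OF pq that] .
  have F_lt: "norm (F z) < 1" if "norm z \<le> 1" "z \<noteq> 1" for z
    unfolding F_def using pgf_norm_less_1[OF L ns that] .
  have q0: "q0 \<noteq> 0" using Qnz[of 0] by (simp add: q0_def)
  have q1: "poly Q 1 \<noteq> 0" using Qnz[of 1] by simp
  have mu: "\<mu> > 0" unfolding \<mu>_def by (rule lifetime_mean_pos[OF L pq])
  have var: "lifetime_variance p > 0" by (rule lifetime_variance_pos[OF L pq])
  have P1: "poly P 1 = poly Q 1"
    using FQ[of 1] pgf_at_1[of p] by (simp add: F_def)
  have P0: "poly P 0 = 0"
    using FQ[of 0] L by (simp add: F_def pgf_at_0 lifetime_def)

  \<comment> \<open>$1 - F$ vanishes at $1$, to first order since $F'(1) = \<mu> > 0$, and nowhere else in the closed disc;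
    dividing out this zero gives $\<phi>$.\<close>
  have "[:-1, 1:] dvd Q - P" by (simp add: poly_eq_0_iff_dvd[symmetric] P1)
  then obtain H where "Q - P = [:-1, 1:] * H" by (elim dvdE)
  define \<phi> where "\<phi> = smult (- 1 / q0) H"
  have QP: "Q - P = smult q0 ([:1, -1:] * \<phi>)"
    using q0 \<open>Q - P = [:-1, 1:] * H\<close> by (simp add: \<phi>_def)
  have cQP: "cpoly Q z - cpoly P z = of_real q0 * (1 - z) * cpoly \<phi> z" for z
    using arg_cong[OF QP, of "\<lambda>p. cpoly p z"] by (simp add: algebra_simps)
  have phi0: "poly \<phi> 0 = 1"
    using arg_cong[OF QP, of "\<lambda>p. poly p 0"] q0 by (simp add: P0 q0_def)
  note mom = pgf_moments(1,2)[OF pq, folded \<mu>_def]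
  have phi1: "q0 * poly \<phi> 1 = \<mu> * poly Q 1"
    using arg_cong[OF QP, of "\<lambda>p. poly (pderiv p) 1"] mom(1)
    unfolding pderiv_smult poly_smult pderiv_linear_factor_at_1 pderiv_diff poly_diff
    by (simp add: algebra_simps)
  have phi1': "2 * q0 * poly (pderiv \<phi>) 1
      = 2 * \<mu> * poly (pderiv Q) 1 + (lifetime_variance p + \<mu>\<^sup>2 - \<mu>) * poly Q 1"
    using arg_cong[OF QP, of "\<lambda>p. poly (pderiv (pderiv p)) 1"] mom(2)
    unfolding pderiv_smult poly_smult pderiv_linear_factor_at_1 pderiv_diff poly_diff
    by (simp add: algebra_simps)
  have phi_nz: "cpoly \<phi> z \<noteq> 0" if z: "norm z \<le> 1" for z
  proof (cases "z = 1")
    case True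
    then show ?thesis using phi1 mu q0 q1 by auto
  next
    case False
    show ?thesis
    proof
      assume "cpoly \<phi> z = 0"
      then have "cpoly Q z * (1 - F z) = 0" using cQP[of z] FQ[OF z] by (simp add: algebra_simps)
      then show False using Qnz[OF z] F_lt[OF z False] by auto
    qed
  qed
  have phi_ne: "\<phi> \<noteq> 0" using phi0 by auto

  \<comment> \<open>$A = 1/(1-F) - 1/(\<mu>(1-z))$ equals $(Q/Q(0) - \<phi>/\<mu>)/((1-z)\<phi>)$, and the value
    $Q(0)\<phi>(1) = \<mu> Q(1)$ makes the numerator divisible by $1 - z$.\<close>
  define W where "W = smult (1 / q0) Q - smult (1 / \<mu>) \<phi>"
  have "poly W 1 = 0" using phi1 mu q0 by (simp add: W_def field_simps)
  then have "[:-1, 1:] dvd W" by (simp add: poly_eq_0_iff_dvd)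
  then obtain R' where "W = [:-1, 1:] * R'" by (elim dvdE)
  define R where "R = - R'"
  have WR: "W = [:1, -1:] * R" using \<open>W = [:-1, 1:] * R'\<close> by (simp add: R_def)
  have cR: "(1 - z) * cpoly R z = cpoly Q z / of_real q0 - cpoly \<phi> z / of_real \<mu>" for z
    using arg_cong[OF WR, of "\<lambda>p. cpoly p z"] by (simp add: W_def algebra_simps)
  have R1: "2 * \<mu> * q0 * poly R 1 = (lifetime_variance p + \<mu>\<^sup>2 - \<mu>) * poly Q 1"
  proof -
    have "- poly R 1 = poly (pderiv Q) 1 / q0 - poly (pderiv \<phi>) 1 / \<mu>"
      using arg_cong[OF WR, of "\<lambda>p. poly (pderiv p) 1"]
      unfolding pderiv_linear_factor_at_1 by (simp add: W_def pderiv_diff pderiv_smult)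
    then have "poly R 1 = poly (pderiv \<phi>) 1 / \<mu> - poly (pderiv Q) 1 / q0" by simp
    then have "2 * \<mu> * q0 * poly R 1 = 2 * q0 * poly (pderiv \<phi>) 1 - 2 * \<mu> * poly (pderiv Q) 1"
      using mu q0 by (simp add: field_simps)
    then show ?thesis unfolding phi1' by simp
  qed
  define a where "a h = u h - 1 / \<mu>" for h
  have a_fps: "fps_of_poly \<phi> * Abs_fps a = fps_of_poly R"
  proof -
    let ?U = "Abs_fps u" and ?F = "Abs_fps (pmf p)" and ?X = "1 - fps_X :: real fps"
    have Xp: "fps_of_poly [:1, -1:] = ?X"
      by (simp add: fps_of_poly_pCons)
    have "(fps_of_poly Q - fps_of_poly Q * ?F) * ?U = fps_of_poly Q * ((1 - ?F) * ?U)"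
      by (simp add: algebra_simps)
    also have "\<dots> = fps_of_poly Q" using renewal_fps[OF u] by simp
    finally have "fps_of_poly (Q - P) * ?U = fps_of_poly Q"
      by (simp add: pgf_fps[OF pq] fps_of_poly_diff)
    then have QU: "fps_const q0 * (?X * fps_of_poly \<phi>) * ?U = fps_of_poly Q"
      unfolding QP fps_of_poly_smult fps_of_poly_mult Xp .
    have XA: "?X * Abs_fps a = ?X * ?U - fps_const (1 / \<mu>)"
    proof -
      have "Abs_fps a = ?U - fps_const (1 / \<mu>) * Abs_fps (\<lambda>_. 1)"
        by (rule fps_ext) (simp add: a_def)
      moreover have "?X * Abs_fps (\<lambda>_. 1) = 1"
        by (rule fps_ext) (simp add: left_diff_distrib fps_X_mult_nth)
      moreover have "?X * (V - C * W) = ?X * V - C * (?X * W)" for V C W :: "real fps"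
        by (simp add: algebra_simps)
      ultimately show ?thesis by simp
    qed
    have "fps_const q0 * (?X * (fps_of_poly \<phi> * Abs_fps a)) = fps_const q0 * fps_of_poly \<phi> * (?X * Abs_fps a)"
      by (simp only: mult_ac)
    also have "\<dots> = fps_of_poly Q - fps_const (q0 / \<mu>) * fps_of_poly \<phi>"
      unfolding XA right_diff_distrib QU[symmetric] by (simp add: mult_ac fps_const_mult[symmetric] del: fps_const_mult)
    also have "\<dots> = fps_const q0 * fps_of_poly W"
    proof -
      have "smult q0 W = Q - smult (q0 / \<mu>) \<phi>" using q0 by (simp add: W_def smult_diff_right)
      then show ?thesis by (metis fps_of_poly_diff fps_of_poly_smult)
    qed
    also have "\<dots> = fps_const q0 * (?X * fps_of_poly R)"
      unfolding WR fps_of_poly_mult Xp ..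
    finally have "?X * (fps_of_poly \<phi> * Abs_fps a) = ?X * fps_of_poly R" using q0 by simp
    moreover have "?X \<noteq> 0"
    proof
      assume "?X = 0"
      then have "fps_nth ?X 0 = fps_nth 0 0" by (rule arg_cong)
      then show False by simp
    qed
    ultimately show ?thesis by simp
  qed
  obtain r where r: "r > 1" "\<And>z. norm z < r \<Longrightarrow> cpoly \<phi> z \<noteq> 0"
    using zero_free_disc_enlarge[OF phi_ne phi_nz] by metis
  have ser: "summable (\<lambda>n. norm (of_real (a n) * z ^ n))"
      "(\<lambda>n. of_real (a n) * z ^ n) sums (cpoly R z / cpoly \<phi> z)" if "norm z < r" for z
    by (rule rational_power_series[OF a_fps r(2) that], assumption)+
  have "u 0 = 1"
  proof -
    have "fps_nth ((1 - Abs_fps (pmf p)) * Abs_fps u) 0 = fps_nth 1 0"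
      using renewal_fps[OF u] by simp
    then show ?thesis using L by (simp add: lifetime_def)
  qed
  then have a0: "a 0 = 1 - 1 / \<mu>" by (simp add: a_def)

  \<comment> \<open>$A(z) + A(1/z) - a_0 = B(z)/(\<phi>(z)\<phi>(1/z))$, and $z^n B(z)$ is the polynomial $q$.\<close>
  define B where "B z = cpoly R z * cpoly \<phi> (1 / z) + cpoly R (1 / z) * cpoly \<phi> z
      - of_real (a 0) * (cpoly \<phi> z * cpoly \<phi> (1 / z))" for z
  have B_sym: "B (1 / z) = B z" for z by (simp add: B_def)
  define n where "n = max (degree R) (degree \<phi>)"
  define q where "q = R * rev_poly n \<phi> + rev_poly n R * \<phi> - smult (a 0) (\<phi> * rev_poly n \<phi>)"
  have qB: "cpoly q z = z ^ n * B z" if "z \<noteq> 0" for z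
    using that by (simp add: q_def B_def cpoly_rev_poly n_def algebra_simps)
  have B_id: "of_real (q0\<^sup>2) * ((1 - z) * (1 - 1 / z)) * B z
      = cpoly Q z * cpoly Q (1 / z) - cpoly P z * cpoly P (1 / z)" if z: "z \<noteq> 0" for z
  proof -
    define x y where "x = 1 - z" and "y = 1 - 1 / z"
    \<comment> \<open>This relation absorbs the terms with $1/\<mu>$.\<close>
    have xy: "x + y = x * y" using z by (simp add: x_def y_def field_simps)
    let ?p = "cpoly \<phi> z" and ?p' = "cpoly \<phi> (1 / z)" and ?c = "complex_of_real q0"
      and ?m = "complex_of_real \<mu>"
    have c0: "?c \<noteq> 0" "?m \<noteq> 0" using q0 mu by auto
    have P: "cpoly P z = cpoly Q z - ?c * x * ?p" "cpoly P (1 / z) = cpoly Q (1 / z) - ?c * y * ?p'"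
      using cQP[of z] cQP[of "1 / z"] by (simp_all add: x_def y_def algebra_simps)
    have xR: "x * cpoly R z = cpoly Q z / ?c - ?p / ?m" "y * cpoly R (1 / z) = cpoly Q (1 / z) / ?c - ?p' / ?m"
      using cR[of z] cR[of "1 / z"] by (simp_all add: x_def y_def)
    have "?c\<^sup>2 * (x * y) * B z = ?c\<^sup>2 * (y * ?p' * (x * cpoly R z) + x * ?p * (y * cpoly R (1 / z))
        - (1 - 1 / ?m) * (x * y) * ?p * ?p')"
      by (simp add: B_def a0 algebra_simps)
    also have "\<dots> = ?c * (y * ?p' * cpoly Q z + x * ?p * cpoly Q (1 / z)) - ?c\<^sup>2 * ((x + y) / ?m + (1 - 1 / ?m) * (x * y)) * ?p * ?p'"
      unfolding xR using c0 by (simp add: field_simps power2_eq_square)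
    also have "(x + y) / ?m + (1 - 1 / ?m) * (x * y) = x * y"
      unfolding xy using c0 by (simp add: field_simps)
    also have "?c * (y * ?p' * cpoly Q z + x * ?p * cpoly Q (1 / z)) - ?c\<^sup>2 * (x * y) * ?p * ?p'
       = cpoly Q z * cpoly Q (1 / z) - cpoly P z * cpoly P (1 / z)"
      unfolding P by (simp add: algebra_simps power2_eq_square)
    finally show ?thesis by (simp add: x_def y_def)
  qed
  have B1: "B 1 = of_real (lifetime_variance p * (poly Q 1)\<^sup>2 / q0\<^sup>2)"
  proof -
    have ph: "poly \<phi> 1 = \<mu> * poly Q 1 / q0" using phi1 q0 by (simp add: field_simps)
    have R: "poly R 1 = (lifetime_variance p + \<mu>\<^sup>2 - \<mu>) * poly Q 1 / (2 * \<mu> * q0)"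
      using R1 q0 mu by (simp add: field_simps)
    have "B 1 = of_real (2 * poly R 1 * poly \<phi> 1 - (1 - 1 / \<mu>) * (poly \<phi> 1)\<^sup>2)"
      by (simp add: B_def a0 power2_eq_square)
    also have "2 * poly R 1 * poly \<phi> 1 - (1 - 1 / \<mu>) * (poly \<phi> 1)\<^sup>2 = lifetime_variance p * (poly Q 1)\<^sup>2 / q0\<^sup>2"
      unfolding ph R using q0 mu by (simp add: field_simps power2_eq_square)
    finally show ?thesis .
  qed
  have B_nz: "B z \<noteq> 0" if z: "norm z = 1" for z
  proof (cases "z = 1")
    case True
    then show ?thesis using B1 var q0 q1 by simp
  next
    case False
    have z0: "z \<noteq> 0" using z by auto
    have inv: "1 / z = cnj z" using z z0 complex_norm_square[of z] by (simp add: field_simps)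
    have "cpoly Q z * cpoly Q (1 / z) - cpoly P z * cpoly P (1 / z)
        = of_real ((norm (cpoly Q z))\<^sup>2 - (norm (cpoly P z))\<^sup>2)"
      unfolding inv cnj_cpoly[symmetric] complex_norm_square[symmetric] by simp
    also have "norm (cpoly P z) = norm (F z) * norm (cpoly Q z)"
      using FQ[of z] z by (metis norm_mult order_refl)
    also have "(norm (cpoly Q z))\<^sup>2 - (norm (F z) * norm (cpoly Q z))\<^sup>2 = (norm (cpoly Q z))\<^sup>2 * (1 - (norm (F z))\<^sup>2)"
      by (simp add: power_mult_distrib algebra_simps)
    finally have "of_real (q0\<^sup>2) * ((1 - z) * (1 - 1 / z)) * B z = of_real ((norm (cpoly Q z))\<^sup>2 * (1 - (norm (F z))\<^sup>2))"
      using B_id[OF z0] by simp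
    moreover have "(norm (F z))\<^sup>2 < 1" using F_lt[of z] z False power_strict_mono[of "norm (F z)" 1 2] by simp
    then have "(norm (cpoly Q z))\<^sup>2 * (1 - (norm (F z))\<^sup>2) \<noteq> 0" using Qnz[of z] z by simp
    then have "complex_of_real ((norm (cpoly Q z))\<^sup>2 * (1 - (norm (F z))\<^sup>2)) \<noteq> 0"
      by (simp only: of_real_eq_0_iff not_False_eq_True)
    ultimately show ?thesis by auto
  qed
  have q_sym: "cpoly q z = z ^ (2 * n) * cpoly q (1 / z)" if "z \<noteq> 0" for z
    using that qB[of z] qB[of "1 / z"] by (simp add: B_sym power_divide mult_2 power_add)
  have q_nz: "cpoly q z \<noteq> 0" if z: "norm z = 1" for z
  proof -
    have "z \<noteq> 0" using z by auto
    then show ?thesis using qB[of z] B_nz[OF z] by simp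
  qed
  obtain \<theta> c where th: "poly \<theta> 0 = 1" "\<And>z. cpoly \<theta> z = 0 \<Longrightarrow> norm z > 1"
    and fac: "\<And>z. z \<noteq> 0 \<Longrightarrow> cpoly q z = of_real c * z ^ n * cpoly \<theta> z * cpoly \<theta> (1 / z)"
    using fejer_riesz[of q n, OF q_sym q_nz] by blast
  have Bth: "B z = of_real c * (cpoly \<theta> z * cpoly \<theta> (1 / z))" if "z \<noteq> 0" for z
    using qB[OF that] fac[OF that] that by simp
  have th1: "poly \<theta> 1 \<noteq> 0" using th(2)[of 1] by auto
  have c: "c = lifetime_variance p * (poly Q 1)\<^sup>2 / ((poly \<theta> 1)\<^sup>2 * (poly Q 0)\<^sup>2)"
  proof -
    have "complex_of_real (c * (poly \<theta> 1)\<^sup>2) = of_real (lifetime_variance p * (poly Q 1)\<^sup>2 / q0\<^sup>2)"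
      using Bth[of 1] B1 by (simp add: power2_eq_square)
    then have "c * (poly \<theta> 1)\<^sup>2 = lifetime_variance p * (poly Q 1)\<^sup>2 / q0\<^sup>2" by (simp only: of_real_eq_iff)
    then show ?thesis using th1 q0 by (simp add: q0_def field_simps)
  qed
  show ?thesis
  proof (rule that[of \<phi> \<theta> r])
    show "norm z > 1" if "cpoly \<phi> z = 0" for z using phi_nz[of z] that by force
    \<comment> \<open>At a common zero $w$ the numerator reduces to $R(w)\<phi>(1/w)$ with $\<phi>(1/w) \<noteq> 0$,
      and $R(w) = \<phi>(w) = 0$ force $Q(w) = P(w) = 0$.\<close>
    show "cpoly \<theta> w \<noteq> 0" if w: "cpoly \<phi> w = 0" for w
    proof
      assume t: "cpoly \<theta> w = 0"
      have n1: "norm w > 1" using th(2)[OF t] .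
      then have w0: "w \<noteq> 0" by auto
      have "cpoly \<phi> (1 / w) \<noteq> 0" using n1 by (intro phi_nz) (simp add: norm_divide divide_le_eq)
      moreover have "B w = 0" using Bth[OF w0] t by simp
      ultimately have "cpoly R w = 0" using w by (simp add: B_def)
      then have "cpoly Q w = 0" using cR[of w] w q0 by simp
      moreover from this have "cpoly P w = 0" using cQP[of w] w by simp
      ultimately show False using coprime_no_common_root[of P Q w] pq by (simp add: pgf_lowest_terms_def)
    qed
    show "norm z > 1" if "cpoly \<theta> z = 0" for z using th(2)[OF that] .
    show "poly Q 0 \<noteq> 0" using q0 unfolding q0_def .
    fix z :: complex assume z: "1 / r < norm z" "norm z < r"
    have z0: "z \<noteq> 0" using z r(1) by auto
    have z': "norm (1 / z) < r" using z(1) z0 r(1) by (simp add: norm_divide divide_less_eq mult.commute)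
    have eq: "cpoly R z / cpoly \<phi> z + cpoly R (1 / z) / cpoly \<phi> (1 / z) - of_real (a 0)
        = B z / (cpoly \<phi> z * cpoly \<phi> (1 / z))"
    proof -
      have "x / p + y / p' - e = (x * p' + y * p - e * (p * p')) / (p * p')"
        if "p \<noteq> 0" "p' \<noteq> 0" for x y p p' e :: complex
        using that by (simp add: add_divide_distrib diff_divide_distrib)
      then show ?thesis unfolding B_def using r(2)[OF z(2)] r(2)[OF z'] .
    qed
    have "((\<lambda>h::int. of_real (a (nat \<bar>h\<bar>)) * z powi h) has_sum B z / (cpoly \<phi> z * cpoly \<phi> (1 / z))) UNIV"
      unfolding eq[symmetric]
      by (rule has_sum_symmetric_Laurent[OF ser(1)[OF z(2)] ser(2)[OF z(2)] ser(1)[OF z'] ser(2)[OF z'] z0])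
    then show "((\<lambda>h::int. of_real (u (nat \<bar>h\<bar>) - 1 / \<mu>) * z powi h) has_sum
         of_real (lifetime_variance p * (poly Q 1)\<^sup>2 / ((poly \<theta> 1)\<^sup>2 * (poly Q 0)\<^sup>2)) *
         (cpoly \<theta> z * cpoly \<theta> (1 / z)) / (cpoly \<phi> z * cpoly \<phi> (1 / z))) UNIV"
      unfolding Bth[OF z0] c a_def .
  qed (fact phi0 th(1) q1 th1 r(1))+
qed

section \<open>Stationarity of the delayed renewal process\<close>

lemma (in finite_measure) measure_nat_valued_sums:
  fixes f :: "'a \<Rightarrow> nat"
  assumes [measurable]: "f \<in> measurable M (count_space UNIV)"
  shows "(\<lambda>n. if n \<in> A then measure M {\<omega> \<in> space M. f \<omega> = n} else 0) sums measure M {\<omega> \<in> space M. f \<omega> \<in> A}"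
proof -
  have "(\<lambda>n. measure M {\<omega> \<in> space M. f \<omega> = n \<and> n \<in> A}) sums measure M (\<Union>n. {\<omega> \<in> space M. f \<omega> = n \<and> n \<in> A})"
    by (rule finite_measure_UNION) (auto simp: disjoint_family_on_def)
  moreover have "(\<Union>n. {\<omega> \<in> space M. f \<omega> = n \<and> n \<in> A}) = {\<omega> \<in> space M. f \<omega> \<in> A}" by auto
  moreover have "measure M {\<omega> \<in> space M. f \<omega> = n \<and> n \<in> A} = (if n \<in> A then measure M {\<omega> \<in> space M. f \<omega> = n} else 0)" for n
    by auto
  ultimately show ?thesis by simp
qed

definition renewal_indicator :: "(nat \<Rightarrow> nat) \<Rightarrow> nat \<Rightarrow> real" where
  "renewal_indicator l t = (if \<exists>k. (\<Sum>j\<le>k. l j) = t then 1 else 0)"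

text \<open>
The lifetimes seen by an observer who starts one time unit later: if the first renewal has not yet
occurred the delay shrinks by one; if it occurs at time $0$ then the following lifetime, reduced by one,
becomes the new delay.  The two subtractions are meant for positive arguments.
\<close>

definition advance :: "(nat \<Rightarrow> nat) \<Rightarrow> nat \<Rightarrow> nat" where
  "advance l = (if l 0 = 0 then (\<lambda>k. if k = 0 then l 1 - 1 else l (Suc k))
                else (\<lambda>k. if k = 0 then l 0 - 1 else l k))"

text \<open>
Every partial sum of the lifetimes drops by one, except that a renewal at time $0$ disappears.  The
hypothesis keeps the subtraction in the new delay exact in that second case.
\<close>

lemma renewal_indicator_advance:
  assumes "l 1 \<noteq> 0"
  shows "renewal_indicator (advance l) t = renewal_indicator l (Suc t)"
proof (cases "l 0 = 0")
  case False
  have "(\<Sum>j\<le>k. l j) = Suc (\<Sum>j\<le>k. advance l j)" for k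
    using False by (induction k) (auto simp: advance_def)
  then show ?thesis by (simp add: renewal_indicator_def)
next
  case True
  have S: "(\<Sum>j\<le>Suc k. l j) = Suc (\<Sum>j\<le>k. advance l j)" for k
  proof (induction k)
    case 0
    then show ?case using True assms by (simp add: advance_def)
  next
    case (Suc k)
    then show ?case using True by (simp add: advance_def)
  qed
  have "(\<exists>k. (\<Sum>j\<le>k. l j) = Suc t) \<longleftrightarrow> (\<exists>k. (\<Sum>j\<le>k. advance l j) = t)"
  proof
    assume "\<exists>k. (\<Sum>j\<le>k. l j) = Suc t"
    then obtain k where k: "(\<Sum>j\<le>k. l j) = Suc t" by blast
    with True obtain k' where "k = Suc k'" by (cases k) auto
    then show "\<exists>k. (\<Sum>j\<le>k. advance l j) = t" using S[of k'] k by auto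
  next
    assume "\<exists>k. (\<Sum>j\<le>k. advance l j) = t"
    then show "\<exists>k. (\<Sum>j\<le>k. l j) = Suc t" using S by metis
  qed
  then show ?thesis by (simp add: renewal_indicator_def)
qed

abbreviation nat_seq_space :: "(nat \<Rightarrow> nat) measure" where
  "nat_seq_space \<equiv> PiM UNIV (\<lambda>_. count_space UNIV)"

abbreviation real_seq_space :: "(nat \<Rightarrow> real) measure" where
  "real_seq_space \<equiv> PiM UNIV (\<lambda>_. borel)"

lemma measurable_renewal_indicator [measurable]:
  "renewal_indicator \<in> measurable nat_seq_space real_seq_space"
proof (rule measurable_PiM_single')
  fix t :: nat
  show "(\<lambda>l. renewal_indicator l t) \<in> borel_measurable nat_seq_space"
    unfolding renewal_indicator_def by measurable
qed (auto simp: space_PiM)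

text \<open>
The delay has the equilibrium distribution of the lifetime, which is what makes the renewal process stationary.
\<close>

locale stationary_lifetimes = prob_space +
  fixes p :: "nat pmf" and L :: "nat \<Rightarrow> 'a \<Rightarrow> nat"
  assumes indep: "indep_vars (\<lambda>_. count_space UNIV) L UNIV"
    and later: "\<And>k. k \<ge> 1 \<Longrightarrow> distr M (count_space UNIV) (L k) = measure_pmf p"
    and first: "\<And>n. prob {\<omega> \<in> space M. L 0 \<omega> = n} = measure_pmf.prob p {n<..} / lifetime_mean p"
    and p0: "pmf p 0 = 0"
    and mean_pos: "lifetime_mean p > 0"
begin

lemma L_measurable [measurable]: "L k \<in> measurable M (count_space UNIV)"
  using indep by (auto simp: indep_vars_def)

lemma prob_later:
  assumes "k \<ge> 1" shows "prob {\<omega> \<in> space M. L k \<omega> \<in> A} = measure_pmf.prob p A"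
proof -
  have "measure_pmf.prob p A = measure (distr M (count_space UNIV) (L k)) A"
    using later[OF assms] by simp
  also have "\<dots> = prob (L k -` A \<inter> space M)" by (rule measure_distr) auto
  finally show ?thesis by (simp add: vimage_def Int_def conj_commute)
qed

lemma prob_cylinder:
  "prob {\<omega> \<in> space M. \<forall>j\<le>n. L j \<omega> \<in> B j}
     = prob {\<omega> \<in> space M. L 0 \<omega> \<in> B 0} * (\<Prod>j=1..n. measure_pmf.prob p (B j))"
proof -
  have "{\<omega> \<in> space M. \<forall>j\<le>n. L j \<omega> \<in> B j} = (\<Inter>j\<in>{..n}. L j -` B j \<inter> space M)" by auto
  then have "prob {\<omega> \<in> space M. \<forall>j\<le>n. L j \<omega> \<in> B j} = (\<Prod>j\<in>{..n}. prob (L j -` B j \<inter> space M))"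
    using indep_varsD[OF indep, of "{..n}" B] by simp
  also have "\<dots> = (\<Prod>j\<in>{..n}. prob {\<omega> \<in> space M. L j \<omega> \<in> B j})"
    by (intro prod.cong refl arg_cong[where f = prob]) auto
  also have "{..n} = insert 0 {1..n}" by auto
  also have "(\<Prod>j\<in>insert 0 {1..n}. prob {\<omega> \<in> space M. L j \<omega> \<in> B j})
     = prob {\<omega> \<in> space M. L 0 \<omega> \<in> B 0} * (\<Prod>j=1..n. measure_pmf.prob p (B j))"
    by (simp add: prob_later)
  finally show ?thesis .
qed

lemma prob_first_0: "prob {\<omega> \<in> space M. L 0 \<omega> = 0} = 1 / lifetime_mean p"
proof -
  have "{0<..} = UNIV - {0::nat}" by auto
  then have "measure_pmf.prob p {0<..} = 1 - measure_pmf.prob p {0}"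
    using measure_pmf.prob_compl[of "{0}" p] by simp
  then show ?thesis using first[of 0] by (simp add: measure_pmf_single p0)
qed

text \<open>
The new delay equals $n$ either because the old one was $n+1$ or because the old one was $0$ and the next
lifetime is $n+1$.  With $d_n = P(L > n)/\mu$ this is $d_n = d_{n+1} + d_0\,P(L = n+1)$, which holds since
$d_0 = 1/\mu$.
\<close>

lemma first_lifetime_balance:
  "prob {\<omega> \<in> space M. L 0 \<omega> = 0} * measure_pmf.prob p {m. m - 1 \<in> A}
     + prob {\<omega> \<in> space M. L 0 \<omega> \<in> {m. m \<noteq> 0 \<and> m - 1 \<in> A}} = prob {\<omega> \<in> space M. L 0 \<omega> \<in> A}"
proof -
  let ?d = "\<lambda>n. prob {\<omega> \<in> space M. L 0 \<omega> = n}"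
  have d: "?d n = ?d (Suc n) + pmf p (Suc n) / lifetime_mean p" for n
  proof -
    have "{n<..} = insert (Suc n) {Suc n<..}" by auto
    then have "measure_pmf.prob p {n<..} = pmf p (Suc n) + measure_pmf.prob p {Suc n<..}"
      using measure_pmf.finite_measure_Union[of "{Suc n}" p "{Suc n<..}"] by (simp add: measure_pmf_single)
    then show ?thesis by (simp add: first add_divide_distrib)
  qed
  have d0: "?d 0 = 1 / lifetime_mean p" by (rule prob_first_0)
  have shift: "(\<lambda>n. h (Suc n)) sums s" if "h sums s" "h 0 = 0" for h :: "nat \<Rightarrow> real" and s
    using that sums_Suc_iff[of h s] by simp
  have id: "(\<lambda>x. x) \<in> measurable (measure_pmf p) (count_space UNIV)" by simp
  have f0: "(\<lambda>n. if n \<in> {m. m - 1 \<in> A} then pmf p n else 0) sums measure_pmf.prob p {m. m - 1 \<in> A}"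
    using measure_pmf.measure_nat_valued_sums[OF id, of "{m. m - 1 \<in> A}"]
    by (simp add: measure_pmf_single cong: if_cong)
  have f: "(\<lambda>n. if n \<in> A then pmf p (Suc n) else 0) sums measure_pmf.prob p {m. m - 1 \<in> A}"
    using shift[OF f0] by (simp add: p0)
  have g0: "(\<lambda>n. if n \<in> {m. m \<noteq> 0 \<and> m - 1 \<in> A} then ?d n else 0) sums prob {\<omega> \<in> space M. L 0 \<omega> \<in> {m. m \<noteq> 0 \<and> m - 1 \<in> A}}"
    by (rule measure_nat_valued_sums) measurable
  have g: "(\<lambda>n. if n \<in> A then ?d (Suc n) else 0) sums prob {\<omega> \<in> space M. L 0 \<omega> \<in> {m. m \<noteq> 0 \<and> m - 1 \<in> A}}"
    using shift[OF g0] by simp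
  have "(\<lambda>n. if n \<in> A then ?d n else 0) sums
      (?d 0 * measure_pmf.prob p {m. m - 1 \<in> A} + prob {\<omega> \<in> space M. L 0 \<omega> \<in> {m. m \<noteq> 0 \<and> m - 1 \<in> A}})"
  proof -
    have "(\<lambda>n. ?d 0 * (if n \<in> A then pmf p (Suc n) else 0) + (if n \<in> A then ?d (Suc n) else 0)) sums
      (?d 0 * measure_pmf.prob p {m. m - 1 \<in> A} + prob {\<omega> \<in> space M. L 0 \<omega> \<in> {m. m \<noteq> 0 \<and> m - 1 \<in> A}})"
      by (intro sums_add sums_mult f g)
    moreover have "(?d 0 * (if n \<in> A then pmf p (Suc n) else 0) + (if n \<in> A then ?d (Suc n) else 0)) = (if n \<in> A then ?d n else 0)" for n
      using d[of n] by (simp add: d0)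
    ultimately show ?thesis by (simp only:)
  qed
  moreover have "(\<lambda>n. if n \<in> A then ?d n else 0) sums prob {\<omega> \<in> space M. L 0 \<omega> \<in> A}"
    by (rule measure_nat_valued_sums) measurable
  ultimately show ?thesis by (rule sums_unique2)
qed

text \<open>
Split according to whether the delay vanishes.  In both cases the event is a cylinder event for the original
lifetimes, and the factors belonging to the later lifetimes agree, which leaves the balance of the
delays.
\<close>

lemma prob_cylinder_advance:
  "prob {\<omega> \<in> space M. \<forall>j\<le>n. advance (\<lambda>k. L k \<omega>) j \<in> A j} = prob {\<omega> \<in> space M. \<forall>j\<le>n. L j \<omega> \<in> A j}"
proof -
  \<comment> \<open>The constraints on the original lifetimes for vanishing and for positive delay.\<close>
  define B1 where "B1 j = (if j = 0 then {0} else if j = 1 then {m. m - 1 \<in> A 0} else A (j - 1))" for j :: nat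
  define B2 where "B2 j = (if j = 0 then {m. m \<noteq> 0 \<and> m - 1 \<in> A 0} else A j)" for j :: nat
  let ?E1 = "{\<omega> \<in> space M. \<forall>j\<le>Suc n. L j \<omega> \<in> B1 j}" and ?E2 = "{\<omega> \<in> space M. \<forall>j\<le>n. L j \<omega> \<in> B2 j}"
  have "(\<forall>j\<le>n. advance l j \<in> A j) \<longleftrightarrow> (\<forall>j\<le>Suc n. l j \<in> B1 j) \<or> (\<forall>j\<le>n. l j \<in> B2 j)" for l
  proof (cases "l 0 = 0")
    case True
    have split: "(\<forall>j\<le>Suc n. R j) \<longleftrightarrow> R 0 \<and> (\<forall>j\<le>n. R (Suc j))" for R :: "nat \<Rightarrow> bool"
      by (metis Suc_le_mono le0 not0_implies_Suc)
    have "(\<forall>j\<le>Suc n. l j \<in> B1 j) \<longleftrightarrow> (\<forall>j\<le>n. l (Suc j) \<in> B1 (Suc j))"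
      unfolding split using True by (simp add: B1_def)
    also have "\<dots> \<longleftrightarrow> (\<forall>j\<le>n. advance l j \<in> A j)"
      using True by (intro all_cong) (auto simp: B1_def advance_def)
    finally show ?thesis using True by (auto simp: B2_def)
  next
    case False
    then have "(\<forall>j\<le>n. advance l j \<in> A j) \<longleftrightarrow> (\<forall>j\<le>n. l j \<in> B2 j)"
      by (intro all_cong) (auto simp: B2_def advance_def)
    then show ?thesis using False by (auto simp: B1_def)
  qed
  then have "{\<omega> \<in> space M. \<forall>j\<le>n. advance (\<lambda>k. L k \<omega>) j \<in> A j} = ?E1 \<union> ?E2" by auto
  moreover have "prob (?E1 \<union> ?E2) = prob ?E1 + prob ?E2"
  proof (rule finite_measure_Union)
    show "?E1 \<in> sets M" "?E2 \<in> sets M" by measurable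
    have "L 0 \<omega> = 0" if "\<omega> \<in> ?E1" for \<omega> using that by (auto simp: B1_def)
    moreover have "L 0 \<omega> \<noteq> 0" if "\<omega> \<in> ?E2" for \<omega> using that by (auto simp: B2_def)
    ultimately show "?E1 \<inter> ?E2 = {}" by blast
  qed
  moreover have "prob ?E1 = prob {\<omega> \<in> space M. L 0 \<omega> = 0} * measure_pmf.prob p {m. m - 1 \<in> A 0}
      * (\<Prod>j=1..n. measure_pmf.prob p (A j))"
  proof -
    have "(\<Prod>j=1..Suc n. measure_pmf.prob p (B1 j)) = measure_pmf.prob p (B1 1) * (\<Prod>j=1..n. measure_pmf.prob p (B1 (Suc j)))"
      by (subst prod.atLeast_Suc_atMost) (simp_all add: prod.shift_bounds_cl_Suc_ivl del: prod.cl_ivl_Suc)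
    also have "(\<Prod>j=1..n. measure_pmf.prob p (B1 (Suc j))) = (\<Prod>j=1..n. measure_pmf.prob p (A j))"
      by (intro prod.cong) (auto simp: B1_def)
    finally show ?thesis unfolding prob_cylinder by (simp add: B1_def)
  qed
  moreover have "prob ?E2 = prob {\<omega> \<in> space M. L 0 \<omega> \<in> {m. m \<noteq> 0 \<and> m - 1 \<in> A 0}} * (\<Prod>j=1..n. measure_pmf.prob p (A j))"
    unfolding prob_cylinder by (simp add: B2_def)
  ultimately show ?thesis
    unfolding prob_cylinder[of n A] first_lifetime_balance[of "A 0", symmetric] by (simp add: algebra_simps)
qed

lemma seq_measurable [measurable]: "(\<lambda>\<omega> k. L k \<omega>) \<in> measurable M nat_seq_space"
  by (rule measurable_PiM_single') (auto simp: space_PiM)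

lemma advance_measurable [measurable]: "advance \<in> measurable nat_seq_space nat_seq_space"
proof (rule measurable_PiM_single')
  fix k show "(\<lambda>l. advance l k) \<in> measurable nat_seq_space (count_space UNIV)"
  proof (cases "k = 0")
    case True
    have "(\<lambda>l. advance l k) = (\<lambda>l. if l 0 = 0 then l 1 - 1 else l 0 - 1)"
      using True by (auto simp: advance_def)
    then show ?thesis by simp
  next
    case False
    have "(\<lambda>l. advance l k) = (\<lambda>l. if l 0 = 0 then l (Suc k) else l k)"
      using False by (auto simp: advance_def)
    then show ?thesis by simp
  qed
qed (auto simp: space_PiM)

lemma distr_advance:
  "distr M nat_seq_space (\<lambda>\<omega>. advance (\<lambda>k. L k \<omega>)) = distr M nat_seq_space (\<lambda>\<omega> k. L k \<omega>)"
proof (rule measure_eqI_PiM_infinite)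
  fix A :: "nat \<Rightarrow> nat set" and J :: "nat set"
  assume J: "finite J"
  then obtain n where n: "J \<subseteq> {..n}" unfolding finite_nat_set_iff_bounded_le by blast
  define A' where "A' j = (if j \<in> J then A j else UNIV)" for j
  have emb: "prod_emb UNIV (\<lambda>_. count_space UNIV) J (Pi\<^sub>E J A) = {l. \<forall>j\<le>n. l j \<in> A' j}"
  proof -
    have "prod_emb UNIV (\<lambda>_. count_space UNIV) J (Pi\<^sub>E J A) = {l. \<forall>j\<in>J. l j \<in> A j}"
      by (auto simp: prod_emb_def space_PiM PiE_iff)
    also have "\<dots> = {l. \<forall>j\<le>n. l j \<in> A' j}" using n by (auto simp: A'_def)
    finally show ?thesis .
  qed
  have s: "{l. \<forall>j\<le>n. l j \<in> A' j} \<in> sets nat_seq_space"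
    unfolding emb[symmetric] using J by (intro sets_PiM_I) auto
  have m: "(\<lambda>\<omega>. advance (\<lambda>k. L k \<omega>)) \<in> measurable M nat_seq_space"
    by (rule measurable_compose[OF seq_measurable advance_measurable])
  show "emeasure (distr M nat_seq_space (\<lambda>\<omega>. advance (\<lambda>k. L k \<omega>))) (prod_emb UNIV (\<lambda>_. count_space UNIV) J (Pi\<^sub>E J A))
     = emeasure (distr M nat_seq_space (\<lambda>\<omega> k. L k \<omega>)) (prod_emb UNIV (\<lambda>_. count_space UNIV) J (Pi\<^sub>E J A))"
  proof -
    have "(\<lambda>\<omega>. advance (\<lambda>k. L k \<omega>)) -` {l. \<forall>j\<le>n. l j \<in> A' j} \<inter> space M
        = {\<omega> \<in> space M. \<forall>j\<le>n. advance (\<lambda>k. L k \<omega>) j \<in> A' j}"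
      "(\<lambda>\<omega> k. L k \<omega>) -` {l. \<forall>j\<le>n. l j \<in> A' j} \<inter> space M = {\<omega> \<in> space M. \<forall>j\<le>n. L j \<omega> \<in> A' j}"
      by blast+
    then show ?thesis
      unfolding emb emeasure_distr[OF m s] emeasure_distr[OF seq_measurable s] emeasure_eq_measure
      by (simp only: prob_cylinder_advance)
  qed
qed (auto intro: finite_measure_distr)

lemma renewal_process_measurable [measurable]:
  "(\<lambda>\<omega>. renewal_indicator (\<lambda>k. L k \<omega>)) \<in> measurable M real_seq_space"
  by (rule measurable_compose[OF seq_measurable measurable_renewal_indicator])

text \<open>
Shifting time by one replaces the lifetimes by their advanced version, which has the same law; positivity of
the lifetime $L_1$ is only available almost surely.
\<close>

lemma renewal_process_stationary:
  "distr M real_seq_space (\<lambda>\<omega> t. renewal_indicator (\<lambda>k. L k \<omega>) (Suc t))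
   = distr M real_seq_space (\<lambda>\<omega>. renewal_indicator (\<lambda>k. L k \<omega>))"
proof -
  have "AE \<omega> in M. L 1 \<omega> \<noteq> 0"
  proof -
    have "prob {\<omega> \<in> space M. L 1 \<omega> \<in> {0}} = 0" by (subst prob_later) (simp_all add: measure_pmf_single p0)
    then show ?thesis by (subst AE_iff_measurable[OF _ refl]) (simp_all add: emeasure_eq_measure)
  qed
  then have "AE \<omega> in M. (\<lambda>t. renewal_indicator (\<lambda>k. L k \<omega>) (Suc t)) = renewal_indicator (advance (\<lambda>k. L k \<omega>))"
    by eventually_elim (simp add: renewal_indicator_advance fun_eq_iff)
  then have "distr M real_seq_space (\<lambda>\<omega> t. renewal_indicator (\<lambda>k. L k \<omega>) (Suc t))
     = distr M real_seq_space (\<lambda>\<omega>. renewal_indicator (advance (\<lambda>k. L k \<omega>)))"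
  proof (rule distr_cong_AE[OF refl refl])
    show "(\<lambda>\<omega> t. renewal_indicator (\<lambda>k. L k \<omega>) (Suc t)) \<in> measurable M real_seq_space"
      by (rule measurable_PiM_single') (auto simp: space_PiM)
    show "(\<lambda>\<omega>. renewal_indicator (advance (\<lambda>k. L k \<omega>))) \<in> measurable M real_seq_space"
      by measurable
  qed
  also have "\<dots> = distr (distr M nat_seq_space (\<lambda>\<omega>. advance (\<lambda>k. L k \<omega>))) real_seq_space renewal_indicator"
    by (subst distr_distr) (auto simp: o_def)
  also have "\<dots> = distr (distr M nat_seq_space (\<lambda>\<omega> k. L k \<omega>)) real_seq_space renewal_indicator"
    unfolding distr_advance ..
  also have "\<dots> = distr M real_seq_space (\<lambda>\<omega>. renewal_indicator (\<lambda>k. L k \<omega>))"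
    by (subst distr_distr) (auto simp: o_def)
  finally show ?thesis .
qed

end

section \<open>The renewal equation and second moments\<close>

lemma shift_measurable [measurable]: "(\<lambda>f t. f (t + n)) \<in> measurable real_seq_space real_seq_space"
  by (rule measurable_PiM_single') (auto simp: space_PiM)

lemma distr_shift_invariant:
  assumes X: "X \<in> measurable M real_seq_space"
    and inv: "distr M real_seq_space (\<lambda>\<omega> t. X \<omega> (Suc t)) = distr M real_seq_space X"
  shows "distr M real_seq_space (\<lambda>\<omega> t. X \<omega> (t + n)) = distr M real_seq_space X"
proof (induction n)
  case (Suc n)
  have S: "(\<lambda>f t. f (Suc t)) \<in> measurable real_seq_space real_seq_space"
    using shift_measurable[of 1] by simp
  have "distr M real_seq_space (\<lambda>\<omega> t. X \<omega> (t + Suc n))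
     = distr (distr M real_seq_space (\<lambda>\<omega> t. X \<omega> (Suc t))) real_seq_space (\<lambda>f t. f (t + n))"
    by (subst distr_distr[OF shift_measurable measurable_compose[OF X S]]) (simp add: o_def)
  also have "\<dots> = distr M real_seq_space (\<lambda>\<omega> t. X \<omega> (t + n))"
    unfolding inv by (subst distr_distr[OF shift_measurable X]) (simp add: o_def)
  finally show ?case using Suc.IH by simp
qed simp

lemma renewal_indicator_iff:
  "renewal_indicator l h = 1 \<longleftrightarrow> (\<exists>j\<le>h. l 0 = j \<and> (\<exists>k. (\<Sum>i=1..k. l i) = h - j))"
proof -
  have "(\<Sum>j\<le>k. l j) = l 0 + (\<Sum>i=1..k. l i)" for k
  proof -
    have "{..k} = insert 0 {1..k}" by auto
    then show ?thesis by simp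
  qed
  moreover have "l 0 + s = h \<longleftrightarrow> l 0 \<le> h \<and> s = h - l 0" for s by auto
  ultimately show ?thesis by (simp add: renewal_indicator_def)
qed

lemma renewal_indicator_0_1: "renewal_indicator l h = 0 \<or> renewal_indicator l h = 1"
  by (simp add: renewal_indicator_def)

lemma (in prob_space) expectation_eq_prob:
  assumes "\<And>\<omega>. \<omega> \<in> space M \<Longrightarrow> Z \<omega> = (if P \<omega> then 1 else (0::real))" "{\<omega> \<in> space M. P \<omega>} \<in> events"
  shows "expectation Z = prob {\<omega> \<in> space M. P \<omega>}"
proof -
  have "expectation Z = expectation (indicator {\<omega> \<in> space M. P \<omega>})"
    by (rule Bochner_Integration.integral_cong) (auto simp: assms(1))
  then show ?thesis using assms(2) by simp
qed

context stationary_lifetimes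
begin

definition renewal_prob :: "nat \<Rightarrow> real" where
  "renewal_prob m = prob {\<omega> \<in> space M. \<exists>k. (\<Sum>i=1..k. L i \<omega>) = m}"

text \<open>
The delay is independent of the sequence of the later lifetimes.
\<close>

lemma prob_first_and_renewal:
  "prob {\<omega> \<in> space M. L 0 \<omega> = j \<and> (\<exists>k. (\<Sum>i=1..k. L i \<omega>) = m)}
     = prob {\<omega> \<in> space M. L 0 \<omega> = j} * renewal_prob m"
proof -
  let ?N = "\<lambda>A. PiM A (\<lambda>_. count_space UNIV) :: (nat \<Rightarrow> nat) measure"
  let ?a = "\<lambda>\<omega>. \<lambda>i\<in>{0}. L i \<omega>" and ?b = "\<lambda>\<omega>. \<lambda>i\<in>{1..}. L i \<omega>"
  let ?A = "{l \<in> space (?N {0}). l 0 = j}"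
  let ?B = "{l \<in> space (?N {1..}). \<exists>k. (\<Sum>i=1..k. l i) = m}"
  have ind: "indep_var (?N {0}) ?a (?N {1..}) ?b"
    by (rule indep_var_restrict[OF indep]) auto
  have A: "?A \<in> sets (?N {0})"
  proof -
    have [measurable]: "(\<lambda>l. l 0) \<in> measurable (?N {0}) (count_space UNIV)"
      by (rule measurable_component_singleton) simp
    show ?thesis by measurable
  qed
  have B: "?B \<in> sets (?N {1..})"
  proof -
    have [measurable]: "(\<lambda>l. \<Sum>i=1..k. l i) \<in> measurable (?N {1..}) (count_space UNIV)" for k :: nat
      by (rule measurable_sum_nat) (auto intro!: measurable_component_singleton)
    show ?thesis by measurable
  qed
  have "prob ((\<lambda>x. (?a x, ?b x)) -` (?A \<times> ?B) \<inter> space M) = prob (?a -` ?A \<inter> space M) * prob (?b -` ?B \<inter> space M)"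
    by (rule indep_varD[OF ind A B])
  moreover have sum: "(\<Sum>i=1..k. (\<lambda>i\<in>{1..}. L i \<omega>) i) = (\<Sum>i=1..k. L i \<omega>)" for k \<omega>
    by (rule sum.cong) auto
  have "?a -` ?A \<inter> space M = {\<omega> \<in> space M. L 0 \<omega> = j}"
    by (auto simp: space_PiM)
  moreover have "?b -` ?B \<inter> space M = {\<omega> \<in> space M. \<exists>k. (\<Sum>i=1..k. L i \<omega>) = m}"
    by (auto simp: space_PiM sum)
  moreover have "(\<lambda>x. (?a x, ?b x)) -` (?A \<times> ?B) \<inter> space M
     = {\<omega> \<in> space M. L 0 \<omega> = j \<and> (\<exists>k. (\<Sum>i=1..k. L i \<omega>) = m)}"
    by (auto simp: space_PiM sum)
  ultimately show ?thesis by (simp add: renewal_prob_def)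
qed

abbreviation X :: "nat \<Rightarrow> 'a \<Rightarrow> real" where
  "X t \<omega> \<equiv> renewal_indicator (\<lambda>k. L k \<omega>) t"

lemma X_measurable [measurable]: "X t \<in> borel_measurable M"
  using measurable_compose[OF renewal_process_measurable measurable_component_singleton[of t UNIV "\<lambda>_. borel"]] by simp

lemma expectation_X: "expectation (X t) = 1 / lifetime_mean p"
proof -
  have c: "(\<lambda>f. f s) \<in> borel_measurable real_seq_space" for s :: nat
    by (rule measurable_component_singleton) simp
  have X': "(\<lambda>\<omega> s. X (s + t) \<omega>) \<in> measurable M real_seq_space"
    by (rule measurable_compose[OF renewal_process_measurable shift_measurable])
  have "expectation (X t) = (\<integral>f. f 0 \<partial>distr M real_seq_space (\<lambda>\<omega> s. X (s + t) \<omega>))"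
    by (subst integral_distr[OF X' c]) simp
  also have "\<dots> = (\<integral>f. f 0 \<partial>distr M real_seq_space (\<lambda>\<omega>. renewal_indicator (\<lambda>k. L k \<omega>)))"
    by (subst distr_shift_invariant[OF renewal_process_measurable renewal_process_stationary]) simp
  also have "\<dots> = expectation (X 0)"
    by (subst integral_distr[OF renewal_process_measurable c]) simp
  also have "\<dots> = prob {\<omega> \<in> space M. L 0 \<omega> = 0}"
  proof (rule expectation_eq_prob)
    fix \<omega>
    have "X 0 \<omega> = 1 \<longleftrightarrow> L 0 \<omega> = 0"
      unfolding renewal_indicator_iff by (auto intro: exI[of _ 0])
    then show "X 0 \<omega> = (if L 0 \<omega> = 0 then 1 else 0)"
      using renewal_indicator_0_1[of "\<lambda>k. L k \<omega>" 0] by auto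
  qed measurable
  finally show ?thesis by (simp add: prob_first_0)
qed

text \<open>
By stationarity $P(X_h = 1) = 1/\mu$; decompose this event according to the value $j$ of the delay.
\<close>

lemma renewal_equation: "(\<Sum>j\<le>h. measure_pmf.prob p {j<..} * renewal_prob (h - j)) = 1"
proof -
  let ?E = "\<lambda>j. {\<omega> \<in> space M. L 0 \<omega> = j \<and> (\<exists>k. (\<Sum>i=1..k. L i \<omega>) = h - j)}"
  have E: "?E j \<in> events" for j by measurable
  have "1 / lifetime_mean p = prob {\<omega> \<in> space M. X h \<omega> = 1}"
    unfolding expectation_X[of h, symmetric]
    by (rule expectation_eq_prob) (use renewal_indicator_0_1 in auto)
  also have "{\<omega> \<in> space M. X h \<omega> = 1} = (\<Union>j\<in>{..h}. ?E j)"
    by (auto simp: renewal_indicator_iff)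
  also have "prob (\<Union>j\<in>{..h}. ?E j) = (\<Sum>j\<le>h. prob (?E j))"
    using E by (intro finite_measure_finite_Union) (auto simp: disjoint_family_on_def)
  also have "\<dots> = (\<Sum>j\<le>h. measure_pmf.prob p {j<..} * renewal_prob (h - j)) / lifetime_mean p"
    unfolding prob_first_and_renewal first by (simp add: sum_divide_distrib)
  finally show ?thesis using mean_pos by simp
qed

lemma expectation_X_product: "expectation (\<lambda>\<omega>. X 0 \<omega> * X h \<omega>) = renewal_prob h / lifetime_mean p"
proof -
  have "expectation (\<lambda>\<omega>. X 0 \<omega> * X h \<omega>) = prob {\<omega> \<in> space M. L 0 \<omega> = 0 \<and> (\<exists>k. (\<Sum>i=1..k. L i \<omega>) = h)}"
  proof (rule expectation_eq_prob)
    fix \<omega>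
    have 0: "X 0 \<omega> = 1 \<longleftrightarrow> L 0 \<omega> = 0"
      unfolding renewal_indicator_iff by (auto intro: exI[of _ 0])
    have "X h \<omega> = 1 \<longleftrightarrow> (\<exists>k. (\<Sum>i=1..k. L i \<omega>) = h)" if "L 0 \<omega> = 0"
      unfolding renewal_indicator_iff using that by auto
    with 0 show "X 0 \<omega> * X h \<omega> = (if L 0 \<omega> = 0 \<and> (\<exists>k. (\<Sum>i=1..k. L i \<omega>) = h) then 1 else 0)"
      using renewal_indicator_0_1[of "\<lambda>k. L k \<omega>" 0] renewal_indicator_0_1[of "\<lambda>k. L k \<omega>" h] by auto
  qed measurable
  then show ?thesis unfolding prob_first_and_renewal prob_first_0 by simp
qed

end

section \<open>Superposition of independent copies\<close>

lemma (in prob_space) cov_eq: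
  assumes "integrable M U" "integrable M V" "integrable M (\<lambda>\<omega>. U \<omega> * V \<omega>)"
  shows "cov M U V = expectation (\<lambda>\<omega>. U \<omega> * V \<omega>) - expectation U * expectation V"
proof -
  have "cov M U V = expectation (\<lambda>\<omega>. U \<omega> * V \<omega> - expectation V * U \<omega> - (expectation U * V \<omega> - expectation U * expectation V))"
    unfolding cov_def by (rule Bochner_Integration.integral_cong) (simp_all only: left_diff_distrib right_diff_distrib mult.commute)
  also have "\<dots> = expectation (\<lambda>\<omega>. U \<omega> * V \<omega>) - expectation U * expectation V"
    using assms by (simp add: prob_space)
  finally show ?thesis .
qed

text \<open>
Centre the variables and expand the product of the two sums: by independence the mixed terms have
expectation $0$.
\<close>

lemma (in prob_space) cov_sum_independent:
  fixes X :: "'i \<Rightarrow> nat \<Rightarrow> 'a \<Rightarrow> real"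
  assumes ind: "indep_vars (\<lambda>_. real_seq_space) (\<lambda>i \<omega> t. X i t \<omega>) I" and fin: "finite I"
    and bd: "\<And>i t \<omega>. i \<in> I \<Longrightarrow> \<omega> \<in> space M \<Longrightarrow> \<bar>X i t \<omega>\<bar> \<le> B"
  shows "cov M (\<lambda>\<omega>. \<Sum>i\<in>I. X i s \<omega>) (\<lambda>\<omega>. \<Sum>i\<in>I. X i t \<omega>) = (\<Sum>i\<in>I. cov M (X i s) (X i t))"
proof -
  have meas: "X i t \<in> borel_measurable M" if "i \<in> I" for i t
  proof -
    have "(\<lambda>\<omega> t. X i t \<omega>) \<in> measurable M real_seq_space"
      using ind that unfolding indep_vars_def by blast
    then show ?thesis
      by (rule measurable_compose) (rule measurable_component_singleton[OF UNIV_I])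
  qed
  have int: "integrable M (X i t)" if "i \<in> I" for i t
  proof (rule integrable_const_bound[of _ B])
    show "AE \<omega> in M. norm (X i t \<omega>) \<le> B"
      unfolding real_norm_def by (rule AE_I2) (rule bd[OF that])
  qed (rule meas[OF that])
  define V where "V i t \<omega> = X i t \<omega> - expectation (X i t)" for i t \<omega>
  have V_meas: "V i t \<in> borel_measurable M" if "i \<in> I" for i t
    unfolding V_def by (intro borel_measurable_diff meas that) auto
  have V_int: "integrable M (V i t)" if "i \<in> I" for i t
    unfolding V_def using int[OF that] by simp
  have V_bd: "\<bar>V i t \<omega>\<bar> \<le> B + \<bar>expectation (X i t)\<bar>" if "i \<in> I" "\<omega> \<in> space M" for i t \<omega>
    using bd[OF that, of t] unfolding V_def by linarith
  have VV_int: "integrable M (\<lambda>\<omega>. V i s \<omega> * V j t \<omega>)" if "i \<in> I" "j \<in> I" for i j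
  proof (rule integrable_const_bound[of _ "(B + \<bar>expectation (X i s)\<bar>) * (B + \<bar>expectation (X j t)\<bar>)"])
    have "\<bar>V i s \<omega> * V j t \<omega>\<bar> \<le> (B + \<bar>expectation (X i s)\<bar>) * (B + \<bar>expectation (X j t)\<bar>)"
      if "\<omega> \<in> space M" for \<omega>
      unfolding abs_mult using V_bd[OF \<open>i \<in> I\<close> that, of s] V_bd[OF \<open>j \<in> I\<close> that, of t]
      by (intro mult_mono) auto
    then show "AE \<omega> in M. norm (V i s \<omega> * V j t \<omega>) \<le> (B + \<bar>expectation (X i s)\<bar>) * (B + \<bar>expectation (X j t)\<bar>)"
      unfolding real_norm_def by (rule AE_I2)
    show "(\<lambda>\<omega>. V i s \<omega> * V j t \<omega>) \<in> borel_measurable M"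
      by (intro borel_measurable_times V_meas that)
  qed
  have E0: "expectation (V i t) = 0" if "i \<in> I" for i t
    unfolding V_def using int[OF that] by (simp add: prob_space)
  have off: "expectation (\<lambda>\<omega>. V i s \<omega> * V j t \<omega>) = 0" if "i \<in> I" "j \<in> I" "i \<noteq> j" for i j
  proof -
    define \<tau> where "\<tau> k = (if k = i then s else t)" for k
    have ind': "indep_vars (\<lambda>_. borel) (\<lambda>k \<omega>. X k (\<tau> k) \<omega> - expectation (X k (\<tau> k))) {i, j}"
      by (rule indep_vars_compose2[OF indep_vars_subset[OF ind]])
        (use that in \<open>auto intro!: borel_measurable_diff measurable_component_singleton\<close>)
    have "expectation (\<lambda>\<omega>. \<Prod>k\<in>{i, j}. V k (\<tau> k) \<omega>) = (\<Prod>k\<in>{i, j}. expectation (V k (\<tau> k)))"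
    proof -
      have "(\<lambda>k \<omega>. X k (\<tau> k) \<omega> - expectation (X k (\<tau> k))) = (\<lambda>k. V k (\<tau> k))"
        by (simp add: V_def fun_eq_iff)
      with ind' have "indep_vars (\<lambda>_. borel) (\<lambda>k. V k (\<tau> k)) {i, j}" by simp
      then show ?thesis
        by (intro indep_vars_lebesgue_integral) (use that V_int in auto)
    qed
    then show ?thesis using that E0[OF that(1)] by (simp add: \<tau>_def)
  qed
  have mean: "(\<Sum>i\<in>I. X i t \<omega>) - expectation (\<lambda>\<omega>. \<Sum>i\<in>I. X i t \<omega>) = (\<Sum>i\<in>I. V i t \<omega>)" for t \<omega>
    using int by (simp add: V_def sum_subtractf)
  have "cov M (\<lambda>\<omega>. \<Sum>i\<in>I. X i s \<omega>) (\<lambda>\<omega>. \<Sum>i\<in>I. X i t \<omega>) = expectation (\<lambda>\<omega>. \<Sum>i\<in>I. \<Sum>j\<in>I. V i s \<omega> * V j t \<omega>)"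
    unfolding cov_def mean by (simp add: sum_product)
  also have "\<dots> = (\<Sum>i\<in>I. \<Sum>j\<in>I. expectation (\<lambda>\<omega>. V i s \<omega> * V j t \<omega>))"
    using VV_int by (simp add: Bochner_Integration.integral_sum)
  also have "\<dots> = (\<Sum>i\<in>I. expectation (\<lambda>\<omega>. V i s \<omega> * V i t \<omega>))"
  proof (intro sum.cong refl)
    fix i assume i: "i \<in> I"
    have "(\<Sum>j\<in>I. expectation (\<lambda>\<omega>. V i s \<omega> * V j t \<omega>)) = (\<Sum>j\<in>I. if j = i then expectation (\<lambda>\<omega>. V i s \<omega> * V i t \<omega>) else 0)"
      using off i by (intro sum.cong) auto
    then show "(\<Sum>j\<in>I. expectation (\<lambda>\<omega>. V i s \<omega> * V j t \<omega>)) = expectation (\<lambda>\<omega>. V i s \<omega> * V i t \<omega>)"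
      using i fin by simp
  qed
  also have "\<dots> = (\<Sum>i\<in>I. cov M (X i s) (X i t))"
    by (simp add: cov_def V_def)
  finally show ?thesis .
qed

text \<open>
All statements are inherited from one copy: the joint law of the $M$ independent copies is a product of laws
that do not change under a shift, and the sum over the copies is a measurable function of them.  The renewal
sequence $v_i$ of each copy satisfies the renewal equation, which will identify all of them.
\<close>

lemma renewal_superposition_properties:
  assumes \<Omega>: "prob_space \<Omega>" and p: "lifetime p" and mean: "lifetime_mean p > 0" and m: "m \<ge> 1"
    and sup: "renewal_superposition \<Omega> p m Y"
  shows "(\<lambda>\<omega> t. Y t \<omega>) \<in> measurable \<Omega> real_seq_space"
    and "distr \<Omega> real_seq_space (\<lambda>\<omega> t. Y (Suc t) \<omega>) = distr \<Omega> real_seq_space (\<lambda>\<omega> t. Y t \<omega>)"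
    and "\<And>\<omega> t. \<omega> \<in> space \<Omega> \<Longrightarrow> \<bar>Y t \<omega>\<bar> \<le> real m"
    and "\<exists>v. (\<forall>i\<in>{1..m}. \<forall>h. (\<Sum>j\<le>h. measure_pmf.prob p {j<..} * v i (h - j)) = 1) \<and>
           (\<forall>h. cov \<Omega> (Y 0) (Y h) = (\<Sum>i=1..m. (v i h - 1 / lifetime_mean p) / lifetime_mean p))"
proof -
  interpret prob_space \<Omega> by fact
  let ?I = "{1..m}"
  obtain X where X: "\<And>i. i \<in> ?I \<Longrightarrow> stationary_renewal_count \<Omega> p (X i)"
    and ind: "indep_vars (\<lambda>_. real_seq_space) (\<lambda>i \<omega> t. X i t \<omega>) ?I"
    and Y: "\<And>t \<omega>. \<omega> \<in> space \<Omega> \<Longrightarrow> Y t \<omega> = (\<Sum>i\<in>?I. X i t \<omega>)"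
    using sup unfolding renewal_superposition_def by blast
  have "\<forall>i\<in>?I. \<exists>L. stationary_lifetimes \<Omega> p L \<and>
      (\<forall>t. \<forall>\<omega>\<in>space \<Omega>. X i t \<omega> = renewal_indicator (\<lambda>k. L k \<omega>) t)"
  proof
    fix i assume "i \<in> ?I"
    from X[OF this] obtain L :: "nat \<Rightarrow> 'a \<Rightarrow> nat" where
      "indep_vars (\<lambda>_. count_space UNIV) L UNIV"
      "\<forall>k\<ge>1. distr \<Omega> (count_space UNIV) (L k) = measure_pmf p"
      "\<forall>n. prob {\<omega> \<in> space \<Omega>. L 0 \<omega> = n} = measure_pmf.prob p {n<..} / lifetime_mean p"
      and XL: "\<forall>t. \<forall>\<omega>\<in>space \<Omega>. X i t \<omega> = (if \<exists>k. (\<Sum>j\<le>k. L j \<omega>) = t then 1 else 0)"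
      unfolding stationary_renewal_count_def by blast
    then have "stationary_lifetimes \<Omega> p L"
      using p mean by unfold_locales (auto simp: lifetime_def)
    then show "\<exists>L. stationary_lifetimes \<Omega> p L \<and>
      (\<forall>t. \<forall>\<omega>\<in>space \<Omega>. X i t \<omega> = renewal_indicator (\<lambda>k. L k \<omega>) t)"
      using XL unfolding renewal_indicator_def by blast
  qed
  then obtain L where L: "\<And>i. i \<in> ?I \<Longrightarrow> stationary_lifetimes \<Omega> p (L i)"
    and XL: "\<And>i t \<omega>. i \<in> ?I \<Longrightarrow> \<omega> \<in> space \<Omega> \<Longrightarrow> X i t \<omega> = renewal_indicator (\<lambda>k. L i k \<omega>) t"
    by metis
  have Xm: "(\<lambda>\<omega> t. X i t \<omega>) \<in> measurable \<Omega> real_seq_space" if "i \<in> ?I" for i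
    using ind that unfolding indep_vars_def by blast
  have S: "(\<lambda>f t. f (Suc t)) \<in> measurable real_seq_space real_seq_space"
    using shift_measurable[of 1] by simp
  have Xstat: "distr \<Omega> real_seq_space (\<lambda>\<omega> t. X i (Suc t) \<omega>) = distr \<Omega> real_seq_space (\<lambda>\<omega> t. X i t \<omega>)"
    if i: "i \<in> ?I" for i
  proof -
    have "distr \<Omega> real_seq_space (\<lambda>\<omega> t. X i (Suc t) \<omega>)
        = distr \<Omega> real_seq_space (\<lambda>\<omega> t. renewal_indicator (\<lambda>k. L i k \<omega>) (Suc t))"
      by (rule distr_cong) (simp_all add: XL[OF i])
    also have "\<dots> = distr \<Omega> real_seq_space (\<lambda>\<omega>. renewal_indicator (\<lambda>k. L i k \<omega>))"
      by (rule stationary_lifetimes.renewal_process_stationary[OF L[OF i]])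
    also have "\<dots> = distr \<Omega> real_seq_space (\<lambda>\<omega> t. X i t \<omega>)"
      by (rule distr_cong) (simp_all add: XL[OF i])
    finally show ?thesis .
  qed
  have ind': "indep_vars (\<lambda>_. real_seq_space) (\<lambda>i \<omega> t. X i (Suc t) \<omega>) ?I"
    using indep_vars_compose2[OF ind, of "\<lambda>_ f t. f (Suc t)" "\<lambda>_. real_seq_space"] S by simp
  have X1m: "(\<lambda>\<omega> t. X i (Suc t) \<omega>) \<in> measurable \<Omega> real_seq_space" if "i \<in> ?I" for i
    using ind' that unfolding indep_vars_def by blast
  let ?P = "PiM ?I (\<lambda>_. real_seq_space)"
  let ?S = "\<lambda>g t. \<Sum>i\<in>?I. g i t :: real"
  have joint: "distr \<Omega> ?P (\<lambda>\<omega>. \<lambda>i\<in>?I. \<lambda>t. X i (Suc t) \<omega>) = distr \<Omega> ?P (\<lambda>\<omega>. \<lambda>i\<in>?I. \<lambda>t. X i t \<omega>)"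
  proof -
    have ne: "?I \<noteq> {}" using m by simp
    have "distr \<Omega> ?P (\<lambda>\<omega>. \<lambda>i\<in>?I. \<lambda>t. X i (Suc t) \<omega>) = PiM ?I (\<lambda>i. distr \<Omega> real_seq_space (\<lambda>\<omega> t. X i (Suc t) \<omega>))"
      by (rule indep_vars_iff_distr_eq_PiM'[THEN iffD1, OF ne _ ind']) (rule X1m)
    also have "\<dots> = PiM ?I (\<lambda>i. distr \<Omega> real_seq_space (\<lambda>\<omega> t. X i t \<omega>))"
      by (rule PiM_cong) (simp_all add: Xstat)
    also have "\<dots> = distr \<Omega> ?P (\<lambda>\<omega>. \<lambda>i\<in>?I. \<lambda>t. X i t \<omega>)"
      by (rule indep_vars_iff_distr_eq_PiM'[THEN iffD1, OF ne _ ind, symmetric]) (rule Xm)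
    finally show ?thesis .
  qed
  have Sm: "?S \<in> measurable ?P real_seq_space"
  proof (rule measurable_PiM_single')
    fix t
    show "(\<lambda>g. \<Sum>i\<in>?I. g i t) \<in> borel_measurable ?P"
    proof (rule borel_measurable_sum)
      fix i assume "i \<in> ?I"
      then have "(\<lambda>g. g i) \<in> measurable ?P real_seq_space" by (rule measurable_component_singleton)
      then show "(\<lambda>g. g i t) \<in> borel_measurable ?P"
        by (rule measurable_compose) (rule measurable_component_singleton[OF UNIV_I])
    qed
  qed (auto simp: space_PiM)
  have Jm: "(\<lambda>\<omega>. \<lambda>i\<in>?I. \<lambda>t. X i t \<omega>) \<in> measurable \<Omega> ?P"
    by (rule measurable_restrict) (rule Xm)
  have J1m: "(\<lambda>\<omega>. \<lambda>i\<in>?I. \<lambda>t. X i (Suc t) \<omega>) \<in> measurable \<Omega> ?P"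
    by (rule measurable_restrict) (rule X1m)
  have YS: "(\<lambda>t. Y t \<omega>) = ?S (\<lambda>i\<in>?I. \<lambda>t. X i t \<omega>)" "(\<lambda>t. Y (Suc t) \<omega>) = ?S (\<lambda>i\<in>?I. \<lambda>t. X i (Suc t) \<omega>)"
    if "\<omega> \<in> space \<Omega>" for \<omega>
    using Y[OF that] by (auto simp: fun_eq_iff)
  show "(\<lambda>\<omega> t. Y t \<omega>) \<in> measurable \<Omega> real_seq_space"
    using measurable_compose[OF Jm Sm] by (subst measurable_cong[OF YS(1)])
  show "distr \<Omega> real_seq_space (\<lambda>\<omega> t. Y (Suc t) \<omega>) = distr \<Omega> real_seq_space (\<lambda>\<omega> t. Y t \<omega>)"
  proof -
    have "distr \<Omega> real_seq_space (\<lambda>\<omega> t. Y (Suc t) \<omega>) = distr (distr \<Omega> ?P (\<lambda>\<omega>. \<lambda>i\<in>?I. \<lambda>t. X i (Suc t) \<omega>)) real_seq_space ?S"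
      unfolding distr_distr[OF Sm J1m] o_def by (rule distr_cong[OF refl refl YS(2)])
    also have "\<dots> = distr \<Omega> real_seq_space (\<lambda>\<omega> t. Y t \<omega>)"
      unfolding joint distr_distr[OF Sm Jm] o_def by (rule distr_cong[OF refl refl YS(1)[symmetric]])
    finally show ?thesis .
  qed
  have Xb: "\<bar>X i t \<omega>\<bar> \<le> 1" if "i \<in> ?I" "\<omega> \<in> space \<Omega>" for i t \<omega>
    unfolding XL[OF that] by (simp add: renewal_indicator_def)
  show "\<bar>Y t \<omega>\<bar> \<le> real m" if "\<omega> \<in> space \<Omega>" for \<omega> t
  proof -
    have "\<bar>\<Sum>i\<in>?I. X i t \<omega>\<bar> \<le> (\<Sum>i\<in>?I. \<bar>X i t \<omega>\<bar>)" by (rule sum_abs)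
    also have "\<dots> \<le> (\<Sum>i\<in>?I. 1)" by (rule sum_mono) (rule Xb[OF _ that])
    finally show ?thesis using Y[OF that] by simp
  qed
  define v where "v i = stationary_lifetimes.renewal_prob \<Omega> (L i)" for i
  show "\<exists>v. (\<forall>i\<in>{1..m}. \<forall>h. (\<Sum>j\<le>h. measure_pmf.prob p {j<..} * v i (h - j)) = 1) \<and>
           (\<forall>h. cov \<Omega> (Y 0) (Y h) = (\<Sum>i=1..m. (v i h - 1 / lifetime_mean p) / lifetime_mean p))"
  proof (intro exI[of _ v] conjI ballI allI)
    show "(\<Sum>j\<le>h. measure_pmf.prob p {j<..} * v i (h - j)) = 1" if "i \<in> ?I" for i h
      unfolding v_def by (rule stationary_lifetimes.renewal_equation[OF L[OF that]])
    fix h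
    have cov_cong: "cov \<Omega> U V = cov \<Omega> U' V'"
      if "\<And>\<omega>. \<omega> \<in> space \<Omega> \<Longrightarrow> U \<omega> = U' \<omega>" "\<And>\<omega>. \<omega> \<in> space \<Omega> \<Longrightarrow> V \<omega> = V' \<omega>" for U U' V V' :: "'a \<Rightarrow> real"
    proof -
      have "expectation U = expectation U'" "expectation V = expectation V'"
        using that by (auto intro!: Bochner_Integration.integral_cong)
      then show ?thesis unfolding cov_def using that by (auto intro!: Bochner_Integration.integral_cong)
    qed
    have "cov \<Omega> (Y 0) (Y h) = cov \<Omega> (\<lambda>\<omega>. \<Sum>i\<in>?I. X i 0 \<omega>) (\<lambda>\<omega>. \<Sum>i\<in>?I. X i h \<omega>)"
      by (rule cov_cong) (simp_all add: Y)
    also have "\<dots> = (\<Sum>i\<in>?I. cov \<Omega> (X i 0) (X i h))"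
      by (rule cov_sum_independent[OF ind _ Xb]) simp_all
    also have "\<dots> = (\<Sum>i\<in>?I. (v i h - 1 / lifetime_mean p) / lifetime_mean p)"
    proof (rule sum.cong[OF refl])
      fix i assume i: "i \<in> ?I"
      interpret R: stationary_lifetimes \<Omega> p "L i" by (rule L[OF i])
      have int: "integrable \<Omega> (R.X t)" for t
      proof (rule integrable_const_bound[of _ 1])
        show "AE \<omega> in \<Omega>. norm (R.X t \<omega>) \<le> 1" by (simp add: renewal_indicator_def)
      qed (rule R.X_measurable)
      have int2: "integrable \<Omega> (\<lambda>\<omega>. R.X 0 \<omega> * R.X t \<omega>)" for t
      proof (rule integrable_const_bound[of _ 1])
        show "AE \<omega> in \<Omega>. norm (R.X 0 \<omega> * R.X t \<omega>) \<le> 1" by (simp add: renewal_indicator_def)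
      qed (intro borel_measurable_times R.X_measurable)
      have "cov \<Omega> (X i 0) (X i h) = cov \<Omega> (R.X 0) (R.X h)"
        by (rule cov_cong) (simp_all add: XL[OF i])
      also have "\<dots> = v i h / lifetime_mean p - (1 / lifetime_mean p) * (1 / lifetime_mean p)"
        unfolding cov_eq[OF int int int2] R.expectation_X R.expectation_X_product v_def ..
      finally show "cov \<Omega> (X i 0) (X i h) = (v i h - 1 / lifetime_mean p) / lifetime_mean p"
        by (simp add: diff_divide_distrib)
    qed
    finally show "cov \<Omega> (Y 0) (Y h) = (\<Sum>i=1..m. (v i h - 1 / lifetime_mean p) / lifetime_mean p)" .
  qed
qed

abbreviation real_int_seq_space :: "(int \<Rightarrow> real) measure" where
  "real_int_seq_space \<equiv> PiM UNIV (\<lambda>_. borel)"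

section \<open>Two-sided extensions\<close>

text \<open>
The law of $(W_j)_{j \in J}$ for a finite set $J$ of integers has to be that of $(Y_{j+n})_{j \in J}$ for any
$n$ that makes all indices nonnegative.  Stationarity makes this independent of $n$, hence consistent in
$J$, and Kolmogorov's theorem provides a measure on sequences with these marginals; the coordinate process
is then stationary because translating $J$ only changes the admissible $n$.
\<close>

lemma Kolmogorov_two_sided:
  fixes Y :: "nat \<Rightarrow> 'a \<Rightarrow> real"
  assumes M: "prob_space M"
    and Y: "(\<lambda>\<omega> t. Y t \<omega>) \<in> measurable M real_seq_space"
    and stat: "distr M real_seq_space (\<lambda>\<omega> t. Y (Suc t) \<omega>) = distr M real_seq_space (\<lambda>\<omega> t. Y t \<omega>)"
  shows "\<exists>(N :: (int \<Rightarrow> real) measure) W. two_sided_extension M Y N W"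
proof -
  interpret prob_space M by fact
  define P where "P J n = distr M (PiM J (\<lambda>_. borel)) (\<lambda>\<omega>. \<lambda>j\<in>J. Y (nat (j + int n)) \<omega>)" for J :: "int set" and n
  define k where "k J = nat (Max (insert 0 (abs ` J)))" for J :: "int set"
  have k: "0 \<le> j + int (k J)" if "finite J" "j \<in> J" for j J
  proof -
    have "\<bar>j\<bar> \<le> Max (insert 0 (abs ` J))" using that by (intro Max_ge) auto
    then show ?thesis unfolding k_def by linarith
  qed
  have Ym: "Y t \<in> borel_measurable M" for t
    using Y by (rule measurable_compose) (rule measurable_component_singleton[OF UNIV_I])
  have Pm: "(\<lambda>\<omega>. \<lambda>j\<in>J. Y (nat (j + int n)) \<omega>) \<in> measurable M (PiM J (\<lambda>_. borel))" for J :: "int set" and n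
    by (rule measurable_restrict) (rule Ym)
  have P_add: "P J (n + d) = P J n" if "\<And>j. j \<in> J \<Longrightarrow> 0 \<le> j + int n" for J n d
  proof -
    let ?g = "\<lambda>f. \<lambda>j\<in>J. f (nat (j + int n)) :: real"
    have g: "?g \<in> measurable real_seq_space (PiM J (\<lambda>_. borel))"
      by (rule measurable_restrict) (rule measurable_component_singleton, simp)
    have sh: "(\<lambda>\<omega> t. Y (t + d) \<omega>) \<in> measurable M real_seq_space"
      by (rule measurable_compose[OF Y shift_measurable])
    have "P J (n + d) = distr (distr M real_seq_space (\<lambda>\<omega> t. Y (t + d) \<omega>)) (PiM J (\<lambda>_. borel)) ?g"
      unfolding distr_distr[OF g sh] P_def o_def
    proof (rule distr_cong[OF refl refl])
      fix \<omega>
      show "(\<lambda>j\<in>J. Y (nat (j + int (n + d))) \<omega>) = (\<lambda>j\<in>J. Y (nat (j + int n) + d) \<omega>)"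
      proof (rule restrict_ext)
        fix j assume "j \<in> J"
        then have "nat (j + int (n + d)) = nat (j + int n) + d" using that[of j] by linarith
        then show "Y (nat (j + int (n + d))) \<omega> = Y (nat (j + int n) + d) \<omega>" by simp
      qed
    qed
    also have "distr M real_seq_space (\<lambda>\<omega> t. Y (t + d) \<omega>) = distr M real_seq_space (\<lambda>\<omega> t. Y t \<omega>)"
      by (rule distr_shift_invariant[OF Y stat])
    also have "distr \<dots> (PiM J (\<lambda>_. borel)) ?g = P J n"
      unfolding distr_distr[OF g Y] P_def o_def ..
    finally show ?thesis .
  qed
  have P_eq: "P J n = P J m" if "\<And>j. j \<in> J \<Longrightarrow> 0 \<le> j + int n" "\<And>j. j \<in> J \<Longrightarrow> 0 \<le> j + int m" for J n m
    using P_add[of J n "m - n"] P_add[of J m "n - m"] that by (cases "n \<le> m") auto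
  have "projective_family UNIV (\<lambda>J. P J (k J)) (\<lambda>_. borel)"
  proof (rule projective_family.intro)
    fix J H :: "int set" assume JH: "J \<subseteq> H" "finite H"
    have fJ: "finite J" and HJ: "H \<inter> J = J" using JH finite_subset by auto
    have "P J (k J) = P J (k H)"
      by (rule P_eq) (rule k[OF fJ] k[OF JH(2) subsetD[OF JH(1)]], assumption)+
    also have "\<dots> = distr (P H (k H)) (PiM J (\<lambda>_. borel)) (\<lambda>f. restrict f J)"
      unfolding P_def
      by (subst distr_distr[OF measurable_restrict_subset[OF JH(1)] Pm]) (simp only: o_def restrict_restrict HJ)
    finally show "P J (k J) = distr (P H (k H)) (PiM J (\<lambda>_. borel)) (\<lambda>f. restrict f J)" .
  next
    fix J :: "int set"
    show "prob_space (P J (k J))" unfolding P_def by (rule prob_space_distr[OF Pm])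
  qed
  then interpret K: polish_projective UNIV "\<lambda>J. P J (k J)"
    by (rule polish_projective.intro)
  define N where "N = K.lim"
  have sN: "sets N = sets real_int_seq_space" unfolding N_def by (rule K.sets_lim)
  have spN: "space N = UNIV" using sets_eq_imp_space_eq[OF sN] by (simp add: space_PiM)
  have PN: "prob_space N" unfolding N_def by (rule K.P.prob_space_axioms)
  have cyl: "emeasure N {f. \<forall>j\<in>J. f j \<in> A j} = emeasure M {\<omega> \<in> space M. \<forall>j\<in>J. Y (nat (j + int n)) \<omega> \<in> A j}"
    if J: "finite J" and A: "\<And>j. j \<in> J \<Longrightarrow> A j \<in> sets borel" and n: "\<And>j. j \<in> J \<Longrightarrow> 0 \<le> j + int n"
    for J :: "int set" and A n
  proof -
    have S: "Pi\<^sub>E J A \<in> sets (PiM J (\<lambda>_. borel))"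
      using J A by (rule sets_PiM_I_finite)
    have "{f. \<forall>j\<in>J. f j \<in> A j} = prod_emb UNIV (\<lambda>_. borel) J (Pi\<^sub>E J A)"
      by (auto simp: prod_emb_def space_PiM PiE_iff)
    then have "emeasure N {f. \<forall>j\<in>J. f j \<in> A j} = emeasure (P J (k J)) (Pi\<^sub>E J A)"
      unfolding N_def using K.emeasure_lim_emb[OF subset_UNIV J S] by simp
    also have "P J (k J) = P J n" by (rule P_eq) (use k[OF J] n in auto)
    also have "emeasure (P J n) (Pi\<^sub>E J A) = emeasure M ((\<lambda>\<omega>. \<lambda>j\<in>J. Y (nat (j + int n)) \<omega>) -` Pi\<^sub>E J A \<inter> space M)"
      unfolding P_def by (rule emeasure_distr[OF Pm S])
    also have "(\<lambda>\<omega>. \<lambda>j\<in>J. Y (nat (j + int n)) \<omega>) -` Pi\<^sub>E J A \<inter> space M = {\<omega> \<in> space M. \<forall>j\<in>J. Y (nat (j + int n)) \<omega> \<in> A j}"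
      by (auto simp: PiE_iff)
    finally show ?thesis .
  qed
  have emb: "prod_emb UNIV (\<lambda>_. borel) J (Pi\<^sub>E J A) = {f. \<forall>j\<in>J. f j \<in> A j}" for J :: "'i set" and A :: "'i \<Rightarrow> real set"
    by (auto simp: prod_emb_def space_PiM PiE_iff)
  have meas_N: "g \<in> measurable N M' \<longleftrightarrow> g \<in> measurable real_int_seq_space M'" for g and M' :: "'c measure"
    using measurable_cong_sets[OF sN refl] by blast
  have "two_sided_extension M Y N (\<lambda>t f. f t)"
    unfolding two_sided_extension_def strictly_stationary_def
  proof (intro conjI allI)
    show "prob_space N" by (rule PN)
    show "(\<lambda>f. f t) \<in> borel_measurable N" for t
      unfolding meas_N by (rule measurable_component_singleton) simp
    fix s :: int
    show "distr N real_int_seq_space (\<lambda>f t. f (t + s)) = distr N real_int_seq_space (\<lambda>f t. f t)"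
    proof (rule measure_eqI_PiM_infinite)
      fix A :: "int \<Rightarrow> real set" and J :: "int set"
      assume J: "finite J" and A: "\<And>j. j \<in> J \<Longrightarrow> A j \<in> sets borel"
      define n where "n = k J + nat \<bar>s\<bar>"
      have n: "0 \<le> j + int n" "0 \<le> j + s + int n" "0 \<le> j + int (nat (int n + s))" if "j \<in> J" for j
        using k[OF J that] unfolding n_def by linarith+
      have n0: "0 \<le> int n + s" unfolding n_def by linarith
      have m1: "(\<lambda>f t. f (t + s)) \<in> measurable N real_int_seq_space"
        unfolding meas_N by (rule measurable_PiM_single') (auto simp: space_PiM)
      have m2: "(\<lambda>f t. f t) \<in> measurable N real_int_seq_space"
        unfolding meas_N by (rule measurable_PiM_single') (auto simp: space_PiM)
      have S: "{f. \<forall>j\<in>J. f j \<in> A j} \<in> sets real_int_seq_space"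
        unfolding emb[symmetric] using J A by (intro sets_PiM_I) auto
      have "{f. \<forall>j\<in>J. f (j + s) \<in> A j} = {f. \<forall>i\<in>(\<lambda>j. j + s) ` J. f i \<in> A (i - s)}" by auto
      then have "emeasure N {f. \<forall>j\<in>J. f (j + s) \<in> A j}
          = emeasure M {\<omega> \<in> space M. \<forall>i\<in>(\<lambda>j. j + s) ` J. Y (nat (i + int n)) \<omega> \<in> A (i - s)}"
        by (simp only:) (rule cyl, use J A n in auto)
      also have "\<dots> = emeasure M {\<omega> \<in> space M. \<forall>j\<in>J. Y (nat (j + int (nat (int n + s)))) \<omega> \<in> A j}"
        using n0 by (simp add: algebra_simps)
      also have "\<dots> = emeasure N {f. \<forall>j\<in>J. f j \<in> A j}"
        by (rule cyl[symmetric]) (use J A n in auto)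
      finally have eq: "emeasure N {f. \<forall>j\<in>J. f (j + s) \<in> A j} = emeasure N {f. \<forall>j\<in>J. f j \<in> A j}" .
      have v1: "(\<lambda>f t. f (t + s)) -` {f. \<forall>j\<in>J. f j \<in> A j} \<inter> space N = {f. \<forall>j\<in>J. f (j + s) \<in> A j}"
        and v2: "(\<lambda>f t. f t) -` {f. \<forall>j\<in>J. f j \<in> A j} \<inter> space N = {f. \<forall>j\<in>J. f j \<in> A j}"
        unfolding spN by blast+
      show "emeasure (distr N real_int_seq_space (\<lambda>f t. f (t + s))) (prod_emb UNIV (\<lambda>_. borel) J (Pi\<^sub>E J A))
          = emeasure (distr N real_int_seq_space (\<lambda>f t. f t)) (prod_emb UNIV (\<lambda>_. borel) J (Pi\<^sub>E J A))"
        unfolding emb emeasure_distr[OF m1 S] emeasure_distr[OF m2 S] v1 v2 by (rule eq)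
    next
      have m1: "(\<lambda>f t. f (t + s)) \<in> measurable N real_int_seq_space"
        unfolding meas_N by (rule measurable_PiM_single') (auto simp: space_PiM)
      show "finite_measure (distr N real_int_seq_space (\<lambda>f t. f (t + s)))"
        using prob_space.prob_space_distr[OF PN m1] by (simp add: prob_space_def)
    qed simp_all
  next
    show "distr N real_seq_space (\<lambda>f t. f (int t)) = distr M real_seq_space (\<lambda>\<omega> t. Y t \<omega>)"
    proof (rule measure_eqI_PiM_infinite)
      fix A :: "nat \<Rightarrow> real set" and J :: "nat set"
      assume J: "finite J" and A: "\<And>j. j \<in> J \<Longrightarrow> A j \<in> sets borel"
      have m1: "(\<lambda>f t. f (int t)) \<in> measurable N real_seq_space"
        unfolding meas_N by (rule measurable_PiM_single') (auto simp: space_PiM)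
      have S: "{f. \<forall>j\<in>J. f j \<in> A j} \<in> sets real_seq_space"
        unfolding emb[symmetric] using J A by (intro sets_PiM_I) auto
      have "{f. \<forall>j\<in>J. f (int j) \<in> A j} = {f. \<forall>i\<in>int ` J. f i \<in> A (nat i)}" by auto
      then have "emeasure N {f. \<forall>j\<in>J. f (int j) \<in> A j}
          = emeasure M {\<omega> \<in> space M. \<forall>i\<in>int ` J. Y (nat (i + int 0)) \<omega> \<in> A (nat i)}"
        by (simp only:) (rule cyl, use J A in auto)
      also have "\<dots> = emeasure M {\<omega> \<in> space M. \<forall>j\<in>J. Y j \<omega> \<in> A j}" by simp
      finally have eq: "emeasure N {f. \<forall>j\<in>J. f (int j) \<in> A j} = emeasure M {\<omega> \<in> space M. \<forall>j\<in>J. Y j \<omega> \<in> A j}" .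
      have v1: "(\<lambda>f t. f (int t)) -` {f. \<forall>j\<in>J. f j \<in> A j} \<inter> space N = {f. \<forall>j\<in>J. f (int j) \<in> A j}"
        and v2: "(\<lambda>\<omega> t. Y t \<omega>) -` {f. \<forall>j\<in>J. f j \<in> A j} \<inter> space M = {\<omega> \<in> space M. \<forall>j\<in>J. Y j \<omega> \<in> A j}"
        unfolding spN by blast+
      show "emeasure (distr N real_seq_space (\<lambda>f t. f (int t))) (prod_emb UNIV (\<lambda>_. borel) J (Pi\<^sub>E J A))
          = emeasure (distr M real_seq_space (\<lambda>\<omega> t. Y t \<omega>)) (prod_emb UNIV (\<lambda>_. borel) J (Pi\<^sub>E J A))"
        unfolding emb emeasure_distr[OF m1 S] emeasure_distr[OF Y S] v1 v2 by (rule eq)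
    next
      have m1: "(\<lambda>f t. f (int t)) \<in> measurable N real_seq_space"
        unfolding meas_N by (rule measurable_PiM_single') (auto simp: space_PiM)
      show "finite_measure (distr N real_seq_space (\<lambda>f t. f (int t)))"
        using prob_space.prob_space_distr[OF PN m1] by (simp add: prob_space_def)
    qed simp_all
  qed
  then show ?thesis by blast
qed

text \<open>
By stationarity the law of the process from any integer time $s$ onwards is that of the one-sided
process, so bounds and second moments carry over.
\<close>

lemma two_sided_extension_moments:
  fixes Y :: "nat \<Rightarrow> 'a \<Rightarrow> real" and W :: "int \<Rightarrow> 'b \<Rightarrow> real"
  assumes ext: "two_sided_extension \<Omega> Y N W" 
    and Y: "(\<lambda>\<omega> t. Y t \<omega>) \<in> measurable \<Omega> real_seq_space"
    and Yb: "\<And>\<omega> t. \<omega> \<in> space \<Omega> \<Longrightarrow> \<bar>Y t \<omega>\<bar> \<le> B"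
  shows "weakly_stationary N W" and "\<And>t. AE \<omega> in N. \<bar>W t \<omega>\<bar> \<le> B"
    and "\<And>s t. cov N (W s) (W t) = cov \<Omega> (Y 0) (Y (nat \<bar>s - t\<bar>))"
proof -
  interpret prob_space N using ext unfolding two_sided_extension_def by (rule conjunct1)
  have Wm: "W t \<in> borel_measurable N" for t
    using ext unfolding two_sided_extension_def strictly_stationary_def by blast
  have stat: "distr N real_int_seq_space (\<lambda>\<omega> t. W (t + s) \<omega>) = distr N real_int_seq_space (\<lambda>\<omega> t. W t \<omega>)" for s
    using ext unfolding two_sided_extension_def strictly_stationary_def by blast
  have Wsm: "(\<lambda>\<omega> t. W (t + s) \<omega>) \<in> measurable N real_int_seq_space" for s
    by (rule measurable_PiM_single') (auto simp: space_PiM Wm)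
  have Wnm: "(\<lambda>\<omega> n. W (int n + s) \<omega>) \<in> measurable N real_seq_space" for s
    by (rule measurable_PiM_single') (auto simp: space_PiM Wm)
  have res: "(\<lambda>f n. f (int n)) \<in> measurable real_int_seq_space real_seq_space"
    by (rule measurable_PiM_single') (auto simp: space_PiM)
  have law: "distr N real_seq_space (\<lambda>\<omega> n. W (int n + s) \<omega>) = distr \<Omega> real_seq_space (\<lambda>\<omega> n. Y n \<omega>)" for s
  proof -
    have "distr N real_seq_space (\<lambda>\<omega> n. W (int n + s) \<omega>)
        = distr (distr N real_int_seq_space (\<lambda>\<omega> t. W (t + s) \<omega>)) real_seq_space (\<lambda>f n. f (int n))"
      unfolding distr_distr[OF res Wsm] o_def ..
    also have "\<dots> = distr (distr N real_int_seq_space (\<lambda>\<omega> t. W (t + 0) \<omega>)) real_seq_space (\<lambda>f n. f (int n))"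
      by (simp only: stat[of s] stat[of 0])
    also have "\<dots> = distr N real_seq_space (\<lambda>\<omega> n. W (int n) \<omega>)"
      unfolding distr_distr[OF res Wsm] unfolding o_def add_0_right ..
    also have "\<dots> = distr \<Omega> real_seq_space (\<lambda>\<omega> n. Y n \<omega>)"
      using ext unfolding two_sided_extension_def by blast
    finally show ?thesis .
  qed
  have transfer: "(\<integral>\<omega>. G (\<lambda>n. W (int n + s) \<omega>) \<partial>N) = (\<integral>\<omega>. G (\<lambda>n. Y n \<omega>) \<partial>\<Omega>)"
    if "G \<in> borel_measurable real_seq_space" for G :: "(nat \<Rightarrow> real) \<Rightarrow> real" and s
    unfolding integral_distr[OF Wnm that, symmetric] law integral_distr[OF Y that] ..
  have comp: "(\<lambda>f. f n) \<in> borel_measurable real_seq_space" for n :: nat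
    by (rule measurable_component_singleton) simp
  have mean: "expectation (W (s + int n)) = (\<integral>\<omega>. Y n \<omega> \<partial>\<Omega>)" for s n
    using transfer[OF comp[of n], of s] unfolding add.commute[of s] .
  have cov_le: "cov N (W s) (W (s + int n)) = cov \<Omega> (Y 0) (Y n)" for s n
  proof -
    let ?a = "\<integral>\<omega>. Y 0 \<omega> \<partial>\<Omega>" and ?b = "\<integral>\<omega>. Y n \<omega> \<partial>\<Omega>"
    have "(\<lambda>f. (f 0 - ?a) * (f n - ?b)) \<in> borel_measurable real_seq_space"
      by (intro borel_measurable_times borel_measurable_diff comp borel_measurable_const)
    from transfer[OF this, of s] show ?thesis
      using mean[of s 0] mean[of s n] unfolding cov_def add.commute[of s] by simp
  qed
  have cov_sym: "cov N (W s) (W t) = cov N (W t) (W s)" for s t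
    by (simp add: cov_def mult.commute)
  show cov_eq: "cov N (W s) (W t) = cov \<Omega> (Y 0) (Y (nat \<bar>s - t\<bar>))" for s t
  proof (cases "s \<le> t")
    case True
    then show ?thesis using cov_le[of s "nat (t - s)"] by simp
  next
    case False
    then show ?thesis using cov_le[of t "nat (s - t)"] cov_sym[of s t] by simp
  qed
  show AE_b: "AE \<omega> in N. \<bar>W t \<omega>\<bar> \<le> B" for t
  proof -
    have S: "{f \<in> space real_seq_space. \<bar>f 0\<bar> \<le> B} \<in> sets real_seq_space"
      by (intro borel_measurable_le borel_measurable_abs comp borel_measurable_const)
    have "AE f in distr \<Omega> real_seq_space (\<lambda>\<omega> n. Y n \<omega>). \<bar>f 0\<bar> \<le> B"
      unfolding AE_distr_iff[OF Y S] by (rule AE_I2) (rule Yb)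
    then have "AE f in distr N real_seq_space (\<lambda>\<omega> n. W (int n + t) \<omega>). \<bar>f 0\<bar> \<le> B"
      unfolding law .
    then show ?thesis unfolding AE_distr_iff[OF Wnm S] by simp
  qed
  show "weakly_stationary N W"
    unfolding weakly_stationary_def
  proof (intro conjI allI)
    fix s t h :: int
    show "W t \<in> borel_measurable N" by (rule Wm)
    show "integrable N (\<lambda>\<omega>. (W t \<omega>)\<^sup>2)"
    proof (rule integrable_const_bound[of _ "B\<^sup>2"])
      show "AE \<omega> in N. norm ((W t \<omega>)\<^sup>2) \<le> B\<^sup>2"
        using AE_b[of t]
      proof (rule eventually_mono)
        fix \<omega> assume "\<bar>W t \<omega>\<bar> \<le> B"
        then have "(W t \<omega>)\<^sup>2 \<le> B\<^sup>2" using abs_le_square_iff[of "W t \<omega>" B] by linarith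
        then show "norm ((W t \<omega>)\<^sup>2) \<le> B\<^sup>2" by simp
      qed
    qed (intro borel_measurable_power Wm)
    show "expectation (W s) = expectation (W t)" using mean[of s 0] mean[of t 0] by simp
    show "cov N (W s) (W (s + h)) = cov N (W t) (W (t + h))" unfolding cov_eq by simp
  qed
qed

section \<open>Laurent series on the unit circle\<close>

lemma sum_roots_of_unity_powi:
  fixes d :: int
  assumes n: "n > 0" and d: "\<bar>d\<bar> < int n"
  shows "(\<Sum>k<n. cis (2 * pi * real k / real n) powi d) = (if d = 0 then of_nat n else 0)"
proof (cases "d = 0")
  case False
  define w where "w = cis (2 * pi * of_int d / real n)"
  have "cis (2 * pi * real k / real n) powi d = w ^ k" for k
    by (simp add: w_def cis_power_int Complex.DeMoivre mult_ac)
  moreover have "w \<noteq> 1"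
  proof
    assume "w = 1"
    then obtain m :: int where "2 * pi * of_int d / real n = of_int m * (2 * pi)"
      unfolding w_def cis_eq_1_iff by blast
    then have "of_int d = (of_int (m * int n) :: real)" using n by (simp add: field_simps)
    then have "d = m * int n" by (simp only: of_int_eq_iff)
    then have "int n dvd d" by simp
    then have "int n \<le> \<bar>d\<bar>" using False by (metis dvd_imp_le_int abs_of_nat)
    then show False using d by simp
  qed
  moreover have "w ^ n = 1"
  proof -
    have "w ^ n = cis (real n * (2 * pi * of_int d / real n))" unfolding w_def by (rule Complex.DeMoivre)
    also have "real n * (2 * pi * of_int d / real n) = of_int d * (2 * pi)" using n by simp
    also have "cis (of_int d * (2 * pi)) = 1" unfolding cis_eq_1_iff by blast
    finally show ?thesis .
  qed
  ultimately show ?thesis using False by (simp add: geometric_sum)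
qed simp

text \<open>
Up to an error $\epsilon$, uniformly on the circle, the series is a finite sum.  Averaging
$z^{-j}$ times it over the $n$-th roots of unity, with $n$ larger than all exponents that occur,
isolates the coefficient of $z^j$, and the averaging does not enlarge the error.
\<close>

lemma Laurent_coeffs_of_constant:
  fixes \<kappa> :: "int \<Rightarrow> complex"
  assumes hs: "\<And>z. norm z = 1 \<Longrightarrow> ((\<lambda>h. \<kappa> h * z powi h) has_sum c) UNIV"
  shows "\<kappa> j = (if j = 0 then c else 0)"
proof -
  let ?c = "if j = 0 then c else 0"
  have "norm (\<kappa> j - ?c) \<le> \<epsilon>" if \<epsilon>: "\<epsilon> > 0" for \<epsilon>
  proof -
    have "(\<kappa> has_sum c) UNIV" using hs[of 1] by simp
    then have "\<kappa> summable_on UNIV" by (rule has_sum_imp_summable)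
    then have abs: "(\<lambda>h. norm (\<kappa> h)) summable_on UNIV"
      by (rule summable_on_iff_abs_summable_on_complex[THEN iffD1])
    define s where "s = infsum (\<lambda>h. norm (\<kappa> h)) UNIV"
    have hs_abs: "((\<lambda>h. norm (\<kappa> h)) has_sum s) UNIV"
      unfolding s_def using abs by (rule has_sum_infsum)
    obtain F0 where F0: "finite F0" "dist (sum (\<lambda>h. norm (\<kappa> h)) F0) s \<le> \<epsilon>"
      using has_sum_finite_approximation[OF hs_abs \<epsilon>] by blast
    define F where "F = insert j F0"
    have F: "finite F" "j \<in> F" using F0 by (auto simp: F_def)
    have Fs: "s - sum (\<lambda>h. norm (\<kappa> h)) F \<le> \<epsilon>"
    proof -
      have "sum (\<lambda>h. norm (\<kappa> h)) F0 \<le> sum (\<lambda>h. norm (\<kappa> h)) F"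
        using F(1) by (intro sum_mono2) (auto simp: F_def)
      then show ?thesis using F0(2) by (simp add: dist_real_def)
    qed
    have near: "norm ((\<Sum>h\<in>F. \<kappa> h * z powi h) - c) \<le> \<epsilon>" if z: "norm z = 1" for z
    proof -
      have nz: "norm (\<kappa> h * z powi h) = norm (\<kappa> h)" for h
        using z by (simp add: norm_mult norm_power_int)
      have "((\<lambda>h. \<kappa> h * z powi h) has_sum (c - (\<Sum>h\<in>F. \<kappa> h * z powi h))) (UNIV - F)"
        by (rule has_sum_Diff[OF hs[OF z]]) (use F in auto)
      moreover have "((\<lambda>h. norm (\<kappa> h * z powi h)) has_sum (s - sum (\<lambda>h. norm (\<kappa> h)) F)) (UNIV - F)"
        unfolding nz by (rule has_sum_Diff[OF hs_abs]) (use F in auto)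
      ultimately have "norm (c - (\<Sum>h\<in>F. \<kappa> h * z powi h)) \<le> s - sum (\<lambda>h. norm (\<kappa> h)) F"
        by (intro norm_has_sum_bound)
      then show ?thesis using Fs by (simp add: norm_minus_commute)
    qed
    define n where "n = Suc (nat (\<Sum>h\<in>insert 0 F. \<bar>h - j\<bar>))"
    have n: "n > 0" "\<bar>h - j\<bar> < int n" if "h \<in> insert 0 F" for h
    proof -
      have "\<bar>h - j\<bar> \<le> (\<Sum>h\<in>insert 0 F. \<bar>h - j\<bar>)"
        using F that by (intro member_le_sum) auto
      then show "\<bar>h - j\<bar> < int n" unfolding n_def by linarith
    qed (simp add: n_def)
    define \<zeta> where "\<zeta> k = cis (2 * pi * real k / real n)" for k
    have \<zeta>: "norm (\<zeta> k) = 1" "\<zeta> k \<noteq> 0" for k by (simp_all add: \<zeta>_def)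
    have root: "(\<Sum>k<n. \<zeta> k powi d) = (if d = 0 then of_nat n else 0)" if "\<bar>d\<bar> < int n" for d
      unfolding \<zeta>_def using n(1)[of 0] that by (intro sum_roots_of_unity_powi) auto
    have "(\<Sum>k<n. \<zeta> k powi (-j) * ((\<Sum>h\<in>F. \<kappa> h * \<zeta> k powi h) - c))
        = (\<Sum>k<n. (\<Sum>h\<in>F. \<kappa> h * \<zeta> k powi (h - j)) - c * \<zeta> k powi (0 - j))"
      using \<zeta>(2) by (intro sum.cong refl)
        (simp add: right_diff_distrib sum_distrib_left power_int_diff power_int_minus divide_inverse mult_ac)
    also have "\<dots> = (\<Sum>h\<in>F. \<kappa> h * (\<Sum>k<n. \<zeta> k powi (h - j))) - c * (\<Sum>k<n. \<zeta> k powi (0 - j))"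
      unfolding sum_subtractf sum_distrib_left by (subst sum.swap) (rule refl)
    also have "\<dots> = (\<Sum>h\<in>F. \<kappa> h * (if h - j = 0 then of_nat n else 0)) - c * (if 0 - j = 0 then of_nat n else 0)"
    proof -
      have "(\<Sum>h\<in>F. \<kappa> h * (\<Sum>k<n. \<zeta> k powi (h - j))) = (\<Sum>h\<in>F. \<kappa> h * (if h - j = 0 then of_nat n else 0))"
        by (intro sum.cong refl) (simp only: root[OF n(2)[OF insertI2]])
      then show ?thesis using root[OF n(2)[of 0]] by simp
    qed
    also have "(\<Sum>h\<in>F. \<kappa> h * (if h - j = 0 then of_nat n else 0)) = (\<Sum>h\<in>F. if h = j then \<kappa> j * of_nat n else 0)"
      by (intro sum.cong) auto
    also have "\<dots> = \<kappa> j * of_nat n" using F by simp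
    also have "\<kappa> j * of_nat n - c * (if 0 - j = 0 then of_nat n else 0) = of_nat n * (\<kappa> j - ?c)"
      by (simp add: right_diff_distrib)
    finally have avg: "(\<Sum>k<n. \<zeta> k powi (-j) * ((\<Sum>h\<in>F. \<kappa> h * \<zeta> k powi h) - c)) = of_nat n * (\<kappa> j - ?c)" .
    have "norm (\<Sum>k<n. \<zeta> k powi (-j) * ((\<Sum>h\<in>F. \<kappa> h * \<zeta> k powi h) - c)) \<le> (\<Sum>k<n. \<epsilon>)"
      by (rule sum_norm_le) (use near[OF \<zeta>(1)] in \<open>simp add: norm_mult norm_power_int \<zeta>(1)\<close>)
    then have "real n * norm (\<kappa> j - ?c) \<le> real n * \<epsilon>"
      unfolding avg by (simp add: norm_mult)
    then show ?thesis using n(1)[of 0] by simp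
  qed
  then have "norm (\<kappa> j - ?c) \<le> 0" by (rule field_le_epsilon[of _ 0, simplified])
  then show ?thesis by simp
qed

text \<open>
With $S$ the backshift, the filter $\psi(S^{\mp 1})$ multiplies the generating function by
$\psi(z^{\mp 1})$.  The double
series converges absolutely on the circle, so the order of summation may be exchanged.  The sign $e$ covers
the filter in the first and in the second argument of an autocovariance.
\<close>

lemma Laurent_convolution:
  fixes \<gamma> :: "int \<Rightarrow> real" and \<psi> :: "nat \<Rightarrow> real" and e :: int and z :: complex
  assumes psi: "summable (\<lambda>j. \<bar>\<psi> j\<bar>)" and z: "norm z = 1"
    and Psi: "(\<lambda>j. of_real (\<psi> j) * (z powi (- e)) ^ j) sums \<Psi>"
    and gam1: "(\<lambda>h. of_real (\<gamma> h) :: complex) summable_on UNIV"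
    and gam: "((\<lambda>h. of_real (\<gamma> h) * z powi h) has_sum G) UNIV"
  shows "((\<lambda>h. of_real (\<Sum>j. \<psi> j * \<gamma> (h + e * int j)) * z powi h) has_sum (\<Psi> * G)) UNIV"
proof -
  have z0: "z \<noteq> 0" using z by auto
  define f where "f = (\<lambda>(j::nat, h::int). complex_of_real (\<psi> j * \<gamma> (h + e * int j)) * z powi h)"
  have bij: "bij_betw (\<lambda>h. h + e * int j) UNIV UNIV" for j
    by (rule bij_betwI[of _ _ _ "\<lambda>h. h - e * int j"]) auto
  have nf: "norm (f (j, h)) = \<bar>\<psi> j\<bar> * \<bar>\<gamma> (h + e * int j)\<bar>" for j h
    using z by (simp add: f_def norm_mult norm_power_int abs_mult)
  have "(\<lambda>h. norm (complex_of_real (\<gamma> h))) summable_on UNIV"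
    using gam1 by (rule summable_on_iff_abs_summable_on_complex[THEN iffD1])
  then have "(\<lambda>h. \<bar>\<gamma> h\<bar>) summable_on UNIV" by simp
  then obtain S where S: "((\<lambda>h. \<bar>\<gamma> h\<bar>) has_sum S) UNIV" by (auto simp: summable_on_def)
  have gb: "\<bar>\<gamma> h\<bar> \<le> S" for h
    using finite_sum_le_has_sum[OF S, of "{h}"] by simp
  have psi_hs: "(\<lambda>j. \<bar>\<psi> j\<bar>) summable_on UNIV"
    using psi by (intro norm_summable_imp_summable_on) simp
  have "(\<lambda>x. norm (f x)) summable_on (UNIV \<times> UNIV)"
  proof (rule summable_on_SigmaI)
    show "((\<lambda>h. norm (f (j, h))) has_sum (\<bar>\<psi> j\<bar> * S)) UNIV" for j
    proof -
      have "((\<lambda>h. \<bar>\<gamma> (h + e * int j)\<bar>) has_sum S) UNIV"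
        using has_sum_reindex_bij_betw[OF bij[of j], of "\<lambda>h. \<bar>\<gamma> h\<bar>" S] S by simp
      then show ?thesis unfolding nf by (rule has_sum_cmult_right)
    qed
    show "(\<lambda>j. \<bar>\<psi> j\<bar> * S) summable_on UNIV" by (rule summable_on_cmult_left[OF psi_hs])
  qed simp
  then have fs: "f summable_on (UNIV \<times> UNIV)" by (rule abs_summable_summable)
  have tot: "(f has_sum (\<Psi> * G)) (UNIV \<times> UNIV)"
  proof (rule has_sum_SigmaI[OF _ _ fs])
    fix j :: nat
    have "((\<lambda>h. of_real (\<gamma> (h + e * int j)) * z powi (h + e * int j)) has_sum G) UNIV"
      using has_sum_reindex_bij_betw[OF bij[of j], of "\<lambda>h. of_real (\<gamma> h) * z powi h" G] gam by simp
    then have "((\<lambda>h. (of_real (\<psi> j) * (z powi (- e)) ^ j) * (of_real (\<gamma> (h + e * int j)) * z powi (h + e * int j)))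
       has_sum (of_real (\<psi> j) * (z powi (- e)) ^ j) * G) UNIV"
      by (rule has_sum_cmult_right)
    moreover have "(of_real (\<psi> j) * (z powi (- e)) ^ j) * (of_real (\<gamma> (h + e * int j)) * z powi (h + e * int j)) = f (j, h)" for h
    proof -
      have "(z powi (- e)) ^ j = z powi (- e * int j)"
        by (simp only: power_int_mult power_int_of_nat)
      moreover have "z powi (- e * int j) * z powi (h + e * int j) = z powi h"
        using z0 by (subst power_int_add[symmetric]) auto
      ultimately show ?thesis by (simp add: f_def mult_ac)
    qed
    ultimately show "((\<lambda>h. f (j, h)) has_sum (of_real (\<psi> j) * (z powi (- e)) ^ j) * G) UNIV" by simp
  next
    have "summable (\<lambda>j. norm (complex_of_real (\<psi> j) * (z powi (- e)) ^ j))"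
      using psi z by (simp add: norm_mult norm_power norm_power_int)
    then have "((\<lambda>j. of_real (\<psi> j) * (z powi (- e)) ^ j) has_sum \<Psi>) UNIV"
      using Psi by (rule norm_summable_imp_has_sum)
    then show "((\<lambda>j. of_real (\<psi> j) * (z powi (- e)) ^ j * G) has_sum \<Psi> * G) UNIV"
      by (rule has_sum_cmult_left)
  qed
  have "bij_betw prod.swap ((UNIV :: int set) \<times> (UNIV :: nat set)) (UNIV \<times> UNIV)"
    by (rule bij_betwI[of _ _ _ prod.swap]) auto
  from has_sum_reindex_bij_betw[OF this, of f "\<Psi> * G"]
  have "((\<lambda>x. f (prod.swap x)) has_sum (\<Psi> * G)) (UNIV \<times> UNIV)" using tot by (simp only:)
  then show ?thesis
  proof (rule has_sum_SigmaD)
    fix h :: int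
    have sm: "summable (\<lambda>j. \<bar>\<psi> j * \<gamma> (h + e * int j)\<bar>)"
    proof (rule summable_comparison_test'[OF summable_mult2[OF psi, of S], of 0])
      fix j
      show "norm \<bar>\<psi> j * \<gamma> (h + e * int j)\<bar> \<le> \<bar>\<psi> j\<bar> * S"
        unfolding real_norm_def abs_abs abs_mult by (rule mult_left_mono[OF gb]) simp
    qed
    then have "(\<lambda>j. \<psi> j * \<gamma> (h + e * int j)) sums (\<Sum>j. \<psi> j * \<gamma> (h + e * int j))"
      by (rule summable_sums[OF summable_rabs_cancel])
    then have "((\<lambda>j. \<psi> j * \<gamma> (h + e * int j)) has_sum (\<Sum>j. \<psi> j * \<gamma> (h + e * int j))) UNIV"
      using sm by (intro norm_summable_imp_has_sum) simp_all
    then have "((\<lambda>j. complex_of_real (\<psi> j * \<gamma> (h + e * int j))) has_sum of_real (\<Sum>j. \<psi> j * \<gamma> (h + e * int j))) UNIV"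
      by (rule has_sum_of_real_iff[THEN iffD2])
    then have "((\<lambda>j. complex_of_real (\<psi> j * \<gamma> (h + e * int j)) * z powi h) has_sum of_real (\<Sum>j. \<psi> j * \<gamma> (h + e * int j)) * z powi h) UNIV"
      by (rule has_sum_cmult_left)
    then show "((\<lambda>j. f (prod.swap (h, j))) has_sum of_real (\<Sum>j. \<psi> j * \<gamma> (h + e * int j)) * z powi h) UNIV"
      by (simp add: f_def)
  qed
qed

section \<open>ARMA representation from a rational spectrum\<close>

lemma ar_charpoly_coeffs:
  assumes "poly \<phi> 0 = 1"
  shows "ar_charpoly (degree \<phi>) (\<lambda>i. - coeff \<phi> i) = \<phi>"
proof (rule poly_eqI)
  fix n
  have "coeff (ar_charpoly (degree \<phi>) (\<lambda>i. - coeff \<phi> i)) n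
      = (if n = 0 then 1 else 0) + (\<Sum>i=1..degree \<phi>. if i = n then coeff \<phi> i else 0)"
    by (simp add: ar_charpoly_def coeff_sum coeff_1 sum_negf[symmetric] cong: if_cong)
  also have "\<dots> = coeff \<phi> n"
    using assms by (cases "n = 0") (auto simp: poly_0_coeff_0 coeff_eq_0)
  finally show "coeff (ar_charpoly (degree \<phi>) (\<lambda>i. - coeff \<phi> i)) n = coeff \<phi> n" .
qed

lemma ma_charpoly_coeffs:
  assumes "poly \<theta> 0 = 1"
  shows "ma_charpoly (degree \<theta>) (coeff \<theta>) = \<theta>"
proof (rule poly_eqI)
  fix n
  have "coeff (ma_charpoly (degree \<theta>) (coeff \<theta>)) n
      = (if n = 0 then 1 else 0) + (\<Sum>i=1..degree \<theta>. if i = n then coeff \<theta> i else 0)"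
    by (simp add: ma_charpoly_def coeff_sum coeff_1 cong: if_cong)
  also have "\<dots> = coeff \<theta> n"
    using assms by (cases "n = 0") (auto simp: poly_0_coeff_0 coeff_eq_0)
  finally show "coeff (ma_charpoly (degree \<theta>) (coeff \<theta>)) n = coeff \<theta> n" .
qed

lemma two_sided_filter_series:
  fixes V :: "int \<Rightarrow> real" and \<psi> :: "nat \<Rightarrow> real"
  assumes "summable (\<lambda>j. \<bar>\<psi> j\<bar>)" "\<And>t. \<bar>V t\<bar> \<le> C"
  shows "summable (\<lambda>j. \<bar>\<psi> j * V (t - int j)\<bar>)"
proof (rule summable_comparison_test'[OF summable_mult2[OF assms(1), of C], of 0])
  fix j
  show "norm \<bar>\<psi> j * V (t - int j)\<bar> \<le> \<bar>\<psi> j\<bar> * C"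
    unfolding real_norm_def abs_abs abs_mult by (rule mult_left_mono[OF assms(2)]) simp
qed

text \<open>
With $S$ the backshift and $\theta \psi = \phi$ as power series, $\theta(S)$ applied to $\psi(S)V$ is
$\phi(S)V$: collect the coefficient of each $V_{t-n}$.
\<close>

lemma filter_inverse_identity:
  fixes V :: "int \<Rightarrow> real" and \<psi> :: "nat \<Rightarrow> real"
  assumes psi: "summable (\<lambda>j. \<bar>\<psi> j\<bar>)" and V: "\<And>t. \<bar>V t\<bar> \<le> C"
    and inv: "fps_of_poly \<theta> * Abs_fps \<psi> = fps_of_poly \<phi>"
  defines "Z \<equiv> \<lambda>t. \<Sum>j. \<psi> j * V (t - int j)"
  shows "(\<Sum>n\<le>degree \<phi>. coeff \<phi> n * V (t - int n)) = (\<Sum>j\<le>degree \<theta>. coeff \<theta> j * Z (t - int j))"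
proof -
  have Zs: "(\<lambda>j. \<psi> j * V (s - int j)) sums Z s" for s
    unfolding Z_def by (rule summable_sums[OF summable_rabs_cancel[OF two_sided_filter_series[OF psi V]]])
  have shifted: "(\<lambda>n. (if j \<le> n then \<psi> (n - j) else 0) * V (t - int n)) sums Z (t - int j)" for j
  proof -
    let ?f = "\<lambda>n. (if j \<le> n then \<psi> (n - j) else 0) * V (t - int n)"
    have "(\<lambda>n. ?f (n + j)) sums Z (t - int j)"
      using Zs[of "t - int j"] by (simp add: algebra_simps)
    moreover have "(\<Sum>i<j. ?f i) = 0" by (rule sum.neutral) auto
    ultimately show ?thesis using sums_iff_shift[of ?f j "Z (t - int j)"] by simp
  qed
  have "(\<lambda>n. \<Sum>j\<le>degree \<theta>. coeff \<theta> j * ((if j \<le> n then \<psi> (n - j) else 0) * V (t - int n))) sums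
      (\<Sum>j\<le>degree \<theta>. coeff \<theta> j * Z (t - int j))"
    by (intro sums_sum sums_mult shifted)
  moreover have "(\<Sum>j\<le>degree \<theta>. coeff \<theta> j * ((if j \<le> n then \<psi> (n - j) else 0) * V (t - int n)))
      = coeff \<phi> n * V (t - int n)" for n
  proof -
    have "(\<Sum>j\<le>degree \<theta>. coeff \<theta> j * (if j \<le> n then \<psi> (n - j) else 0)) = (\<Sum>j\<le>n. coeff \<theta> j * \<psi> (n - j))"
      by (rule sum.mono_neutral_cong) (auto simp: coeff_eq_0)
    also have "\<dots> = fps_nth (fps_of_poly \<theta> * Abs_fps \<psi>) n"
      by (simp add: fps_mult_nth atLeast0AtMost)
    also have "\<dots> = coeff \<phi> n" unfolding inv by simp
    finally show ?thesis by (simp only: mult.assoc[symmetric] sum_distrib_right[symmetric])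
  qed
  ultimately have "(\<lambda>n. coeff \<phi> n * V (t - int n)) sums (\<Sum>j\<le>degree \<theta>. coeff \<theta> j * Z (t - int j))"
    by (simp only:)
  moreover have "(\<lambda>n. coeff \<phi> n * V (t - int n)) sums (\<Sum>n\<le>degree \<phi>. coeff \<phi> n * V (t - int n))"
    by (rule sums_finite) (auto simp: coeff_eq_0)
  ultimately show ?thesis by (rule sums_unique2[rotated])
qed

text \<open>
Boundedness together with absolute summability of $\psi$ allows integrating the filter series term by
term.
\<close>

lemma (in prob_space) integral_filtered_product:
  fixes V :: "int \<Rightarrow> 'a \<Rightarrow> real" and \<psi> :: "nat \<Rightarrow> real"
  assumes psi: "summable (\<lambda>j. \<bar>\<psi> j\<bar>)"
    and Vm: "\<And>t. V t \<in> borel_measurable M" and V: "\<And>t \<omega>. \<bar>V t \<omega>\<bar> \<le> C"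
    and Um: "U \<in> borel_measurable M" and U: "\<And>\<omega>. \<bar>U \<omega>\<bar> \<le> D"
  shows "expectation (\<lambda>\<omega>. U \<omega> * (\<Sum>j. \<psi> j * V (t - int j) \<omega>)) = (\<Sum>j. \<psi> j * expectation (\<lambda>\<omega>. U \<omega> * V (t - int j) \<omega>))"
proof -
  have D: "D \<ge> 0" using U[of undefined] by linarith
  have C: "C \<ge> 0" using V[of 0 undefined] by linarith
  have b: "\<bar>U \<omega> * V s \<omega>\<bar> \<le> D * C" for s \<omega>
    unfolding abs_mult by (rule mult_mono[OF U V D]) simp
  have UV: "integrable M (\<lambda>\<omega>. U \<omega> * V s \<omega>)" for s
  proof (rule integrable_const_bound[of _ "D * C"])
    show "AE \<omega> in M. norm (U \<omega> * V s \<omega>) \<le> D * C" unfolding real_norm_def by (rule AE_I2) (rule b)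
  qed (intro borel_measurable_times Um Vm)
  let ?f = "\<lambda>j \<omega>. \<psi> j * (U \<omega> * V (t - int j) \<omega>)"
  have f: "integrable M (?f j)" for j by (rule integrable_mult_right[OF UV])
  have fb: "norm (?f j \<omega>) \<le> \<bar>\<psi> j\<bar> * (D * C)" for j \<omega>
    unfolding real_norm_def abs_mult[of "\<psi> j"] by (rule mult_left_mono[OF b]) simp
  have sm: "summable (\<lambda>j. \<bar>\<psi> j\<bar> * (D * C))" by (rule summable_mult2[OF psi])
  have "expectation (\<lambda>\<omega>. \<Sum>j. ?f j \<omega>) = (\<Sum>j. expectation (?f j))"
  proof (rule integral_suminf[OF f])
    show "AE \<omega> in M. summable (\<lambda>j. norm (?f j \<omega>))"
    proof (rule AE_I2)
      fix \<omega>
      show "summable (\<lambda>j. norm (?f j \<omega>))"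
        by (rule summable_comparison_test'[OF sm, of 0]) (use fb in simp)
    qed
    show "summable (\<lambda>j. expectation (\<lambda>\<omega>. norm (?f j \<omega>)))"
    proof (rule summable_comparison_test'[OF sm, of 0])
      fix j
      have "expectation (\<lambda>\<omega>. norm (?f j \<omega>)) \<le> expectation (\<lambda>\<omega>. \<bar>\<psi> j\<bar> * (D * C))"
        by (rule integral_mono[OF integrable_norm[OF f] _ fb]) simp
      then have "expectation (\<lambda>\<omega>. norm (?f j \<omega>)) \<le> \<bar>\<psi> j\<bar> * (D * C)" by (simp add: prob_space)
      moreover have "expectation (\<lambda>\<omega>. norm (?f j \<omega>)) \<ge> 0" by (rule Bochner_Integration.integral_nonneg) simp
      ultimately show "norm (expectation (\<lambda>\<omega>. norm (?f j \<omega>))) \<le> \<bar>\<psi> j\<bar> * (D * C)" by simp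
    qed
  qed
  moreover have "(\<Sum>j. ?f j \<omega>) = U \<omega> * (\<Sum>j. \<psi> j * V (t - int j) \<omega>)" for \<omega>
  proof -
    have "summable (\<lambda>j. \<psi> j * V (t - int j) \<omega>)"
      by (rule summable_rabs_cancel[OF two_sided_filter_series[OF psi]]) (rule V)
    from suminf_mult[OF this, of "U \<omega>"] show ?thesis by (simp add: mult_ac)
  qed
  moreover have "expectation (?f j) = \<psi> j * expectation (\<lambda>\<omega>. U \<omega> * V (t - int j) \<omega>)" for j
    by simp
  ultimately show ?thesis by (simp only:)
qed

text \<open>
The noise is $Z_t = \sum_j \psi_j V_{t-j}$ with $\psi = \phi/\theta$ and $V$ the centred process.  Its autocovariance
generating function on the unit circle is $\psi(z)\psi(1/z)$ times that of $V$, which is the constant $c$.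
The bound on $W$ makes the series for $Z$ converge at almost every point, so that no $L^2$ limits are
needed.
\<close>

theorem ARMA_of_rational_spectrum:
  fixes N :: "'b measure" and W :: "int \<Rightarrow> 'b \<Rightarrow> real" and \<gamma> :: "int \<Rightarrow> real"
  assumes N: "prob_space N" and ws: "weakly_stationary N W"
    and bound: "\<And>t. AE \<omega> in N. \<bar>W t \<omega>\<bar> \<le> B"
    and cv: "\<And>s t. cov N (W s) (W t) = \<gamma> (s - t)"
    and gf: "\<And>z. norm z = 1 \<Longrightarrow> ((\<lambda>h. of_real (\<gamma> h) * z powi h) has_sum
        (of_real c * (cpoly \<theta> z * cpoly \<theta> (1 / z)) / (cpoly \<phi> z * cpoly \<phi> (1 / z)))) UNIV"
    and c: "c > 0" and phi0: "poly \<phi> 0 = 1" and th0: "poly \<theta> 0 = 1"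
    and phiz: "\<And>z. cpoly \<phi> z = 0 \<Longrightarrow> norm z > 1" and thz: "\<And>z. cpoly \<theta> z = 0 \<Longrightarrow> norm z > 1"
  shows "ARMA N W (degree \<phi>) (degree \<theta>) (\<lambda>i. - coeff \<phi> i) (coeff \<theta>)"
proof -
  interpret prob_space N by fact
  have Wm: "W t \<in> borel_measurable N" for t 
    using conjunct1[OF ws[unfolded weakly_stationary_def], THEN spec, of t] by (rule conjunct1)
  define V where "V t \<omega> = W t \<omega> - expectation (W t)" for t \<omega>
  define C where "C = 2 * \<bar>B\<bar>"
  \<comment> \<open>$V$ is bounded only almost everywhere; clipping makes the filter series converge at every point.\<close>
  define V' where "V' t \<omega> = (if \<bar>V t \<omega>\<bar> \<le> C then V t \<omega> else 0)" for t \<omega>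
  have Vm: "V t \<in> borel_measurable N" for t unfolding V_def by (intro borel_measurable_diff Wm borel_measurable_const)
  have V'm: "V' t \<in> borel_measurable N" for t
    unfolding V'_def
    by (rule measurable_If) (intro Vm borel_measurable_const borel_measurable_le borel_measurable_abs)+
  have C0: "C \<ge> 0" by (simp add: C_def)
  have V'b: "\<bar>V' t \<omega>\<bar> \<le> C" for t \<omega> using C0 by (simp add: V'_def)
  have Wi: "integrable N (W t)" for t
    by (rule integrable_const_bound[of _ B]) (unfold real_norm_def, rule bound, rule Wm)
  have V_AE: "AE \<omega> in N. V' t \<omega> = V t \<omega>" for t
  proof -
    have "\<bar>expectation (W t)\<bar> \<le> expectation (\<lambda>\<omega>. \<bar>W t \<omega>\<bar>)" by (rule integral_abs_bound)
    also have "\<dots> \<le> expectation (\<lambda>\<omega>. B)"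
      by (rule integral_mono_AE[OF integrable_abs[OF Wi] _ bound]) simp
    finally have "\<bar>expectation (W t)\<bar> \<le> B" by (simp add: prob_space)
    with bound[of t] show ?thesis
    proof (elim eventually_mono)
      fix \<omega> assume "\<bar>expectation (W t)\<bar> \<le> B" "\<bar>W t \<omega>\<bar> \<le> B"
      then have "\<bar>V t \<omega>\<bar> \<le> C" unfolding V_def C_def by linarith
      then show "V' t \<omega> = V t \<omega>" unfolding V'_def by (simp only: if_True)
    qed
  qed
  have EV: "expectation (V' t) = 0" for t
  proof -
    have "expectation (V' t) = expectation (V t)"
      by (rule integral_cong_AE[OF V'm Vm V_AE])
    also have "\<dots> = 0" unfolding V_def using Wi by (simp add: prob_space)
    finally show ?thesis .
  qed
  have EVV: "expectation (\<lambda>\<omega>. V' s \<omega> * V' t \<omega>) = \<gamma> (s - t)" for s t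
  proof -
    have "expectation (\<lambda>\<omega>. V' s \<omega> * V' t \<omega>) = expectation (\<lambda>\<omega>. V s \<omega> * V t \<omega>)"
    proof (rule integral_cong_AE)
      show "AE \<omega> in N. V' s \<omega> * V' t \<omega> = V s \<omega> * V t \<omega>"
        using V_AE[of s] V_AE[of t] by eventually_elim simp
    qed (intro borel_measurable_times Vm V'm)+
    also have "\<dots> = cov N (W s) (W t)" by (simp add: cov_def V_def)
    finally show ?thesis by (simp add: cv)
  qed

  have th_ne: "\<theta> \<noteq> 0" using th0 by auto
  have th_nz: "cpoly \<theta> z \<noteq> 0" if "norm z \<le> 1" for z using thz[of z] that by force
  have phi_nz: "cpoly \<phi> z \<noteq> 0" if "norm z \<le> 1" for z using phiz[of z] that by force
  obtain r where r: "r > 1" "\<And>z. norm z < r \<Longrightarrow> cpoly \<theta> z \<noteq> 0"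
    using zero_free_disc_enlarge[OF th_ne th_nz] by metis
  have "poly \<theta> 0 \<noteq> 0" using th0 by simp
  then obtain \<psi> where inv: "fps_of_poly \<theta> * Abs_fps \<psi> = fps_of_poly \<phi>"
    by (rule rational_power_series_exists)
  have "summable (\<lambda>n. norm (complex_of_real (\<psi> n) * 1 ^ n))"
    by (rule rational_power_series(1)[OF inv r(2)]) (use r(1) in auto)
  then have psi: "summable (\<lambda>j. \<bar>\<psi> j\<bar>)" by simp
  have Psi: "(\<lambda>j. complex_of_real (\<psi> j) * z ^ j) sums (cpoly \<phi> z / cpoly \<theta> z)" if "norm z = 1" for z
    by (rule rational_power_series(2)[OF inv r(2)]) (use r(1) that in auto)

  define Z where "Z t \<omega> = (\<Sum>j. \<psi> j * V' (t - int j) \<omega>)" for t \<omega>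
  have Zm: "Z t \<in> borel_measurable N" for t
    unfolding Z_def by (intro borel_measurable_suminf borel_measurable_times V'm borel_measurable_const)
  define D where "D = (\<Sum>j. \<bar>\<psi> j\<bar>) * C"
  have Zb: "\<bar>Z t \<omega>\<bar> \<le> D" for t \<omega>
  proof -
    have "norm (Z t \<omega>) \<le> (\<Sum>j. \<bar>\<psi> j\<bar> * C)"
      unfolding Z_def
    proof (rule norm_suminf_le)
      show "norm (\<psi> j * V' (t - int j) \<omega>) \<le> \<bar>\<psi> j\<bar> * C" for j
        unfolding real_norm_def abs_mult by (rule mult_left_mono[OF V'b]) simp
    qed (rule summable_mult2[OF psi])
    then show ?thesis unfolding D_def using suminf_mult2[OF psi, of C] by simp
  qed
  have EZ: "expectation (Z t) = 0" for t
  proof -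
    have "expectation (\<lambda>\<omega>. 1 * Z t \<omega>) = (\<Sum>j. \<psi> j * expectation (\<lambda>\<omega>. 1 * V' (t - int j) \<omega>))"
      unfolding Z_def by (rule integral_filtered_product[OF psi V'm V'b, of _ 1]) simp_all
    then show ?thesis by (simp add: EV)
  qed
  \<comment> \<open>The cross-covariances of $V$ and $Z$, and the autocovariances of $Z$.\<close>
  define \<kappa>1 where "\<kappa>1 h = (\<Sum>j. \<psi> j * \<gamma> (h + 1 * int j))" for h
  define \<kappa> where "\<kappa> h = (\<Sum>j. \<psi> j * \<kappa>1 (h + (- 1) * int j))" for h
  have VZ: "expectation (\<lambda>\<omega>. V' u \<omega> * Z s \<omega>) = \<kappa>1 (u - s)" for u s
  proof -
    have "expectation (\<lambda>\<omega>. V' u \<omega> * Z s \<omega>) = (\<Sum>j. \<psi> j * expectation (\<lambda>\<omega>. V' u \<omega> * V' (s - int j) \<omega>))"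
      unfolding Z_def by (rule integral_filtered_product[OF psi V'm V'b V'm V'b])
    then show ?thesis unfolding EVV \<kappa>1_def by (simp add: algebra_simps)
  qed
  have ZZ: "expectation (\<lambda>\<omega>. Z s \<omega> * Z t \<omega>) = \<kappa> (t - s)" for s t
  proof -
    have "expectation (\<lambda>\<omega>. Z s \<omega> * Z t \<omega>) = (\<Sum>j. \<psi> j * expectation (\<lambda>\<omega>. Z s \<omega> * V' (t - int j) \<omega>))"
      by (subst (2) Z_def[abs_def]) (rule integral_filtered_product[OF psi V'm V'b Zm Zb])
    also have "\<dots> = (\<Sum>j. \<psi> j * expectation (\<lambda>\<omega>. V' (t - int j) \<omega> * Z s \<omega>))"
      by (simp only: mult.commute[of "Z s _"])
    also have "\<dots> = \<kappa> (t - s)" unfolding VZ \<kappa>_def by (simp add: algebra_simps)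
    finally show ?thesis .
  qed
  have gf1: "((\<lambda>h. of_real (\<kappa>1 h) * z powi h) has_sum
        (of_real c * cpoly \<theta> z / cpoly \<phi> z)) UNIV" if z: "norm z = 1" for z
  proof -
    have z0: "z \<noteq> 0" and z': "norm (1 / z) = 1" using z by (auto simp: norm_divide)
    have s: "(\<lambda>h. complex_of_real (\<gamma> h)) summable_on UNIV"
      using has_sum_imp_summable[OF gf[of 1]] by simp
    have "((\<lambda>h. of_real (\<kappa>1 h) * z powi h) has_sum (cpoly \<phi> (1 / z) / cpoly \<theta> (1 / z) *
        (of_real c * (cpoly \<theta> z * cpoly \<theta> (1 / z)) / (cpoly \<phi> z * cpoly \<phi> (1 / z))))) UNIV"
      unfolding \<kappa>1_def
    proof (rule Laurent_convolution[OF psi z _ s gf[OF z]])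
      show "(\<lambda>j. complex_of_real (\<psi> j) * (z powi - 1) ^ j) sums (cpoly \<phi> (1 / z) / cpoly \<theta> (1 / z))"
        using Psi[OF z'] by (simp add: power_int_minus inverse_eq_divide)
    qed
    moreover have "cpoly \<phi> (1 / z) / cpoly \<theta> (1 / z) *
        (of_real c * (cpoly \<theta> z * cpoly \<theta> (1 / z)) / (cpoly \<phi> z * cpoly \<phi> (1 / z))) = of_real c * cpoly \<theta> z / cpoly \<phi> z"
      using th_nz[of "1 / z"] phi_nz[of "1 / z"] z' by simp
    ultimately show ?thesis by simp
  qed
  have gf2: "((\<lambda>h. of_real (\<kappa> h) * z powi h) has_sum of_real c) UNIV" if z: "norm z = 1" for z :: complex
  proof -
    have s: "(\<lambda>h. complex_of_real (\<kappa>1 h)) summable_on UNIV"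
      using has_sum_imp_summable[OF gf1[of 1]] by simp
    have "((\<lambda>h. of_real (\<kappa> h) * z powi h) has_sum (cpoly \<phi> z / cpoly \<theta> z * (of_real c * cpoly \<theta> z / cpoly \<phi> z))) UNIV"
      unfolding \<kappa>_def
    proof (rule Laurent_convolution[OF psi z _ s gf1[OF z]])
      show "(\<lambda>j. complex_of_real (\<psi> j) * (z powi - (- 1)) ^ j) sums (cpoly \<phi> z / cpoly \<theta> z)"
        using Psi[OF z] by simp
    qed
    then show ?thesis using th_nz[of z] phi_nz[of z] z by simp
  qed
  have kap: "\<kappa> h = (if h = 0 then c else 0)" for h
  proof -
    have "complex_of_real (\<kappa> h) = (if h = 0 then of_real c else 0)"
      by (rule Laurent_coeffs_of_constant[of "\<lambda>h. of_real (\<kappa> h)"]) (rule gf2)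
    then show ?thesis by (simp split: if_splits)
  qed

  have "white_noise N c Z"
    unfolding white_noise_def
  proof (intro conjI allI)
    fix s t
    show "integrable N (\<lambda>\<omega>. (Z t \<omega>)\<^sup>2)"
    proof (rule integrable_const_bound[of _ "D\<^sup>2"])
      have "(Z t \<omega>)\<^sup>2 \<le> D\<^sup>2" for \<omega> using Zb[of t \<omega>] abs_le_square_iff[of "Z t \<omega>" D] by linarith
      then show "AE \<omega> in N. norm ((Z t \<omega>)\<^sup>2) \<le> D\<^sup>2" by (intro AE_I2) simp
    qed (intro borel_measurable_power Zm)
    show "cov N (Z s) (Z t) = (if s = t then c else 0)"
      unfolding cov_def EZ using ZZ[of s t] by (simp add: kap)
  qed (simp_all add: c Zm EZ)
  moreover have "AE \<omega> in N. V t \<omega> - (\<Sum>i=1..degree \<phi>. - coeff \<phi> i * V (t - int i) \<omega>)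
      = Z t \<omega> + (\<Sum>j=1..degree \<theta>. coeff \<theta> j * Z (t - int j) \<omega>)" for t
  proof -
    have "AE \<omega> in N. \<forall>t. V' t \<omega> = V t \<omega>" using V_AE by (simp add: AE_all_countable)
    then show ?thesis
    proof (rule eventually_mono)
      fix \<omega> assume eq: "\<forall>t. V' t \<omega> = V t \<omega>"
      have "(\<Sum>n\<le>degree \<phi>. coeff \<phi> n * V' (t - int n) \<omega>) = (\<Sum>j\<le>degree \<theta>. coeff \<theta> j * Z (t - int j) \<omega>)"
        unfolding Z_def by (rule filter_inverse_identity[OF psi V'b inv])
      moreover have "(\<Sum>n\<le>d. coeff p n * f n) = coeff p 0 * f 0 + (\<Sum>n=1..d. coeff p n * f n)"
        for d and p :: "real poly" and f :: "nat \<Rightarrow> real"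
      proof -
        have "{..d} = insert 0 {1..d}" by auto
        then show ?thesis by simp
      qed
      ultimately show "V t \<omega> - (\<Sum>i=1..degree \<phi>. - coeff \<phi> i * V (t - int i) \<omega>)
          = Z t \<omega> + (\<Sum>j=1..degree \<theta>. coeff \<theta> j * Z (t - int j) \<omega>)"
        using phi0 th0 eq by (simp add: poly_0_coeff_0 sum_negf)
    qed
  qed
  ultimately show ?thesis using ws unfolding ARMA_def Let_def V_def by blast
qed

section \<open>Superpositions of stationary renewal processes\<close>

theorem theorem1:
  fixes \<Omega> :: "'a measure" and L :: "nat pmf" and P Q :: "real poly"
    and M :: nat and Y :: "nat \<Rightarrow> 'a \<Rightarrow> real"
  assumes "prob_space \<Omega>"
    and "lifetime L"
    and "\<not> lattice_lifetime L"
    and "\<not> shifted_lattice_lifetime L"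
    and "pgf_lowest_terms L P Q"
    and "M \<ge> 1"
    and "renewal_superposition \<Omega> L M Y"
  shows "\<exists>p q a b \<phi> \<theta>.
     \<phi> = ar_charpoly p a \<and> \<theta> = ma_charpoly q b \<and>
     (\<exists>(N :: (int \<Rightarrow> real) measure) W. two_sided_extension \<Omega> Y N W) \<and>
     (\<forall>(N :: 'b measure) W. two_sided_extension \<Omega> Y N W \<longrightarrow>
        causal_invertible_ARMA N W p q a b) \<and>
     poly \<phi> 0 = 1 \<and> poly \<theta> 0 = 1 \<and>
     (\<forall>z. cpoly \<phi> z = 0 \<longrightarrow> norm z > 1) \<and>
     (\<forall>z. cpoly \<theta> z = 0 \<longrightarrow> norm z > 1) \<and>
     \<not> (\<exists>z. cpoly \<phi> z = 0 \<and> cpoly \<theta> z = 0) \<and>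
     (let \<mu> = lifetime_mean L;
          k = lifetime_variance L * (poly Q 1)\<^sup>2 / ((poly \<theta> 1)\<^sup>2 * (poly Q 0)\<^sup>2)
      in \<exists>r>1. \<forall>z. 1 / r < norm z \<and> norm z < r \<longrightarrow>
           ((\<lambda>h::int. complex_of_real (autocov \<Omega> Y h) * z powi h) has_sum
             complex_of_real (k * real M / \<mu>) *
               (cpoly \<theta> z * cpoly \<theta> (1 / z)) / (cpoly \<phi> z * cpoly \<phi> (1 / z))) UNIV)"
proof -
  let ?\<mu> = "lifetime_mean L" and ?\<sigma> = "lifetime_variance L"
  have mean: "?\<mu> > 0" by (rule lifetime_mean_pos[OF assms(2,5)])
  have var: "?\<sigma> > 0" by (rule lifetime_variance_pos[OF assms(2,5)])
  note sup = renewal_superposition_properties[OF assms(1,2) mean assms(6,7)]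
  obtain v where v: "\<And>i h. i \<in> {1..M} \<Longrightarrow> (\<Sum>j\<le>h. measure_pmf.prob L {j<..} * v i (h - j)) = 1"
    and cov_v: "\<And>h. cov \<Omega> (Y 0) (Y h) = (\<Sum>i=1..M. (v i h - 1 / ?\<mu>) / ?\<mu>)"
    using sup(4) by blast
  define u where "u = v 1"
  have u: "(\<Sum>j\<le>h. measure_pmf.prob L {j<..} * u (h - j)) = 1" for h
    unfolding u_def by (rule v) (use assms(6) in simp)
  \<comment> \<open>The renewal equation determines the renewal sequence, so all copies have the same one.\<close>
  have vu: "v i = u" if i: "i \<in> {1..M}" for i
  proof -
    have "(1 - Abs_fps (pmf L)) * Abs_fps (v i) = 1" by (rule renewal_fps[OF v[OF i]])
    moreover have U: "(1 - Abs_fps (pmf L)) * Abs_fps u = 1" by (rule renewal_fps[OF u])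
    ultimately have eq: "(1 - Abs_fps (pmf L)) * Abs_fps (v i) = (1 - Abs_fps (pmf L)) * Abs_fps u" by simp
    have ne: "1 - Abs_fps (pmf L) \<noteq> 0" using U by auto
    have "Abs_fps (v i) = Abs_fps u" by (rule mult_left_cancel[OF ne, THEN iffD1, OF eq])
    then have "fps_nth (Abs_fps (v i)) h = fps_nth (Abs_fps u) h" for h by (rule arg_cong)
    then show ?thesis by (simp add: fun_eq_iff)
  qed
  have cov_u: "cov \<Omega> (Y 0) (Y h) = real M / ?\<mu> * (u h - 1 / ?\<mu>)" for h
  proof -
    have "cov \<Omega> (Y 0) (Y h) = (\<Sum>i=1..M. (u h - 1 / ?\<mu>) / ?\<mu>)"
      unfolding cov_v by (rule sum.cong) (simp_all add: vu)
    then show ?thesis by simp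
  qed
  show ?thesis
  proof (rule renewal_covariance_factorization[OF assms(2,4,5) u])
    fix \<phi> \<theta> :: "real poly" and r :: real
    assume phi0: "poly \<phi> 0 = 1" and th0: "poly \<theta> 0 = 1"
      and phiz: "\<And>z. cpoly \<phi> z = 0 \<Longrightarrow> norm z > 1"
      and thz: "\<And>z. cpoly \<theta> z = 0 \<Longrightarrow> norm z > 1"
      and cop: "\<And>z. cpoly \<phi> z = 0 \<Longrightarrow> cpoly \<theta> z \<noteq> 0"
      and Q: "poly Q 0 \<noteq> 0" "poly Q 1 \<noteq> 0" and th1: "poly \<theta> 1 \<noteq> 0" and r: "r > 1"
      and gf: "\<And>z. 1 / r < norm z \<Longrightarrow> norm z < r \<Longrightarrow>
         ((\<lambda>h::int. complex_of_real (u (nat \<bar>h\<bar>) - 1 / ?\<mu>) * z powi h) has_sum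
           of_real (?\<sigma> * (poly Q 1)\<^sup>2 / ((poly \<theta> 1)\<^sup>2 * (poly Q 0)\<^sup>2)) *
           (cpoly \<theta> z * cpoly \<theta> (1 / z)) / (cpoly \<phi> z * cpoly \<phi> (1 / z))) UNIV"
    define k where "k = ?\<sigma> * (poly Q 1)\<^sup>2 / ((poly \<theta> 1)\<^sup>2 * (poly Q 0)\<^sup>2)"
    have k: "k > 0" unfolding k_def using var Q th1 by simp
    have Gf: "((\<lambda>h::int. complex_of_real (autocov \<Omega> Y h) * z powi h) has_sum
        of_real (k * real M / ?\<mu>) * (cpoly \<theta> z * cpoly \<theta> (1 / z)) / (cpoly \<phi> z * cpoly \<phi> (1 / z))) UNIV"
      if z: "1 / r < norm z" "norm z < r" for z
    proof -
      have "((\<lambda>h::int. of_real (real M / ?\<mu>) * (complex_of_real (u (nat \<bar>h\<bar>) - 1 / ?\<mu>) * z powi h)) has_sum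
          of_real (real M / ?\<mu>) * (of_real k * (cpoly \<theta> z * cpoly \<theta> (1 / z)) / (cpoly \<phi> z * cpoly \<phi> (1 / z)))) UNIV"
        unfolding k_def by (rule has_sum_cmult_right[OF gf[OF z]])
      moreover have "of_real (real M / ?\<mu>) * (complex_of_real (u (nat \<bar>h\<bar>) - 1 / ?\<mu>) * z powi h)
          = complex_of_real (autocov \<Omega> Y h) * z powi h" for h
        unfolding autocov_def cov_u of_real_mult by (simp only: mult.assoc)
      moreover have "of_real (real M / ?\<mu>) * (of_real k * (cpoly \<theta> z * cpoly \<theta> (1 / z)) / (cpoly \<phi> z * cpoly \<phi> (1 / z)))
          = of_real (k * real M / ?\<mu>) * (cpoly \<theta> z * cpoly \<theta> (1 / z)) / (cpoly \<phi> z * cpoly \<phi> (1 / z))"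
        by simp
      ultimately show ?thesis by (simp only:)
    qed
    let ?a = "\<lambda>i. - coeff \<phi> i" and ?b = "coeff \<theta>"
    have ar: "ar_charpoly (degree \<phi>) ?a = \<phi>" by (rule ar_charpoly_coeffs[OF phi0])
    have ma: "ma_charpoly (degree \<theta>) ?b = \<theta>" by (rule ma_charpoly_coeffs[OF th0])
    have arma: "causal_invertible_ARMA N W (degree \<phi>) (degree \<theta>) ?a ?b"
      if ext: "two_sided_extension \<Omega> Y N W" for N :: "'b measure" and W
    proof -
      note mom = two_sided_extension_moments[OF ext sup(1) sup(3)]
      have "ARMA N W (degree \<phi>) (degree \<theta>) ?a ?b"
      proof (rule ARMA_of_rational_spectrum[OF _ mom(1) mom(2)])
        show "prob_space N" using ext unfolding two_sided_extension_def by (rule conjunct1)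
        show "cov N (W s) (W t) = autocov \<Omega> Y (s - t)" for s t
          unfolding autocov_def by (rule mom(3))
        show "k * real M / ?\<mu> > 0" using k mean assms(6) by simp
        show "((\<lambda>h. complex_of_real (autocov \<Omega> Y h) * z powi h) has_sum
            of_real (k * real M / ?\<mu>) * (cpoly \<theta> z * cpoly \<theta> (1 / z)) / (cpoly \<phi> z * cpoly \<phi> (1 / z))) UNIV"
          if "norm z = 1" for z
          by (rule Gf) (use that r in auto)
      qed (assumption | fact phi0 th0 phiz thz)+
      moreover have "cpoly \<phi> z \<noteq> 0" "cpoly \<theta> z \<noteq> 0" if "norm z \<le> 1" for z
        using phiz[of z] thz[of z] that by linarith+
      ultimately show ?thesis unfolding causal_invertible_ARMA_def ar ma by blast
    qed
    have ex: "\<exists>(N :: (int \<Rightarrow> real) measure) W. two_sided_extension \<Omega> Y N W"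
      by (rule Kolmogorov_two_sided[OF assms(1) sup(1,2)])
    show ?thesis
    proof (rule exI[of _ "degree \<phi>"], rule exI[of _ "degree \<theta>"], rule exI[of _ ?a],
        rule exI[of _ ?b], rule exI[of _ \<phi>], rule exI[of _ \<theta>], intro conjI)
      show "\<phi> = ar_charpoly (degree \<phi>) ?a" "\<theta> = ma_charpoly (degree \<theta>) ?b" by (rule ar[symmetric], rule ma[symmetric])
      show "\<exists>(N :: (int \<Rightarrow> real) measure) W. two_sided_extension \<Omega> Y N W" by (rule ex)
      show "\<forall>(N :: 'b measure) W. two_sided_extension \<Omega> Y N W \<longrightarrow>
          causal_invertible_ARMA N W (degree \<phi>) (degree \<theta>) ?a ?b" using arma by blast
      show "\<forall>z. cpoly \<phi> z = 0 \<longrightarrow> norm z > 1" "\<forall>z. cpoly \<theta> z = 0 \<longrightarrow> norm z > 1"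
        using phiz thz by blast+
      show "\<not> (\<exists>z. cpoly \<phi> z = 0 \<and> cpoly \<theta> z = 0)" using cop by blast
      show "let \<mu> = ?\<mu>; k = ?\<sigma> * (poly Q 1)\<^sup>2 / ((poly \<theta> 1)\<^sup>2 * (poly Q 0)\<^sup>2)
        in \<exists>r>1. \<forall>z. 1 / r < norm z \<and> norm z < r \<longrightarrow>
             ((\<lambda>h::int. complex_of_real (autocov \<Omega> Y h) * z powi h) has_sum
               complex_of_real (k * real M / \<mu>) *
                 (cpoly \<theta> z * cpoly \<theta> (1 / z)) / (cpoly \<phi> z * cpoly \<phi> (1 / z))) UNIV"
        unfolding Let_def k_def[symmetric]
        by (intro exI[of _ r] conjI allI impI r) (rule Gf; blast)
    qed (fact phi0 th0)+
  qed
qed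

end
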